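(* Let $N$ be large, let $M\le2\sqrt N$, and set $c=M^2/(4N)$. (1) $$\sum_{n\le N}|\mathcal{A}(n,M)|=\frac{\kappa'}{2}\cdot I(c)\cdot M N^{1/2}\left((2\log M)^{1/2}+O(1)\right).$$ (2) $$\sum_{n\le N}\binom{|\mathcal{A}(n,M)|}{2}\ll N^{1/3}M^{4/3}(\log N)^6+N^{1/2}(\log N)^3.$$
   Context: Let $\mathcal{U}=\{1,-1,i,-i\}$ be the units of $\mathbb{Z}[i]$. For a positive integer $n$ and $M>0$ let $$S(n,M)=\{(\alpha,\beta,u)\in\mathbb{Z}[i]^2\times\mathcal{U}:\ |\alpha|\,|\beta|=\sqrt n,\ |\alpha|\,|\beta-u\overline\beta|\le M,\ \gcd(\beta,\overline\beta)=1 \text{ in } \mathbb{Z}[i]\}.$$ For $(\alpha,\beta,u)\in S(n,M)$ let $A(\alpha,\beta,u)=\{(\alpha',\beta w,uw^2):\ \alpha'\in\mathbb{Z}[i],\ |\alpha'|=|\alpha|,\ w\in\mathcal{U}\}$ and $A^*(\alpha,\beta,u)=A(\alpha,\beta,u)\cup A(\overline\alpha,\overline\beta,\overline u)$. Let $\mathcal{A}(n,M)=\{A^*(\alpha,\beta,u):(\alpha,\beta,u)\in S(n,M)\}$ (a set of sets, so $|\mathcal{A}(n,M)|$ is the number of distinct classes). Let $\kappa'=\prod_{p\equiv1\ (\mathrm{mod}\ 4)}(1-1/p^2)^{1/2}$ and $I(c)=\frac4\pi\int_0^1(1-ct^2)^{1/2}dt$.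
   Formalization: S(n,M) also requires |α||β−uβ̄|>0; otherwise the triples (α,1,1) add a class for every n that is a sum of two squares, and both (1) and (2) fail for small M. Part (1) is stated for 1≤M≤2√N, so that (2 log M)^{1/2} is defined, and part (2) for 0<M≤2√N. *)

theory Defs
  imports "HOL-Analysis.Analysis" "HOL-Computational_Algebra.Primes"
begin

definition gauss_ints :: "complex set" where
  "gauss_ints = {z. Re z \<in> \<int> \<and> Im z \<in> \<int>}"

definition gauss_units :: "complex set" where
  "gauss_units = {1, -1, \<i>, -\<i>}"

definition gauss_dvd :: "complex \<Rightarrow> complex \<Rightarrow> bool" where
  "gauss_dvd d z \<longleftrightarrow> (\<exists>q\<in>gauss_ints. z = d * q)"

definition gauss_coprime :: "complex \<Rightarrow> complex \<Rightarrow> bool" where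
  "gauss_coprime x y \<longleftrightarrow>
     (\<forall>d\<in>gauss_ints. gauss_dvd d x \<longrightarrow> gauss_dvd d y \<longrightarrow> d \<in> gauss_units)"

text \<open>
  A triple stands for the two lattice points \<open>\<alpha> * \<beta>\<close> and \<open>\<alpha> * u * cnj \<beta>\<close> on the circle of
  radius \<open>sqrt n\<close>, at distance at most \<open>M\<close>.  The two points are required to be distinct (the lower
  bound \<open>0 <\<close>).  For coprime \<open>\<beta>\<close> and \<open>cnj \<beta>\<close> this excludes exactly the triples with \<open>\<beta>\<close> a unit
  and \<open>u = \<beta>\<^sup>2\<close>.  These would form one further class for every \<open>n\<close> that is a sum of two squares,
  whatever \<open>M\<close>, and so contribute a term of order \<open>N / sqrt (ln N)\<close> to the sum of the class
  numbers, which the asymptotic formula does not contain.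
\<close>
definition S_set :: "nat \<Rightarrow> real \<Rightarrow> (complex \<times> complex \<times> complex) set" where
  "S_set n M = {(\<alpha>, \<beta>, u). \<alpha> \<in> gauss_ints \<and> \<beta> \<in> gauss_ints \<and> u \<in> gauss_units \<and>
     cmod \<alpha> * cmod \<beta> = sqrt (real n) \<and>
     0 < cmod \<alpha> * cmod (\<beta> - u * cnj \<beta>) \<and>
     cmod \<alpha> * cmod (\<beta> - u * cnj \<beta>) \<le> M \<and>
     gauss_coprime \<beta> (cnj \<beta>)}"

definition A_class :: "complex \<Rightarrow> complex \<Rightarrow> complex \<Rightarrow> (complex \<times> complex \<times> complex) set" where
  "A_class \<alpha> \<beta> u =
     {(\<alpha>', \<beta> * w, u * w\<^sup>2) | \<alpha>' w. \<alpha>' \<in> gauss_ints \<and> cmod \<alpha>' = cmod \<alpha> \<and> w \<in> gauss_units}"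

definition A_star :: "complex \<Rightarrow> complex \<Rightarrow> complex \<Rightarrow> (complex \<times> complex \<times> complex) set" where
  "A_star \<alpha> \<beta> u = A_class \<alpha> \<beta> u \<union> A_class (cnj \<alpha>) (cnj \<beta>) (cnj u)"

definition A_family :: "nat \<Rightarrow> real \<Rightarrow> (complex \<times> complex \<times> complex) set set" where
  "A_family n M = {A_star \<alpha> \<beta> u | \<alpha> \<beta> u. (\<alpha>, \<beta>, u) \<in> S_set n M}"

definition kappa' :: real where
  "kappa' = (\<Prod>p::nat. if prime p \<and> p mod 4 = 1 then sqrt (1 - 1 / (real p)\<^sup>2) else 1)"

definition I_fun :: "real \<Rightarrow> real" where
  "I_fun c = 4 / pi * integral {0..1} (\<lambda>t. sqrt (1 - c * t\<^sup>2))"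

end

theory Submission
  imports Defs "HOL-Number_Theory.Number_Theory" "HOL-Computational_Algebra.Squarefree"
    "HOL-Real_Asymp.Real_Asymp"
begin

text \<open>
  For fixed \<open>n\<close> a class is determined by the real part of the rotation \<open>u * cnj \<beta> / \<beta>\<close>.

  Part 1. Let \<open>G\<close> be the set of squarefree products of primes congruent to 1 mod 4. By the theorem on
  sums of two squares, classes correspond bijectively to quadruples \<open>(e, m, X, Y)\<close> with \<open>e \<in> {1, 2}\<close>,
  \<open>m \<in> G\<close>, \<open>X \<ge> 0\<close>, \<open>Y \<ge> 1\<close>, \<open>X\<close> and \<open>Y\<close> of equal parity if \<open>e = 2\<close>, and \<open>m (X\<^sup>2 + Y\<^sup>2) = e n\<close>; the
  distance condition becomes \<open>4 m Y\<^sup>2 \<le> e M\<^sup>2\<close>. Counting lattice points for each \<open>m\<close> with error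
  \<open>O(sqrt (N / m))\<close> leaves the sum of \<open>1 / m\<close> over \<open>m \<in> G\<close>, \<open>m \<le> x\<close>. Mertens' theorem for primes
  congruent to 1 mod 4 yields a relation between this sum and its logarithmic integral which forces
  the shape \<open>C * sqrt (ln x) + O(1)\<close>, and comparing Dirichlet series as \<open>s \<rightarrow> 1\<close> gives
  \<open>C = 2 * kappa' / pi\<close>.

  Part 2. Two distinct classes for the same \<open>n\<close> have \<open>\<beta>\<^sub>1 = \<delta> \<epsilon> \<gamma>\<^sub>1\<close> and \<open>\<beta>\<^sub>2 = \<delta> (cnj \<epsilon>) \<gamma>\<^sub>2\<close> with
  \<open>n = k |\<delta> \<epsilon> \<gamma>\<^sub>1 \<gamma>\<^sub>2|\<^sup>2\<close>. Any two of the four factors fix the directions of the other two up to an angle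
  \<open>O(M / sqrt n)\<close>, and a nonzero difference of the two rotations cannot be too small, which bounds
  \<open>k |\<delta>|\<^sup>2 / |\<epsilon>|\<^sup>2\<close>, \<open>k |\<epsilon>|\<^sup>2 / |\<delta>|\<^sup>2\<close> and \<open>k |\<gamma>\<^sub>i|\<^sup>2\<close> by \<open>O(M\<^sup>2)\<close>. Summing over dyadic ranges of the five
  parameters gives \<open>O(N\<^sup>1\<^sup>/\<^sup>3 M\<^sup>4\<^sup>/\<^sup>3 (ln N)\<^sup>5)\<close>.
\<close>


section \<open>Mertens' theorem for primes congruent to 1 modulo 4\<close>

lemma abel_bound:
  fixes c f :: "nat \<Rightarrow> real"
  assumes K: "\<And>n. n \<ge> a \<Longrightarrow> \<bar>\<Sum>k=a..n. c k\<bar> \<le> K"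
    and dec: "\<And>n. n \<ge> a \<Longrightarrow> f (Suc n) \<le> f n"
    and nonneg: "\<And>n. n \<ge> a \<Longrightarrow> 0 \<le> f n"
    and "a \<le> b"
  shows "\<bar>\<Sum>k=a..b. c k * f k\<bar> \<le> K * f a"
proof -
  define X where "X n = (\<Sum>k=a..n. c k)" for n
  have id: "(\<Sum>k=a..b. c k * f k) = X b * f b + (\<Sum>k=a..<b. X k * (f k - f (Suc k)))"
    using \<open>a \<le> b\<close>
  proof (induction b rule: dec_induct)
    case base then show ?case by (simp add: X_def)
  next
    case (step n)
    then show ?case by (simp add: X_def algebra_simps)
  qed
  have tel: "(\<Sum>k=a..<b. f k - f (Suc k)) = f a - f b"
    using \<open>a \<le> b\<close> by (induction b rule: dec_induct) auto
  have "\<bar>\<Sum>k=a..b. c k * f k\<bar> \<le> \<bar>X b * f b\<bar> + (\<Sum>k=a..<b. \<bar>X k * (f k - f (Suc k))\<bar>)"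
    unfolding id by (intro order.trans[OF abs_triangle_ineq] add_mono sum_abs order.refl)
  also have "0 \<le> K" using K[OF order.refl] by linarith
  then have "\<bar>X b * f b\<bar> + (\<Sum>k=a..<b. \<bar>X k * (f k - f (Suc k))\<bar>) \<le> K * f b + (\<Sum>k=a..<b. K * (f k - f (Suc k)))"
    using K dec nonneg \<open>a \<le> b\<close>
    by (intro add_mono sum_mono) (auto simp: X_def abs_mult intro!: mult_mono)
  also have "\<dots> = K * f a"
    unfolding sum_distrib_left[symmetric] tel by (simp add: algebra_simps)
  finally show ?thesis .
qed

lemma sum_divisors_swap:
  fixes f :: "nat \<Rightarrow> nat \<Rightarrow> real"
  shows "(\<Sum>n=1..N. \<Sum>d | d dvd n. f d n) = (\<Sum>d=1..N. \<Sum>k=1..N div d. f d (d * k))"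
proof -
  have "(\<Sum>n=1..N. \<Sum>d | d dvd n. f d n) = (\<Sum>(n,d)\<in>(SIGMA n:{1..N}. {d. d dvd n}). f d n)"
    by (rule sum.Sigma) auto
  also have "\<dots> = (\<Sum>(d,k)\<in>(SIGMA d:{1..N}. {1..N div d}). f d (d * k))"
  proof (rule sum.reindex_bij_witness[where i = "\<lambda>(d,k). (d*k, d)" and j = "\<lambda>(n,d). (d, n div d)"], goal_cases)
    case (2 a)
    then show ?case by (auto simp: dvd_def Suc_le_eq intro!: div_le_mono)
       (metis div_le_mono nonzero_mult_div_cancel_left not_less_zero le_trans mult_le_mono2 Suc_leI mult.right_neutral One_nat_def)+
  next
    case (4 b)
    then show ?case by (auto simp: less_eq_div_iff_mult_less_eq mult.commute Suc_le_eq)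
  qed auto
  also have "\<dots> = (\<Sum>d=1..N. \<Sum>k=1..N div d. f d (d * k))"
    by (rule sum.Sigma[symmetric]) auto
  finally show ?thesis .
qed

lemma ln_fact_sum: "ln (fact n :: real) = (\<Sum>k=1..n. ln (real k))"
  by (induction n) (simp_all add: ln_mult add.commute)

lemma ln_fact_mangoldt: "ln (fact n :: real) = (\<Sum>d=1..n. mangoldt d * real (n div d))"
proof -
  have "ln (fact n :: real) = (\<Sum>k=1..n. \<Sum>d | d dvd k. mangoldt d)"
    unfolding ln_fact_sum by (intro sum.cong refl) (simp add: mangoldt_sum)
  also have "\<dots> = (\<Sum>d=1..n. mangoldt d * real (n div d))"
    by (subst sum_divisors_swap) (simp add: mult.commute)
  finally show ?thesis .
qed

lemma psi_double: "(\<Sum>d=1..2*n. mangoldt d :: real) \<le> (\<Sum>d=1..n. mangoldt d) + 2 * real n"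
proof -
  have "(\<Sum>d=1..2*n. mangoldt d :: real) - (\<Sum>d=1..n. mangoldt d) = (\<Sum>d=n+1..2*n. mangoldt d)"
    using sum.ub_add_nat[of 1 n "mangoldt :: nat \<Rightarrow> real" n] by (simp add: mult_2)
  also have "\<dots> \<le> (\<Sum>d=n+1..2*n. mangoldt d * (real (2*n div d) - 2 * real (n div d)))"
  proof (intro sum_mono)
    fix d assume d: "d \<in> {n+1..2*n}"
    then have "2 * n div d \<ge> 1" "n div d = 0" by (auto simp: Suc_le_eq div_greater_zero_iff)
    then show "mangoldt d \<le> (mangoldt d :: real) * (real (2*n div d) - 2 * real (n div d))"
      using mangoldt_nonneg[of d] by (simp add: mult_le_cancel_left1)
  qed
  also have "\<dots> \<le> (\<Sum>d=1..2*n. mangoldt d * (real (2*n div d) - 2 * real (n div d)))"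
  proof (intro sum_mono2)
    fix d assume d: "d \<in> {1..2*n} - {n+1..2*n}"
    have "2 * (n div d) * d \<le> 2 * n" by simp
    then have "2 * (n div d) \<le> 2 * n div d"
      using d by (subst less_eq_div_iff_mult_less_eq) auto
    then have "2 * real (n div d) \<le> real (2 * n div d)"
      by (metis of_nat_le_iff of_nat_mult of_nat_numeral)
    then show "0 \<le> (mangoldt d :: real) * (real (2*n div d) - 2 * real (n div d))"
      using mangoldt_nonneg[of d] by simp
  qed auto
  also have "\<dots> = ln (fact (2*n)) - 2 * (\<Sum>d=1..2*n. mangoldt d * real (n div d))"
    by (simp add: ln_fact_mangoldt right_diff_distrib sum_subtractf sum_distrib_left mult_ac)
  also have "(\<Sum>d=1..2*n. mangoldt d * real (n div d)) = (\<Sum>d=1..n. mangoldt d * real (n div d))"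
    by (intro sum.mono_neutral_right) auto
  also have "\<dots> = ln (fact n)" by (simp add: ln_fact_mangoldt)
  also have "ln (fact (2*n)) - 2 * ln (fact n :: real) = ln (real (2*n choose n))"
    by (simp add: binomial_fact ln_div ln_mult)
  also have "\<dots> \<le> ln (2 ^ (2*n))"
  proof -
    have "2 * n choose n \<le> 2 ^ (2*n)" by (rule binomial_le_pow2)
    then have "real (2 * n choose n) \<le> 2 ^ (2*n)"
      by (metis of_nat_le_iff of_nat_numeral of_nat_power)
    moreover have "0 < real (2 * n choose n)" by simp
    ultimately show ?thesis by (intro ln_mono) auto
  qed
  also have "\<dots> = 2 * real n * ln 2" by (simp add: ln_realpow)
  also have "\<dots> \<le> 2 * real n" using ln_2_less_1 mult_left_mono[of "ln 2" 1 "2 * real n"] by simp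
  finally show ?thesis by simp
qed

lemma psi_bound: "(\<Sum>d=1..n. mangoldt d :: real) \<le> 4 * real n"
proof (induction n rule: less_induct)
  case (less n)
  consider "n = 0" | "n = 1" | m where "n = 2 * m" "m \<ge> 1" | m where "n = 2 * m + 1" "m \<ge> 1"
    by (metis One_nat_def add.commute add_0 evenE less_one linorder_not_le mult_0_right oddE)
  then show ?case
  proof cases
    case (3 m)
    then have "(\<Sum>d=1..m. mangoldt d :: real) \<le> 4 * real m" using less by auto
    then show ?thesis using psi_double[of m] 3 by simp
  next
    case (4 m)
    then have "(\<Sum>d=1..m+1. mangoldt d :: real) \<le> 4 * real (m+1)" by (intro less) auto
    moreover have "(\<Sum>d=1..n. mangoldt d :: real) \<le> (\<Sum>d=1..2*(m+1). mangoldt d)"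
      using 4 mangoldt_nonneg by (intro sum_mono2) auto
    ultimately show ?thesis using psi_double[of "m+1"] 4 by simp
  qed auto
qed

lemma ln_fact_lower: "real n * ln (real n) - real n \<le> ln (fact n)"
proof (induction n)
  case (Suc n)
  show ?case
  proof (cases "n = 0")
    case False
    have "ln (real (Suc n)) - ln (real n) = ln (1 + 1 / real n)"
      using False ln_div[of "real (Suc n)" "real n"] by (simp add: add_divide_distrib add.commute)
    also have "\<dots> \<le> 1 / real n" by (rule ln_add_one_self_le_self) auto
    finally have "real n * (ln (real (Suc n)) - ln (real n)) \<le> 1"
      using False by (simp add: field_simps)
    moreover have "ln (fact (Suc n) :: real) = ln (real (Suc n)) + ln (fact n)"
      unfolding ln_fact_sum by simp
    ultimately show ?thesis using Suc by (simp add: algebra_simps)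
  qed auto
qed auto

lemma ln_fact_upper: "ln (fact n) \<le> real n * ln (real n)"
proof -
  have "ln (fact n :: real) \<le> (\<Sum>k=1..n. ln (real n))"
    unfolding ln_fact_sum by (intro sum_mono) auto
  then show ?thesis by simp
qed

lemma mertens_mangoldt:
  assumes "n \<ge> 1"
  shows "\<bar>(\<Sum>d=1..n. mangoldt d / real d) - ln (real n)\<bar> \<le> 5"
proof -
  have "\<bar>real n * (\<Sum>d=1..n. mangoldt d / real d) - ln (fact n)\<bar>
      = \<bar>\<Sum>d=1..n. mangoldt d * (real n / real d - real (n div d))\<bar>"
    by (simp add: ln_fact_mangoldt sum_distrib_left sum_subtractf right_diff_distrib mult_ac)
  also have "\<dots> \<le> (\<Sum>d=1..n. mangoldt d * 1)"
  proof (intro order.trans[OF sum_abs] sum_mono)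
    fix d assume "d \<in> {1..n}"
    then have "real (n div d) = real_of_int \<lfloor>real n / real d\<rfloor>" by (simp add: floor_divide_of_nat_eq)
    then have "\<bar>real n / real d - real (n div d)\<bar> \<le> 1" by linarith
    then show "\<bar>mangoldt d * (real n / real d - real (n div d))\<bar> \<le> (mangoldt d :: real) * 1"
      unfolding abs_mult by (intro mult_mono) (auto simp: mangoldt_nonneg)
  qed
  also have "\<dots> \<le> 4 * real n" using psi_bound[of n] by simp
  finally have "\<bar>real n * (\<Sum>d=1..n. mangoldt d / real d) - real n * ln (real n)\<bar> \<le> 5 * real n"
    using ln_fact_lower[of n] ln_fact_upper[of n] by linarith
  then have "real n * \<bar>(\<Sum>d=1..n. mangoldt d / real d) - ln (real n)\<bar> \<le> real n * 5"
    by (simp add: right_diff_distrib[symmetric] abs_mult mult.commute)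
  then show ?thesis using assms by (simp add: mult_le_cancel_left)
qed

definition chi4 :: "nat \<Rightarrow> real" where
  "chi4 n = (if n mod 4 = 1 then 1 else if n mod 4 = 3 then -1 else 0)"

lemma chi4_mult: "chi4 (m * n) = chi4 m * chi4 n"
proof -
  have "m mod 4 \<in> {0,1,2,3}" "n mod 4 \<in> {0,1,2,3}" by auto
  moreover have "m * n mod 4 = (m mod 4) * (n mod 4) mod 4" by (simp add: mod_mult_eq)
  ultimately show ?thesis
    by (elim insertE emptyE) (simp_all add: chi4_def)
qed

lemma abs_chi4_le: "\<bar>chi4 n\<bar> \<le> 1" by (simp add: chi4_def)

lemma sum_chi4_lessThan: "(\<Sum>k<n. chi4 k) = (if n mod 4 \<in> {2,3} then 1 else 0)"
proof (induction n)
  case (Suc n)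
  have "n mod 4 \<in> {0,1,2,3}" by auto
  then show ?case using Suc by (auto simp: chi4_def mod_Suc)
qed auto

lemma sum_chi4_abs_le: "\<bar>\<Sum>k=a..n. chi4 k\<bar> \<le> 1"
proof (cases "a \<le> n")
  case True
  have "(\<Sum>k<Suc n. chi4 k) = (\<Sum>k<a. chi4 k) + (\<Sum>k=a..n. chi4 k)"
  proof -
    have "{..<Suc n} = {..<a} \<union> {a..n}" using True by auto
    then show ?thesis by (simp add: sum.union_disjoint ivl_disj_int)
  qed
  then show ?thesis unfolding sum_chi4_lessThan by (auto split: if_splits)
qed auto

lemma sum_chi4_lessThan_even:
  "(\<Sum>n<2*K. chi4 n / real n) = (\<Sum>k<K. (-1) ^ k * 1 / real (k * 2 + 1))"
proof (induction K)
  case (Suc K)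
  have "chi4 (2 * K) = 0" 
  proof -
    have "2 * K mod 4 \<noteq> 1" "2 * K mod 4 \<noteq> 3" by presburger+
    then show ?thesis by (simp add: chi4_def)
  qed
  moreover have "chi4 (Suc (2 * K)) = (-1) ^ K"
  proof (cases "even K")
    case True then obtain j where "K = 2 * j" by (elim evenE)
    then show ?thesis by (simp add: chi4_def mod_Suc)
  next
    case False then obtain j where "K = 2 * j + 1" by (elim oddE)
    then have "Suc (2 * K) mod 4 = 3" by presburger
    then show ?thesis using False by (simp add: chi4_def)
  qed
  ultimately show ?case using Suc by (simp add: mult.commute)
qed auto

lemma chi4_tail: "\<bar>\<Sum>k=a..n. chi4 k / real k\<bar> \<le> 1 / real a" if "a \<ge> 1"
proof (cases "a \<le> n")
  case True
  have "\<bar>\<Sum>k=a..n. chi4 k * (1 / real k)\<bar> \<le> 1 * (1 / real a)"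
    using that True by (intro abel_bound sum_chi4_abs_le) (auto simp: field_simps)
  then show ?thesis by simp
qed (use that in auto)

lemma chi4_partial: "\<bar>(\<Sum>k=1..n. chi4 k / real k) - pi / 4\<bar> \<le> 1 / (real n + 1)"
proof -
  define S where "S n = (\<Sum>k=1..n. chi4 k / real k)" for n
  have "pi / 4 = (\<Sum>k. (-1) ^ k * 1 / real (k * 2 + 1))"
    by (rule pi_series)
  then have "(\<lambda>K. \<Sum>k<K. (-1) ^ k * 1 / real (k * 2 + 1)) \<longlonglongrightarrow> pi / 4"
    using summable_LIMSEQ[OF summable_arctan_series[of 1]] by (simp only:) (simp add: mult.commute)
  then have lim: "(\<lambda>K. \<Sum>n<2*K. chi4 n / real n) \<longlonglongrightarrow> pi / 4"
    unfolding sum_chi4_lessThan_even .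
  have ev: "\<forall>\<^sub>F K in sequentially. \<bar>S n - (\<Sum>n<2*K. chi4 n / real n)\<bar> \<le> 1 / (real n + 1)"
    using eventually_gt_at_top[of n]
  proof eventually_elim
    case (elim K)
    have "{..<2*K} = insert 0 ({1..n} \<union> {n+1..2*K-1})" using elim by auto
    then have "(\<Sum>n<2*K. chi4 n / real n) = S n + (\<Sum>k=n+1..2*K-1. chi4 k / real k)"
      unfolding S_def by (simp add: sum.union_disjoint)
    then show ?case using chi4_tail[of "n+1" "2*K-1"] by (simp add: add.commute)
  qed
  have "(\<lambda>K. \<bar>S n - (\<Sum>n<2*K. chi4 n / real n)\<bar>) \<longlonglongrightarrow> \<bar>S n - pi / 4\<bar>"
    by (intro tendsto_intros lim)
  from tendsto_upperbound[OF this ev] show ?thesis by (simp add: S_def)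
qed

lemma chi4_ln_bounded: "\<bar>\<Sum>k=1..n. chi4 k * ln (real k) / real k\<bar> \<le> 1"
proof (cases "n \<ge> 3")
  case True
  have eq: "{1..n} = {1,2} \<union> {3..n}" using True by auto
  have "(\<Sum>k=1..n. chi4 k * ln (real k) / real k) = (\<Sum>k=3..n. chi4 k * (ln (real k) / real k))"
    unfolding eq by (subst sum.union_disjoint) (auto simp: chi4_def)
  moreover have "\<bar>\<Sum>k=3..n. chi4 k * (ln (real k) / real k)\<bar> \<le> 1 * (ln (real 3) / real 3)"
  proof (intro abel_bound sum_chi4_abs_le True)
    fix m :: nat assume "m \<ge> 3"
    then show "ln (real (Suc m)) / real (Suc m) \<le> ln (real m) / real m"
      using exp_le by (intro ln_x_over_x_mono) (auto intro: order.trans)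
  qed auto
  moreover have "ln (3::real) \<le> 3" using ln_le_minus_one[of 3] by simp
  ultimately show ?thesis by simp
next
  case False
  then have "n \<in> {0,1,2}" by auto
  moreover have "{1..2} = {1,2::nat}" by auto
  ultimately show ?thesis by (auto simp: chi4_def)
qed

lemma chi4_mangoldt_bounded:
  assumes "n \<ge> 1"
  shows "\<bar>\<Sum>d=1..n. chi4 d * mangoldt d / real d\<bar> \<le> 10"
proof -
  define S where "S n = (\<Sum>k=1..n. chi4 k / real k)" for n
  have "(\<Sum>k=1..n. chi4 k * ln (real k) / real k)
      = (\<Sum>k=1..n. \<Sum>d | d dvd k. chi4 k / real k * mangoldt d)"
  proof (intro sum.cong refl)
    fix k assume "k \<in> {1..n}"
    then have "(\<Sum>d | d dvd k. mangoldt d) = ln (real k)" by (simp add: mangoldt_sum)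
    then show "chi4 k * ln (real k) / real k = (\<Sum>d | d dvd k. chi4 k / real k * mangoldt d)"
      by (metis (no_types, lifting) sum.cong sum_distrib_left times_divide_eq_left)
  qed
  also have "\<dots> = (\<Sum>d=1..n. chi4 d * mangoldt d / real d * S (n div d))"
    unfolding sum_divisors_swap S_def
    by (intro sum.cong refl) (simp add: sum_distrib_left chi4_mult field_simps)
  finally have eq: "(\<Sum>k=1..n. chi4 k * ln (real k) / real k)
      = (\<Sum>d=1..n. chi4 d * mangoldt d / real d * S (n div d))" .
  have "\<bar>(\<Sum>d=1..n. chi4 d * mangoldt d / real d * S (n div d)) - pi / 4 * (\<Sum>d=1..n. chi4 d * mangoldt d / real d)\<bar>
     = \<bar>\<Sum>d=1..n. chi4 d * mangoldt d / real d * (S (n div d) - pi / 4)\<bar>"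
    by (simp add: sum_distrib_left right_diff_distrib sum_subtractf mult_ac)
  also have "\<dots> \<le> (\<Sum>d=1..n. mangoldt d / real n)"
  proof (intro order.trans[OF sum_abs] sum_mono)
    fix d assume d: "d \<in> {1..n}"
    have "\<bar>S (n div d) - pi / 4\<bar> \<le> 1 / (real (n div d) + 1)"
      unfolding S_def by (rule chi4_partial)
    also have "real n / real d \<le> real (n div d) + 1"
    proof -
      have "real (n div d) = real_of_int \<lfloor>real n / real d\<rfloor>" by (simp add: floor_divide_of_nat_eq)
      then show ?thesis by linarith
    qed
    then have "1 / (real (n div d) + 1) \<le> 1 / (real n / real d)"
      using d by (intro divide_left_mono) auto
    finally have *: "\<bar>S (n div d) - pi / 4\<bar> \<le> real d / real n" by simp
    have "\<bar>chi4 d * mangoldt d / real d * (S (n div d) - pi / 4)\<bar>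
        = \<bar>chi4 d\<bar> * (mangoldt d / real d * \<bar>S (n div d) - pi / 4\<bar>)"
      by (simp add: abs_mult)
    also have "\<dots> \<le> 1 * (mangoldt d / real d * (real d / real n))"
      using * by (intro mult_mono abs_chi4_le) (auto simp: mangoldt_nonneg)
    finally show "\<bar>chi4 d * mangoldt d / real d * (S (n div d) - pi / 4)\<bar> \<le> mangoldt d / real n"
      using d by simp
  qed
  also have "\<dots> = (\<Sum>d=1..n. mangoldt d) / real n" by (simp add: sum_divide_distrib)
  also have "\<dots> \<le> 4" using psi_bound[of n] assms by (simp add: field_simps)
  finally have "\<bar>pi / 4 * (\<Sum>d=1..n. chi4 d * mangoldt d / real d)\<bar> \<le> 5"
    using chi4_ln_bounded[of n] unfolding eq by linarith
  then have "pi / 4 * \<bar>\<Sum>d=1..n. chi4 d * mangoldt d / real d\<bar> \<le> 5" by (simp add: abs_mult)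
  moreover have "1 / 2 * \<bar>\<Sum>d=1..n. chi4 d * mangoldt d / real d\<bar>
     \<le> pi / 4 * \<bar>\<Sum>d=1..n. chi4 d * mangoldt d / real d\<bar>"
    using pi_gt3 by (intro mult_right_mono) auto
  ultimately show ?thesis by linarith
qed


lemma ln_le_sqrt: "x \<ge> 1 \<Longrightarrow> ln x \<le> 2 * x powr (1/2)" for x :: real
  using ln_powr_bound[of x "1/2"] by simp

lemma summable_ln_over_square: "summable (\<lambda>n::nat. ln (real n) / (real n)\<^sup>2)"
proof (rule summable_comparison_test)
  show "\<exists>N. \<forall>n\<ge>N. norm (ln (real n) / (real n)\<^sup>2) \<le> 2 * real n powr (-3/2)"
  proof (intro exI[of _ 1] allI impI)
    fix n :: nat assume n: "n \<ge> 1"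
    have "ln (real n) / (real n)\<^sup>2 \<le> 2 * real n powr (1/2) / (real n)\<^sup>2"
      using n by (intro divide_right_mono ln_le_sqrt) auto
    also have "\<dots> = 2 * real n powr (-3/2)"
      using n powr_diff[of "real n" "1/2" 2] by simp
    finally show "norm (ln (real n) / (real n)\<^sup>2) \<le> 2 * real n powr (-3/2)" using n by simp
  qed
  show "summable (\<lambda>n::nat. 2 * real n powr (-3/2))"
    by (intro summable_mult) (simp add: summable_real_powr_iff)
qed

lemma sum_ln_over_square_bounded:
  "\<exists>C\<ge>0. \<forall>A. finite A \<longrightarrow> (\<Sum>n\<in>A. ln (real n) / (real n)\<^sup>2) \<le> C"
proof (intro exI[of _ "\<Sum>n. ln (real n) / (real n)\<^sup>2"] conjI allI impI)
  have nonneg: "0 \<le> ln (real n) / (real n)\<^sup>2" for n by (cases "n = 0") auto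
  show "0 \<le> (\<Sum>n. ln (real n) / (real n)\<^sup>2)"
    by (intro suminf_nonneg summable_ln_over_square nonneg)
  show "(\<Sum>n\<in>A. ln (real n) / (real n)\<^sup>2) \<le> (\<Sum>n. ln (real n) / (real n)\<^sup>2)" if "finite A" for A
    by (intro sum_le_suminf summable_ln_over_square nonneg that)
qed

lemma geometric_tail_le:
  fixes x :: real
  assumes "0 \<le> x" "x \<le> 1 / 2"
  shows "(\<Sum>k=2..n. x ^ k) \<le> 2 * x\<^sup>2"
proof (cases "n \<ge> 1")
  case True
  then have "(\<Sum>k=2..n. x ^ k) + 2 * x ^ Suc n \<le> 2 * x\<^sup>2"
  proof (induction n rule: dec_induct)
    case base then show ?case by (simp add: power2_eq_square)
  next
    case (step n)
    have "x ^ Suc (Suc n) * 2 \<le> x ^ Suc n"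
      using assms mult_left_mono[of "x * 2" 1 "x ^ Suc n"] by (simp add: mult_ac)
    then show ?case using step by simp
  qed
  moreover have "0 \<le> 2 * x ^ Suc n" using assms by simp
  ultimately show ?thesis by linarith
qed auto

lemma nonprime_primepow_sum_bounded:
  "\<exists>C\<ge>0. \<forall>N. (\<Sum>d | d \<in> {1..N} \<and> primepow d \<and> \<not> prime d. mangoldt d / real d) \<le> C"
proof -
  obtain C where C: "C \<ge> 0" "\<And>A. finite A \<Longrightarrow> (\<Sum>n\<in>A. ln (real n) / (real n)\<^sup>2) \<le> C"
    using sum_ln_over_square_bounded by blast
  have "(\<Sum>d | d \<in> {1..N} \<and> primepow d \<and> \<not> prime d. mangoldt d / real d) \<le> 2 * C" for N
  proof -
    let ?P = "{p\<in>{2..N}. prime p}"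
    let ?I = "?P \<times> {2..N}"
    have sub: "{d. d \<in> {1..N} \<and> primepow d \<and> \<not> prime d} \<subseteq> (\<lambda>(p,k). p ^ k) ` ?I"
    proof
      fix d assume d: "d \<in> {d. d \<in> {1..N} \<and> primepow d \<and> \<not> prime d}"
      then obtain p k where pk: "prime p" "k > 0" "d = p ^ k" by (auto simp: primepow_def)
      with d have "k \<noteq> 1" by auto
      with pk have k: "k \<ge> 2" by simp
      have p: "p \<ge> 2" using pk prime_ge_2_nat by blast
      have "p \<le> p ^ k" using pk p by (intro self_le_power) auto
      moreover have "k < p ^ k" using p by (intro power_gt_expt) auto
      ultimately show "d \<in> (\<lambda>(p,k). p ^ k) ` ?I"
        using d pk k p by (intro image_eqI[of _ _ "(p,k)"]) auto
    qed
    have "(\<Sum>d | d \<in> {1..N} \<and> primepow d \<and> \<not> prime d. mangoldt d / real d)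
        \<le> (\<Sum>d\<in>(\<lambda>(p,k). p ^ k) ` ?I. mangoldt d / real d)"
      by (intro sum_mono2 sub) (auto simp: mangoldt_nonneg)
    also have "\<dots> \<le> (\<Sum>i\<in>?I. ((\<lambda>d. mangoldt d / real d) \<circ> (\<lambda>(p,k). p ^ k)) i)"
      by (intro sum_image_le) (auto simp: mangoldt_nonneg)
    also have "\<dots> = (\<Sum>(p,k)\<in>?I. ln (real p) * (1 / real p) ^ k)"
      by (intro sum.cong refl) (auto simp: power_divide)
    also have "\<dots> = (\<Sum>p\<in>?P. \<Sum>k=2..N. ln (real p) * (1 / real p) ^ k)"
      by (rule sum.Sigma[symmetric]) auto
    also have "\<dots> = (\<Sum>p\<in>?P. ln (real p) * (\<Sum>k=2..N. (1 / real p) ^ k))"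
      by (simp add: sum_distrib_left)
    also have "\<dots> \<le> (\<Sum>p\<in>?P. ln (real p) * (2 * (1 / real p)\<^sup>2))"
      by (intro sum_mono mult_left_mono geometric_tail_le) auto
    also have "\<dots> = 2 * (\<Sum>p\<in>?P. ln (real p) / (real p)\<^sup>2)"
      by (simp add: sum_distrib_left power_divide mult_ac)
    also have "\<dots> \<le> 2 * C" by (intro mult_left_mono C) auto
    finally show ?thesis .
  qed
  then show ?thesis using C by (intro exI[of _ "2 * C"]) auto
qed

lemma mertens_mod4_nat:
  "\<exists>c\<ge>0. \<forall>n\<ge>1. \<bar>(\<Sum>p | p \<in> {1..n} \<and> prime p \<and> p mod 4 = 1. ln (real p) / real p) - ln (real n) / 2\<bar> \<le> c"
proof -
  obtain C where C: "C \<ge> 0"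
    "\<And>N. (\<Sum>d | d \<in> {1..N} \<and> primepow d \<and> \<not> prime d. mangoldt d / real d) \<le> C"
    using nonprime_primepow_sum_bounded by blast
  have "\<bar>(\<Sum>p | p \<in> {1..n} \<and> prime p \<and> p mod 4 = 1. ln (real p) / real p) - ln (real n) / 2\<bar> \<le> 8 + C"
    if n: "n \<ge> 1" for n
  proof -
    let ?h = "\<lambda>d. (1 + chi4 d) * mangoldt d / real d"
    let ?P = "{p. p \<in> {1..n} \<and> prime p \<and> p mod 4 = 1}"
    let ?Q = "{d. d \<in> {1..n} \<and> primepow d \<and> \<not> prime d}"
    have h0: "0 \<le> ?h d" for d by (auto simp: chi4_def mangoldt_nonneg)
    have hP: "(\<Sum>d\<in>?P. ?h d) = 2 * (\<Sum>p\<in>?P. ln (real p) / real p)"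
      unfolding sum_distrib_left by (intro sum.cong refl) (auto simp: chi4_def)
    have split: "(\<Sum>d=1..n. ?h d) = (\<Sum>d\<in>?P. ?h d) + (\<Sum>d\<in>{1..n}-?P. ?h d)"
      by (subst sum.subset_diff[of ?P]) auto
    have "(\<Sum>d\<in>{1..n}-?P. ?h d)
       \<le> (\<Sum>d\<in>{1..n}. (if d = 2 then 1 else 0) + (if primepow d \<and> \<not> prime d then 2 * (mangoldt d / real d) else 0))"
    proof (rule order.trans[OF sum_mono sum_mono2])
      fix d assume d: "d \<in> {1..n} - ?P"
      show "?h d \<le> (if d = 2 then 1 else 0) + (if primepow d \<and> \<not> prime d then 2 * (mangoldt d / real d) else 0)"
      proof (cases "prime d")
        case True
        show ?thesis
        proof (cases "d = 2")
          case True
          then show ?thesis using ln_2_less_1 by (auto simp: chi4_def)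
        next
          case False
          then have "odd d" using \<open>prime d\<close> prime_odd_nat prime_ge_2_nat[of d] by force
          then have "d mod 4 = 1 \<or> d mod 4 = 3" by presburger
          then have "d mod 4 = 3" using d \<open>prime d\<close> by auto
          then show ?thesis using False \<open>prime d\<close> by (simp add: chi4_def)
        qed
      next
        case False
        show ?thesis
        proof (cases "primepow d")
          case True
          have "?h d \<le> 2 * (mangoldt d / real d)"
          proof -
            have "(1 + chi4 d) * (mangoldt d / real d) \<le> 2 * (mangoldt d / real d)"
              using abs_chi4_le[of d] mangoldt_nonneg[of d] by (intro mult_right_mono) auto
            then show ?thesis by simp
          qed
          then show ?thesis using True False by (cases "d = 2") auto
        next
          case False
          then show ?thesis by (simp add: mangoldt_def)
        qed
      qed
    qed (auto simp: mangoldt_nonneg)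
    also have "\<dots> \<le> 1 + 2 * (\<Sum>d\<in>?Q. mangoldt d / real d)"
    proof -
      have "(\<Sum>d\<in>{1..n}. (if primepow d \<and> \<not> prime d then 2 * (mangoldt d / real d) else 0))
          = 2 * (\<Sum>d\<in>?Q. mangoldt d / real d)"
        unfolding sum_distrib_left by (subst sum.inter_filter[symmetric]) auto
      then show ?thesis by (simp add: sum.distrib)
    qed
    also have "\<dots> \<le> 1 + 2 * C" using C(2)[of n] by simp
    finally have rest: "(\<Sum>d\<in>{1..n}-?P. ?h d) \<le> 1 + 2 * C" .
    have rest0: "0 \<le> (\<Sum>d\<in>{1..n}-?P. ?h d)" by (intro sum_nonneg h0)
    have "(\<Sum>d=1..n. ?h d) = (\<Sum>d=1..n. mangoldt d / real d) + (\<Sum>d=1..n. chi4 d * mangoldt d / real d)"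
      by (simp add: sum.distrib[symmetric] algebra_simps add_divide_distrib)
    then have "\<bar>(\<Sum>d=1..n. ?h d) - ln (real n)\<bar> \<le> 15"
      using mertens_mangoldt[OF n] chi4_mangoldt_bounded[OF n] by linarith
    then show ?thesis using rest rest0 C(1) unfolding split hP by linarith
  qed
  then show ?thesis using C by (intro exI[of _ "8 + C"]) auto
qed

lemma mertens_mod4:
  "\<exists>c\<ge>0. \<forall>x\<ge>1. \<bar>(\<Sum>p | prime p \<and> p mod 4 = 1 \<and> real p \<le> x. ln (real p) / real p) - ln x / 2\<bar> \<le> c"
proof -
  obtain c where c: "c \<ge> 0" "\<And>n. n \<ge> 1 \<Longrightarrow>
    \<bar>(\<Sum>p | p \<in> {1..n} \<and> prime p \<and> p mod 4 = 1. ln (real p) / real p) - ln (real n) / 2\<bar> \<le> c"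
    using mertens_mod4_nat by blast
  have "\<bar>(\<Sum>p | prime p \<and> p mod 4 = 1 \<and> real p \<le> x. ln (real p) / real p) - ln x / 2\<bar> \<le> c + 1"
    if x: "x \<ge> 1" for x
  proof -
    define n where "n = nat \<lfloor>x\<rfloor>"
    have n: "n \<ge> 1" "real n \<le> x" "x \<le> 2 * real n"
    proof -
      have "real n = real_of_int \<lfloor>x\<rfloor>" "\<lfloor>x\<rfloor> \<ge> 1" using x unfolding n_def by (auto simp: le_floor_iff)
      then show "n \<ge> 1" "real n \<le> x" "x \<le> 2 * real n" by linarith+
    qed
    have set: "{p. prime p \<and> p mod 4 = 1 \<and> real p \<le> x} = {p. p \<in> {1..n} \<and> prime p \<and> p mod 4 = 1}"
      using x unfolding n_def by (auto simp: le_nat_floor dest: prime_gt_0_nat) linarith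
    have "ln x \<le> ln (2 * real n)" using n x by (intro ln_mono) auto
    then have "ln x \<le> ln 2 + ln (real n)" using n by (simp add: ln_mult)
    moreover have "ln (real n) \<le> ln x" using n by (intro ln_mono) auto
    ultimately show ?thesis unfolding set using c(2)[OF n(1)] ln_2_less_1 by linarith
  qed
  then show ?thesis using c by (intro exI[of _ "c + 1"]) auto
qed

section \<open>Squarefree products of primes congruent to 1 modulo 4\<close>

text \<open>
  Up to a factor 2, the squarefree parts of sums of two squares.
\<close>

definition G4 :: "nat set" where
  "G4 = {m. squarefree m \<and> (\<forall>p. prime p \<longrightarrow> p dvd m \<longrightarrow> p mod 4 = 1)}"

definition LG :: "real \<Rightarrow> real" where
  "LG x = (\<Sum>m | m \<in> G4 \<and> real m \<le> x. 1 / real m)"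

lemma finite_nat_le_real [simp]: "finite {m. P m \<and> real m \<le> x}"
  by (rule finite_subset[of _ "{..nat \<lfloor>x\<rfloor>}"]) (auto simp: le_nat_floor)

lemma G4_pos: "m \<in> G4 \<Longrightarrow> m > 0"
  by (cases m) (auto simp: G4_def)

lemma G4_squarefree: "m \<in> G4 \<Longrightarrow> squarefree m" by (simp add: G4_def)

lemma G4_prime_dvd: "m \<in> G4 \<Longrightarrow> prime p \<Longrightarrow> p dvd m \<Longrightarrow> p mod 4 = 1" by (simp add: G4_def)

lemma one_in_G4: "1 \<in> G4" by (auto simp: G4_def)

lemma G4_odd: "m \<in> G4 \<Longrightarrow> odd m"
  using G4_prime_dvd[of m 2] by auto

lemma G4_dvd: "m \<in> G4 \<Longrightarrow> d dvd m \<Longrightarrow> d \<in> G4"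
  unfolding G4_def using squarefree_mono dvd_trans by blast

lemma G4_times_prime:
  assumes "m \<in> G4" "prime p" "p mod 4 = 1" "\<not> p dvd m"
  shows "m * p \<in> G4"
proof -
  have "coprime m p" using assms by (metis coprime_commute prime_imp_coprime)
  then have "squarefree (m * p)"
    using assms by (intro squarefree_mult_coprime) (auto simp: G4_def squarefree_prime)
  moreover have "q mod 4 = 1" if "prime q" "q dvd m * p" for q
  proof -
    have "q dvd m \<or> q dvd p" using that prime_dvd_mult_iff by blast
    then show ?thesis using assms that primes_dvd_imp_eq[of q p] by (auto simp: G4_def)
  qed
  ultimately show ?thesis by (auto simp: G4_def)
qed

lemma squarefree_not_dvd_div:
  assumes "squarefree (m::nat)" "prime p" "p dvd m"
  shows "\<not> p dvd m div p"
proof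
  assume "p dvd m div p"
  then have "p\<^sup>2 dvd m" using assms(3)
    by (metis dvd_div_mult_self mult_dvd_mono dvd_refl power2_eq_square)
  then have "p dvd 1" using assms(1) squarefreeD by blast
  then show False using assms(2) by auto
qed

lemma G4_reindex:
  fixes F :: "nat \<Rightarrow> nat \<Rightarrow> real"
  shows "(\<Sum>m | m \<in> G4 \<and> real m \<le> x. \<Sum>p\<in>prime_factors m. F p m)
    = (\<Sum>m | m \<in> G4 \<and> real m \<le> x. \<Sum>p | prime p \<and> p mod 4 = 1 \<and> \<not> p dvd m \<and> real p \<le> x / real m. F p (m * p))"
proof -
  let ?G = "{m. m \<in> G4 \<and> real m \<le> x}"
  let ?Q = "\<lambda>m. {p. prime p \<and> p mod 4 = 1 \<and> \<not> p dvd m \<and> real p \<le> x / real m}"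
  have finQ: "finite (?Q m)" for m
    by (rule finite_subset[OF _ finite_nat_le_real[of "\<lambda>_. True" "x / real m"]]) auto
  have "(\<Sum>m\<in>?G. \<Sum>p\<in>prime_factors m. F p m) = (\<Sum>(m,p)\<in>Sigma ?G prime_factors. F p m)"
    by (rule sum.Sigma) auto
  also have "\<dots> = (\<Sum>(m,p)\<in>Sigma ?G ?Q. F p (m * p))"
  proof (rule sum.reindex_bij_witness[where i = "\<lambda>(m,p). (m * p, p)" and j = "\<lambda>(m,p). (m div p, p)"], goal_cases)
    case (1 a)
    then show ?case by auto
  next
    case (2 a)
    then obtain m p where a: "a = (m,p)" "m \<in> G4" "real m \<le> x" "prime p" "p dvd m"
      by (auto simp: prime_factors_dvd)
    have dv: "m div p * p = m" using a by simp
    have "m div p \<in> G4" by (rule G4_dvd[OF a(2)]) (use a in \<open>auto intro: div_dvd_iff_mult[THEN iffD2]\<close>)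
    moreover have "\<not> p dvd m div p" using a by (intro squarefree_not_dvd_div G4_squarefree)
    moreover have "real (m div p) * real p \<le> x" using dv a by (metis of_nat_mult)
    moreover have "real (m div p) \<le> x"
      using a by (meson div_le_dividend of_nat_mono order.trans)
    moreover have "m div p > 0" using \<open>m div p \<in> G4\<close> by (rule G4_pos)
    ultimately show ?case using a G4_prime_dvd[OF a(2,4,5)] by (auto simp: field_simps)
  next
    case (3 b)
    then show ?case by auto
  next
    case (4 b)
    then obtain m p where b: "b = (m,p)" "m \<in> G4" "prime p" "p mod 4 = 1" "\<not> p dvd m" "real p \<le> x / real m"
      by auto
    have "real (m * p) \<le> x" using b G4_pos[of m] by (simp add: field_simps)
    moreover have "m * p \<in> G4" using b by (intro G4_times_prime)
    ultimately show ?case using b G4_pos[of "m*p"] by (auto simp: prime_factors_dvd)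
  next
    case (5 a)
    then show ?case by (auto simp: prime_factors_dvd)
  qed
  also have "\<dots> = (\<Sum>m\<in>?G. \<Sum>p\<in>?Q m. F p (m * p))"
    by (rule sum.Sigma[symmetric]) (auto simp: finQ)
  finally show ?thesis .
qed

lemma squarefree_ln:
  assumes "squarefree (m::nat)"
  shows "ln (real m) = (\<Sum>p\<in>prime_factors m. ln (real p))"
proof -
  have m: "m \<noteq> 0" using assms by (auto intro!: Nat.gr0I)
  have "m = (\<Prod>p\<in>prime_factors m. p ^ multiplicity p m)"
    using prod_prime_factors[OF m] by simp
  also have "\<dots> = (\<Prod>p\<in>prime_factors m. p)"
  proof (intro prod.cong refl)
    fix p assume p: "p \<in> prime_factors m"
    then have "multiplicity p m \<le> 1" using assms m by (auto simp: squarefree_factorial_semiring'')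
    moreover have "multiplicity p m > 0" using p by (simp add: prime_factors_multiplicity)
    ultimately have "multiplicity p m = 1" by linarith
    then show "p ^ multiplicity p m = p" by simp
  qed
  finally have "ln (real m) = ln (real (\<Prod>p\<in>prime_factors m. p))" by (rule arg_cong)
  also have "\<dots> = ln (\<Prod>p\<in>prime_factors m. real p)" by simp
  also have "\<dots> = (\<Sum>p\<in>prime_factors m. ln (real p))"
    by (intro ln_prod) (auto simp: in_prime_factors_iff prime_gt_0_nat)
  finally show ?thesis .
qed

lemma G4_log_relation:
  "\<exists>c\<ge>0. \<forall>x\<ge>1. \<bar>(\<Sum>m | m \<in> G4 \<and> real m \<le> x. ln (real m) / real m)
      - (\<Sum>m | m \<in> G4 \<and> real m \<le> x. (ln x - ln (real m)) / real m) / 2\<bar> \<le> c * LG x"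
proof -
  obtain c where c: "c \<ge> 0" "\<And>x. x \<ge> 1 \<Longrightarrow>
    \<bar>(\<Sum>p | prime p \<and> p mod 4 = 1 \<and> real p \<le> x. ln (real p) / real p) - ln x / 2\<bar> \<le> c"
    using mertens_mod4 by blast
  obtain C where C: "C \<ge> 0" "\<And>A. finite A \<Longrightarrow> (\<Sum>n\<in>A. ln (real n) / (real n)\<^sup>2) \<le> C"
    using sum_ln_over_square_bounded by blast
  have "\<bar>(\<Sum>m | m \<in> G4 \<and> real m \<le> x. ln (real m) / real m)
      - (\<Sum>m | m \<in> G4 \<and> real m \<le> x. (ln x - ln (real m)) / real m) / 2\<bar> \<le> (c + C) * LG x"
    if x: "x \<ge> 1" for x
  proof -
    let ?G = "{m. m \<in> G4 \<and> real m \<le> x}"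
    let ?Q = "\<lambda>m. {p. prime p \<and> p mod 4 = 1 \<and> \<not> p dvd m \<and> real p \<le> x / real m}"
    let ?R = "\<lambda>m. {p. prime p \<and> p mod 4 = 1 \<and> p dvd m \<and> real p \<le> x / real m}"
    let ?P = "\<lambda>m. {p. prime p \<and> p mod 4 = 1 \<and> real p \<le> x / real m}"
    have finP: "finite (?P m)" for m
      by (rule finite_subset[OF _ finite_nat_le_real[of "\<lambda>_. True" "x / real m"]]) auto
    have e1: "(\<Sum>m\<in>?G. ln (real m) / real m) = (\<Sum>m\<in>?G. \<Sum>p\<in>?Q m. ln (real p) / real p / real m)"
    proof -
      have "(\<Sum>m\<in>?G. ln (real m) / real m) = (\<Sum>m\<in>?G. \<Sum>p\<in>prime_factors m. ln (real p) / real m)"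
        by (intro sum.cong refl) (auto simp: squarefree_ln G4_squarefree sum_divide_distrib)
      also have "\<dots> = (\<Sum>m\<in>?G. \<Sum>p\<in>?Q m. ln (real p) / real (m * p))"
        by (rule G4_reindex)
      finally show ?thesis by (simp add: mult.commute)
    qed
    have e2: "(\<Sum>p\<in>?P m. ln (real p) / real p) = (\<Sum>p\<in>?Q m. ln (real p) / real p) + (\<Sum>p\<in>?R m. ln (real p) / real p)" for m
    proof -
      have "?P m = ?Q m \<union> ?R m" by auto
      moreover have "finite (?Q m)" "finite (?R m)" by (rule finite_subset[OF _ finP[of m]], auto)+
      ultimately show ?thesis by (simp only:) (rule sum.union_disjoint, auto)
    qed
    have "(\<Sum>m\<in>?G. (\<Sum>p\<in>?R m. ln (real p) / real p) / real m)
        \<le> (\<Sum>m\<in>?G. \<Sum>p\<in>prime_factors m. ln (real p) / (real p * real m))"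
    proof (intro sum_mono)
      fix m assume m: "m \<in> ?G"
      have "(\<Sum>p\<in>?R m. ln (real p) / real p / real m) \<le> (\<Sum>p\<in>prime_factors m. ln (real p) / real p / real m)"
        using m G4_pos[of m]
        by (intro sum_mono2) (auto simp: prime_factors_dvd intro!: divide_nonneg_nonneg dest: prime_gt_0_nat)
      then show "(\<Sum>p\<in>?R m. ln (real p) / real p) / real m \<le> (\<Sum>p\<in>prime_factors m. ln (real p) / (real p * real m))"
        by (simp add: sum_divide_distrib)
    qed
    also have "\<dots> = (\<Sum>m\<in>?G. \<Sum>p\<in>?Q m. ln (real p) / (real p * real (m * p)))"
      by (rule G4_reindex)
    also have "\<dots> = (\<Sum>m\<in>?G. (\<Sum>p\<in>?Q m. ln (real p) / (real p)\<^sup>2) / real m)"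
      by (simp add: sum_divide_distrib power2_eq_square mult_ac)
    also have "\<dots> \<le> (\<Sum>m\<in>?G. C / real m)"
      by (intro sum_mono divide_right_mono C finite_subset[OF _ finP]) auto
    also have "\<dots> = C * LG x" by (simp add: LG_def sum_distrib_left)
    finally have R: "(\<Sum>m\<in>?G. (\<Sum>p\<in>?R m. ln (real p) / real p) / real m) \<le> C * LG x" .
    have R0: "0 \<le> (\<Sum>m\<in>?G. (\<Sum>p\<in>?R m. ln (real p) / real p) / real m)"
      by (intro sum_nonneg divide_nonneg_nonneg) (auto dest: prime_gt_0_nat)
    have "\<bar>(\<Sum>m\<in>?G. (\<Sum>p\<in>?P m. ln (real p) / real p) / real m) - (\<Sum>m\<in>?G. (ln x - ln (real m)) / real m) / 2\<bar>
       = \<bar>\<Sum>m\<in>?G. ((\<Sum>p\<in>?P m. ln (real p) / real p) - (ln x - ln (real m)) / 2) / real m\<bar>"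
      unfolding diff_divide_distrib[of "sum _ _"] sum_subtractf
      by (simp add: sum_divide_distrib mult.commute)
    also have "\<dots> \<le> (\<Sum>m\<in>?G. c / real m)"
    proof (intro order.trans[OF sum_abs] sum_mono)
      fix m assume m: "m \<in> ?G"
      then have m0: "real m > 0" using G4_pos by auto
      have "x / real m \<ge> 1" using m m0 by (simp add: field_simps)
      moreover have "ln (x / real m) = ln x - ln (real m)" using m0 x by (simp add: ln_div)
      ultimately have "\<bar>(\<Sum>p\<in>?P m. ln (real p) / real p) - (ln x - ln (real m)) / 2\<bar> \<le> c"
        using c(2)[of "x / real m"] by simp
      then have "\<bar>(\<Sum>p\<in>?P m. ln (real p) / real p) - (ln x - ln (real m)) / 2\<bar> / real m \<le> c / real m"
        using m0 by (intro divide_right_mono) auto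
      then show "\<bar>((\<Sum>p\<in>?P m. ln (real p) / real p) - (ln x - ln (real m)) / 2) / real m\<bar> \<le> c / real m"
        by simp
    qed
    also have "\<dots> = c * LG x" by (simp add: LG_def sum_distrib_left)
    finally have "\<bar>(\<Sum>m\<in>?G. (\<Sum>p\<in>?P m. ln (real p) / real p) / real m) - (\<Sum>m\<in>?G. (ln x - ln (real m)) / real m) / 2\<bar> \<le> c * LG x" .
    moreover have "(\<Sum>m\<in>?G. (\<Sum>p\<in>?P m. ln (real p) / real p) / real m)
       = (\<Sum>m\<in>?G. ln (real m) / real m) + (\<Sum>m\<in>?G. (\<Sum>p\<in>?R m. ln (real p) / real p) / real m)"
      unfolding e1 e2 by (simp add: add_divide_distrib sum.distrib sum_divide_distrib)
    ultimately show ?thesis using R R0 by (simp add: distrib_right)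
  qed
  then show ?thesis using c C by (intro exI[of _ "c + C"]) auto
qed

lemma abs_exp_minus_one_le: "\<bar>exp t - 1\<bar> \<le> \<bar>t\<bar> * exp \<bar>t\<bar>" for t :: real
proof (cases "t \<ge> 0")
  case True
  have "1 - t \<le> exp (- t)" using exp_ge_add_one_self[of "-t"] by simp
  then have "(1 - t) * exp t \<le> exp (- t) * exp t" by (intro mult_right_mono) auto
  then show ?thesis using True by (simp add: exp_minus algebra_simps)
next
  case False
  have "1 + t \<le> exp t" by (rule exp_ge_add_one_self)
  moreover have "\<bar>t\<bar> * 1 \<le> \<bar>t\<bar> * exp \<bar>t\<bar>" by (intro mult_left_mono) auto
  moreover have "exp t \<le> 1" using False by simp
  ultimately show ?thesis using False by linarith
qed

text \<open>
  The hypotheses say that \<open>t' / t = 3 / (2 * u) + O(1 / u\<^sup>2)\<close>, hence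
  \<open>ln t - (3 / 2) * ln u\<close> converges at rate \<open>O(1 / u)\<close>.
\<close>

lemma sqrt_asymptotic_of_log_relation:
  fixes l t :: "real \<Rightarrow> real"
  assumes mono: "\<And>u v. 0 \<le> u \<Longrightarrow> u \<le> v \<Longrightarrow> l u \<le> l v"
    and pos: "\<And>u. u \<ge> 0 \<Longrightarrow> l u \<ge> 1"
    and cont: "\<And>B. continuous_on {0..B} t"
    and S: "\<And>B. finite (S \<inter> {0..B})"
    and der: "\<And>u. u > 0 \<Longrightarrow> u \<notin> S \<Longrightarrow> (t has_real_derivative l u) (at u)"
    and rel: "\<And>u. u \<ge> 0 \<Longrightarrow> \<bar>u * l u - 3 / 2 * t u\<bar> \<le> c * l u"
    and c: "c \<ge> 0"
  shows "\<exists>C K. C \<ge> 0 \<and> (\<forall>u\<ge>0. \<bar>l u - C * sqrt u\<bar> \<le> K)"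
proof -
  define u0 where "u0 = 2 * c + 1"
  have t_ge: "t u \<ge> u * l u / 3" "t u > 0" if u: "u \<ge> u0" for u
  proof -
    have u': "u \<ge> 1" "u \<ge> 2 * c" using u c by (auto simp: u0_def)
    have "c * l u \<le> u / 2 * l u" using u' pos[of u] by (intro mult_right_mono) auto
    then show "t u \<ge> u * l u / 3" using rel[of u] u' by (simp add: abs_le_iff)
    moreover have "u * l u > 0" using u' pos[of u] by simp
    ultimately show "t u > 0" by linarith
  qed
  define f where "f u = ln (t u) - 3 / 2 * ln u" for u
  have f_diff: "\<bar>f v - f u\<bar> \<le> 3 * c / u" if uv: "u \<ge> u0" "u \<le> v" for u v
  proof -
    have u1: "u \<ge> 1" using uv c by (auto simp: u0_def)
    define g where "g s = (if s \<in> S then 0 else l s / t s - 3 / 2 * (1 / s))" for s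
    have "(g has_integral (f v - f u)) {u..v}"
    proof (rule fundamental_theorem_of_calculus_strong[OF S[of v]])
      show "u \<le> v" by fact
      show "continuous_on {u..v} f"
        unfolding f_def
      proof (intro continuous_intros continuous_on_subset[OF cont])
        show "{u..v} \<subseteq> {0..v}" using u1 by auto
        show "\<forall>x\<in>{u..v}. t x \<noteq> 0" using t_ge uv by (metis atLeastAtMost_iff less_irrefl order.trans)
      qed (use u1 in auto)
      fix s assume "s \<in> {u..v} - S \<inter> {0..v}"
      then have s: "s \<in> {u..v} - S" using u1 by auto
      then have s1: "s \<ge> 1" "s \<ge> u0" using u1 uv by auto
      have "(f has_real_derivative (l s / t s - 3 / 2 * (1 / s))) (at s)"
      proof -
        have dt: "(t has_real_derivative l s) (at s)" using s s1 by (intro der) auto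
        have "(f has_real_derivative (1 / t s * l s - 3 / 2 * (1 / s))) (at s)"
          unfolding f_def
          by (intro DERIV_diff DERIV_cmult DERIV_chain2[OF DERIV_ln_divide dt] DERIV_ln_divide t_ge(2) s1)
             (use s1 in auto)
        then show ?thesis by simp
      qed
      then show "(f has_vector_derivative g s) (at s)"
        using s by (simp add: g_def has_real_derivative_iff_has_vector_derivative)
    qed
    moreover have "((\<lambda>s. 3 * c / s\<^sup>2) has_integral ((- 3 * c / v) - (- 3 * c / u))) {u..v}"
    proof (rule fundamental_theorem_of_calculus)
      fix s assume "s \<in> {u..v}"
      then have "s \<noteq> 0" using u1 by auto
      then show "((\<lambda>s. - 3 * c / s) has_vector_derivative 3 * c / s\<^sup>2) (at s within {u..v})"
        unfolding has_real_derivative_iff_has_vector_derivative[symmetric]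
        by (auto intro!: derivative_eq_intros simp: power2_eq_square)
    qed fact
    moreover have "norm (g s) \<le> 3 * c / s\<^sup>2" if "s \<in> {u..v}" for s
    proof (cases "s \<in> S")
      case False
      have s: "s \<ge> 1" "s \<ge> u0" using u1 uv that by auto
      have ts: "t s > 0" "s * l s / 3 \<le> t s" using t_ge s by auto
      have "\<bar>l s / t s - 3 / 2 * (1 / s)\<bar> = \<bar>s * l s - 3 / 2 * t s\<bar> / (s * t s)"
      proof -
        have "l s / t s - 3 / 2 * (1 / s) = (s * l s - 3 / 2 * t s) / (s * t s)"
          using ts s by (simp add: field_simps)
        then show ?thesis using ts s by simp
      qed
      also have "\<dots> \<le> c * l s / (s * t s)"
        using rel[of s] s ts by (intro divide_right_mono) auto
      also have "\<dots> \<le> 3 * c / s\<^sup>2"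
      proof -
        have "c * (s * l s) \<le> c * (3 * t s)" using ts c by (intro mult_left_mono) auto
        then show ?thesis using ts s by (simp add: field_simps power2_eq_square)
      qed
      finally show ?thesis using False by (simp add: g_def)
    qed (use c in \<open>auto simp: g_def\<close>)
    ultimately have "norm (f v - f u) \<le> (- 3 * c / v) - (- 3 * c / u)"
      by (metis (no_types, lifting) has_integral_integrable integral_norm_bound_integral integral_unique)
    also have "\<dots> \<le> 3 * c / u" using u1 uv c by simp
    finally show ?thesis by simp
  qed
  have "Cauchy (\<lambda>n. f (real n))"
  proof (rule CauchyI')
    fix e :: real assume e: "e > 0"
    define M where "M = nat \<lceil>u0 + 3 * c / e + 1\<rceil>"
    have c0: "3 * c / e \<ge> 0" using c e by simp
    have M: "real M \<ge> u0 + 3 * c / e + 1" unfolding M_def by linarith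
    have M1: "real M \<ge> u0" "real M > 0" "real M > 3 * c / e" using M c0 c by (auto simp: u0_def)
    have "norm (f (real m) - f (real n)) < e" if "m \<ge> M" "n > m" for m n
    proof -
      have "\<bar>f (real n) - f (real m)\<bar> \<le> 3 * c / real m" using that M1 by (intro f_diff) auto
      also have "\<dots> \<le> 3 * c / real M" using that M1 c by (intro divide_left_mono) auto
      also have "\<dots> < e" using M1 e by (simp add: field_simps)
      finally show ?thesis by (simp add: abs_minus_commute)
    qed
    then show "\<exists>M. \<forall>m\<ge>M. \<forall>n>m. dist (f (real m)) (f (real n)) < e"
      unfolding dist_norm by blast
  qed
  then obtain a where a: "(\<lambda>n. f (real n)) \<longlonglongrightarrow> a"
    using convergent_eq_Cauchy by blast
  have f_lim: "\<bar>f u - a\<bar> \<le> 3 * c / u" if u: "u \<ge> u0" for u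
  proof -
    have "(\<lambda>n. \<bar>f (real n) - f u\<bar>) \<longlonglongrightarrow> \<bar>a - f u\<bar>" by (intro tendsto_intros a)
    moreover have "\<forall>\<^sub>F n in sequentially. \<bar>f (real n) - f u\<bar> \<le> 3 * c / u"
      using eventually_ge_at_top[of "nat \<lceil>u\<rceil>"]
      by eventually_elim (intro f_diff u, linarith)
    ultimately have "\<bar>a - f u\<bar> \<le> 3 * c / u" by (rule tendsto_upperbound) auto
    then show ?thesis by (simp add: abs_minus_commute)
  qed
  define E where "E = exp a"
  define e where "e = exp (3 / 2 :: real)"
  define K1 where "K1 = 3 * c * (E * e) + 9 / 2 * c * E * e"
  have big: "\<bar>l u - 3 / 2 * E * sqrt u\<bar> \<le> K1" if u: "u \<ge> u0" for u
  proof -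
    have u1: "u \<ge> 1" "u \<ge> 2 * c" using u c by (auto simp: u0_def)
    have q: "3 * c / u \<le> 3 / 2" using u1 by (simp add: field_simps)
    have tpos: "t u > 0" "u * l u / 3 \<le> t u" using t_ge u by auto
    have "ln (t u) = f u + 3 / 2 * ln u" by (simp add: f_def)
    then have "t u = exp (f u + 3 / 2 * ln u)" using tpos by (metis exp_ln)
    also have "\<dots> = exp (f u) * u powr (3 / 2)" using u1 by (simp add: exp_add powr_def)
    also have "u powr (3 / 2) = u * sqrt u"
      using u1 powr_add[of u 1 "1/2"] by (simp add: powr_half_sqrt)
    finally have tu: "t u = exp (f u) * (u * sqrt u)" .
    have fu: "exp (f u) = E * exp (f u - a)" by (simp add: E_def exp_add[symmetric])
    have "\<bar>exp (f u - a) - 1\<bar> \<le> \<bar>f u - a\<bar> * exp \<bar>f u - a\<bar>" by (rule abs_exp_minus_one_le)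
    also have "\<dots> \<le> 3 * c / u * e"
      unfolding e_def using f_lim[OF u] q by (intro mult_mono) auto
    finally have h: "\<bar>exp (f u - a) - 1\<bar> \<le> 3 * c / u * e" .
    have d1: "\<bar>exp (f u) - E\<bar> \<le> E * (3 * c / u * e)"
    proof -
      have "exp (f u) - E = E * (exp (f u - a) - 1)" unfolding fu by (simp add: algebra_simps)
      then have "\<bar>exp (f u) - E\<bar> = E * \<bar>exp (f u - a) - 1\<bar>" by (simp add: abs_mult E_def)
      also have "\<dots> \<le> E * (3 * c / u * e)" using h by (intro mult_left_mono) (auto simp: E_def)
      finally show ?thesis .
    qed
    have "exp (f u - a) \<le> e" unfolding e_def using f_lim[OF u] q by auto
    then have d2: "exp (f u) \<le> E * e" unfolding fu by (intro mult_left_mono) (auto simp: E_def)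
    have squ: "sqrt u \<le> u" "sqrt u \<ge> 1" using u1 by (auto simp: real_le_lsqrt power2_eq_square)
    have "\<bar>l u - 3 / 2 * t u / u\<bar> = \<bar>u * l u - 3 / 2 * t u\<bar> / u"
    proof -
      have "l u - 3 / 2 * t u / u = (u * l u - 3 / 2 * t u) / u" using u1 by (simp add: field_simps)
      then show ?thesis using u1 by simp
    qed
    also have "\<dots> \<le> c * l u / u" using rel[of u] u1 by (intro divide_right_mono) auto
    also have "\<dots> \<le> c * (3 * t u / u) / u"
      using tpos u1 c by (intro divide_right_mono mult_left_mono) (auto simp: field_simps)
    also have "\<dots> = 3 * c * exp (f u) * (sqrt u / u)" using u1 by (simp add: tu)
    also have "\<dots> \<le> 3 * c * exp (f u) * 1" using squ u1 c by (intro mult_left_mono) auto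
    also have "\<dots> \<le> 3 * c * (E * e)" using d2 c by (simp add: mult_left_mono)
    finally have p1: "\<bar>l u - 3 / 2 * t u / u\<bar> \<le> 3 * c * (E * e)" .
    have "\<bar>3 / 2 * t u / u - 3 / 2 * E * sqrt u\<bar> = 3 / 2 * sqrt u * \<bar>exp (f u) - E\<bar>"
    proof -
      have "3 / 2 * t u / u - 3 / 2 * E * sqrt u = 3 / 2 * sqrt u * (exp (f u) - E)"
        using u1 by (simp add: tu algebra_simps)
      then have "\<bar>3 / 2 * t u / u - 3 / 2 * E * sqrt u\<bar> = \<bar>3 / 2 * sqrt u\<bar> * \<bar>exp (f u) - E\<bar>"
        by (simp only: abs_mult)
      then show ?thesis using squ by simp
    qed
    also have "\<dots> \<le> 3 / 2 * sqrt u * (E * (3 * c / u * e))" using d1 squ by (intro mult_left_mono) auto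
    also have "\<dots> = 9 / 2 * c * E * e * (sqrt u / u)" by simp
    also have "\<dots> \<le> 9 / 2 * c * E * e * 1"
      using squ u1 c by (intro mult_left_mono) (auto simp: E_def e_def)
    finally show ?thesis using p1 unfolding K1_def by linarith
  qed
  have E0: "E > 0" by (simp add: E_def)
  have u00: "u0 > 0" using c by (simp add: u0_def)
  have K10: "K1 \<ge> 0" using c by (simp add: K1_def E_def e_def)
  have "\<bar>l u - 3 / 2 * E * sqrt u\<bar> \<le> K1 + l u0 + 3 / 2 * E * sqrt u0" if u: "u \<ge> 0" for u
  proof (cases "u \<ge> u0")
    case True
    have "0 \<le> 3 / 2 * E * sqrt u0" using E0 u00 by simp
    then show ?thesis using big[OF True] pos[of u0] u00 by linarith
  next
    case False
    then have "l u \<le> l u0" using mono u by auto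
    moreover have "3 / 2 * E * sqrt u \<le> 3 / 2 * E * sqrt u0" "0 \<le> 3 / 2 * E * sqrt u"
      using False E0 u by (auto intro!: mult_left_mono)
    ultimately show ?thesis using pos[OF u] K10 pos[of u0] u00 by (simp add: abs_le_iff)
  qed
  then show ?thesis using E0 by (intro exI[of _ "3 / 2 * E"] exI[of _ "K1 + l u0 + 3 / 2 * E * sqrt u0"]) auto
qed

lemma LG_mono: "x \<le> y \<Longrightarrow> LG x \<le> LG y"
  unfolding LG_def by (intro sum_mono2) auto

lemma LG_ge_1: "x \<ge> 1 \<Longrightarrow> LG x \<ge> 1"
proof -
  assume "x \<ge> 1"
  moreover have "LG 1 \<ge> 1"
  proof -
    have "{m. m \<in> G4 \<and> real m \<le> 1} = {1}"
      using one_in_G4 by (auto dest: G4_pos)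
    then show ?thesis by (simp add: LG_def)
  qed
  ultimately show ?thesis using LG_mono[of 1 x] by linarith
qed

lemma LG_asymptotic: "\<exists>C K. C \<ge> 0 \<and> (\<forall>x\<ge>1. \<bar>LG x - C * sqrt (ln x)\<bar> \<le> K)"
proof -
  define l where "l u = LG (exp u)" for u
  define t where "t u = (\<Sum>m | m \<in> G4 \<and> real m \<le> exp u. (u - ln (real m)) / real m)" for u
  define tb where "tb B u = (\<Sum>m | m \<in> G4 \<and> real m \<le> exp B. max 0 (u - ln (real m)) / real m)" for B u
  have le_exp: "real m \<le> exp u \<longleftrightarrow> ln (real m) \<le> u" if "m \<in> G4" for m u
    using G4_pos[OF that] by (metis exp_le_cancel_iff exp_ln of_nat_0_less_iff)
  have t_tb: "t u = tb B u" if "u \<le> B" for u B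
    unfolding t_def tb_def
  proof (rule sum.mono_neutral_cong_left)
    show "{m. m \<in> G4 \<and> real m \<le> exp u} \<subseteq> {m. m \<in> G4 \<and> real m \<le> exp B}"
      using that by (auto simp: le_exp)
  qed (auto simp: le_exp)
  obtain c where c: "c \<ge> 0" "\<And>x. x \<ge> 1 \<Longrightarrow> \<bar>(\<Sum>m | m \<in> G4 \<and> real m \<le> x. ln (real m) / real m)
      - (\<Sum>m | m \<in> G4 \<and> real m \<le> x. (ln x - ln (real m)) / real m) / 2\<bar> \<le> c * LG x"
    using G4_log_relation by blast
  have "\<exists>C K. C \<ge> 0 \<and> (\<forall>u\<ge>0. \<bar>l u - C * sqrt u\<bar> \<le> K)"
  proof (rule sqrt_asymptotic_of_log_relation)
    show "l u \<le> l v" if "0 \<le> u" "u \<le> v" for u v using that by (simp add: l_def LG_mono)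
    show "l u \<ge> 1" if "u \<ge> 0" for u using that by (simp add: l_def LG_ge_1)
    show "continuous_on {0..B} t" for B
    proof -
      have "continuous_on {0..B} (tb B)"
        unfolding tb_def by (intro continuous_intros) (auto dest: G4_pos)
      then show ?thesis by (rule continuous_on_eq) (use t_tb in auto)
    qed
    show "finite ((\<lambda>m::nat. ln (real m)) ` UNIV \<inter> {0..B})" for B
    proof (rule finite_subset)
      show "(\<lambda>m::nat. ln (real m)) ` UNIV \<inter> {0..B} \<subseteq> (\<lambda>m. ln (real m)) ` {m. True \<and> real m \<le> exp B}"
      proof
        fix y assume "y \<in> (\<lambda>m::nat. ln (real m)) ` UNIV \<inter> {0..B}"
        then obtain m :: nat where m: "y = ln (real m)" "ln (real m) \<le> B" by auto
        have "real m \<le> exp B"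
        proof (cases "m = 0")
          case False
          then show ?thesis using m by (metis exp_le_cancel_iff exp_ln gr0I of_nat_0_less_iff)
        qed auto
        then show "y \<in> (\<lambda>m. ln (real m)) ` {m. True \<and> real m \<le> exp B}" using m by auto
      qed
      show "finite ((\<lambda>m::nat. ln (real m)) ` {m. True \<and> real m \<le> exp B})"
        by (intro finite_imageI finite_nat_le_real)
    qed
    show "c \<ge> 0" by fact
    show "(t has_real_derivative l u) (at u)" if u: "u > 0" "u \<notin> (\<lambda>m::nat. ln (real m)) ` UNIV" for u
    proof -
      have "(tb (u + 1) has_real_derivative
          (\<Sum>m | m \<in> G4 \<and> real m \<le> exp (u + 1). (if ln (real m) < u then 1 else 0) / real m)) (at u)"
        unfolding tb_def
      proof (intro DERIV_sum DERIV_cdivide)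
        fix m :: nat
        have ne: "u \<noteq> ln (real m)" using u by auto
        show "((\<lambda>u. max 0 (u - ln (real m))) has_real_derivative (if ln (real m) < u then 1 else 0)) (at u)"
        proof (cases "ln (real m) < u")
          case True
          have "((\<lambda>u. u - ln (real m)) has_real_derivative 1) (at u)"
            by (auto intro!: derivative_eq_intros)
          then have "((\<lambda>u. max 0 (u - ln (real m))) has_real_derivative 1) (at u)"
            by (rule has_field_derivative_transform_within_open[where S = "{ln (real m)<..}"])
               (use True in auto)
          then show ?thesis using True by simp
        next
          case False
          have "((\<lambda>u. 0) has_real_derivative 0) (at u)" by simp
          then have "((\<lambda>u. max 0 (u - ln (real m))) has_real_derivative 0) (at u)"
            by (rule has_field_derivative_transform_within_open[where S = "{..<ln (real m)}"])
               (use False ne in auto)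
          then show ?thesis using False by simp
        qed
      qed
      moreover have "(\<Sum>m | m \<in> G4 \<and> real m \<le> exp (u + 1). (if ln (real m) < u then 1 else 0) / real m) = l u"
        unfolding l_def LG_def
      proof (rule sum.mono_neutral_cong_right)
        show "{m. m \<in> G4 \<and> real m \<le> exp u} \<subseteq> {m. m \<in> G4 \<and> real m \<le> exp (u + 1)}"
          by (auto simp: le_exp)
        fix m assume m: "m \<in> {m. m \<in> G4 \<and> real m \<le> exp u}"
        have "u \<noteq> ln (real m)" using u by auto
        then show "(if ln (real m) < u then 1 else 0) / real m = 1 / real m" using m by (auto simp: le_exp)
      qed (auto simp: le_exp)
      ultimately have "(tb (u + 1) has_real_derivative l u) (at u)" by simp
      then show ?thesis
        by (rule has_field_derivative_transform_within_open[where S = "{..<u+1}"]) (simp_all add: t_tb[of _ "u + 1"])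
    qed
    show "\<bar>u * l u - 3 / 2 * t u\<bar> \<le> c * l u" if "u \<ge> 0" for u
    proof -
      have "t u = u * l u - (\<Sum>m | m \<in> G4 \<and> real m \<le> exp u. ln (real m) / real m)"
        unfolding t_def l_def LG_def by (simp add: diff_divide_distrib sum_subtractf sum_distrib_left)
      then have "u * l u - 3 / 2 * t u = (\<Sum>m | m \<in> G4 \<and> real m \<le> exp u. ln (real m) / real m) - t u / 2"
        by linarith
      then show ?thesis using c(2)[of "exp u"] that by (simp add: t_def l_def)
    qed
  qed
  then obtain C K where CK: "C \<ge> 0" "\<And>u. u \<ge> 0 \<Longrightarrow> \<bar>l u - C * sqrt u\<bar> \<le> K" by blast
  have "\<bar>LG x - C * sqrt (ln x)\<bar> \<le> K" if "x \<ge> 1" for x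
    using CK(2)[of "ln x"] that by (simp add: l_def)
  then show ?thesis using CK by blast
qed

section \<open>Dirichlet series near 1 and Euler products\<close>

lemma le_nat_floor_exp_iff: "n \<le> nat \<lfloor>exp u\<rfloor> \<longleftrightarrow> n = 0 \<or> ln (real n) \<le> u" for u :: real
proof -
  have "n \<le> nat \<lfloor>exp u\<rfloor> \<longleftrightarrow> real n \<le> exp u"
    by (meson exp_ge_zero le_nat_floor nat_floor_neg of_nat_floor of_nat_le_iff order.trans)
  also have "\<dots> \<longleftrightarrow> n = 0 \<or> ln (real n) \<le> u"
    by (cases "n = 0") (auto, (metis exp_le_cancel_iff exp_ln of_nat_0_less_iff)+)
  finally show ?thesis .
qed

lemma Gamma_integral_tendsto:
  assumes "a > (0::real)"
  shows "(\<lambda>k. integral {0..real k} (\<lambda>t. t powr a * exp (- t))) \<longlonglongrightarrow> Gamma (1 + a)"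
proof -
  define h where "h t = t powr a * exp (- t)" for t :: real
  have h: "(h has_integral Gamma (1 + a)) {0..}"
    using Gamma_integral_real[of "1 + a"] assms unfolding h_def by (simp add: exp_minus divide_inverse)
  have int: "h integrable_on {0..real k}" for k
    unfolding h_def using assms
    by (intro integrable_continuous_interval continuous_on_mult continuous_on_powr' continuous_intros) auto
  have sub: "{0..real k} \<subseteq> {0..}" for k by auto
  have "(\<lambda>k. integral {0..} (\<lambda>t. if t \<in> {0..real k} then h t else 0)) \<longlonglongrightarrow> integral {0..} h"
  proof (rule dominated_convergence(2)[where h = h])
    show "(\<lambda>t. if t \<in> {0..real k} then h t else 0) integrable_on {0..}" for k
      using int[of k] has_integral_restrict[OF sub, of k h] unfolding integrable_on_def by blast
    show "h integrable_on {0..}" using h by blast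
    show "norm (if t \<in> {0..real k} then h t else 0) \<le> h t" for k t
      by (auto simp: h_def)
    show "(\<lambda>k. if t \<in> {0..real k} then h t else 0) \<longlonglongrightarrow> h t" if "t \<in> {0..}" for t
    proof (rule tendsto_eventually)
      show "\<forall>\<^sub>F k in sequentially. (if t \<in> {0..real k} then h t else 0) = h t"
        using eventually_ge_at_top[of "nat \<lceil>t\<rceil>"]
      proof eventually_elim
        case (elim k)
        have "t \<le> real k" using elim by linarith
        then show ?case using that by simp
      qed
    qed
  qed
  moreover have "integral {0..} (\<lambda>t. if t \<in> {0..real k} then h t else 0) = integral {0..real k} h" for k
    using has_integral_restrict[OF sub, of k h] int[of k]
    by (meson has_integral_integral integral_unique)
  ultimately show ?thesis using h unfolding h_def by (simp add: integral_unique)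
qed

lemma dirichlet_series_laplace:
  fixes f :: "nat \<Rightarrow> real"
  assumes d: "d > 0" and a: "0 < a" "a \<le> 1"
    and A: "\<And>u. u \<ge> 0 \<Longrightarrow> \<bar>(\<Sum>n\<le>nat \<lfloor>exp u\<rfloor>. f n / real n) - C * u powr a\<bar> \<le> K"
    and sums: "(\<lambda>n. f n * real n powr (- (1 + d))) sums s"
  shows "\<bar>s - C * d powr (- a) * Gamma (1 + a)\<bar> \<le> K"
proof -
  define B where "B u = (\<Sum>n\<le>nat \<lfloor>exp u\<rfloor>. f n / real n)" for u :: real
  define P where "P V = (\<Sum>n\<le>nat \<lfloor>exp (V / d)\<rfloor>. f n / real n * (real n powr (- d) - exp (- V)))" for V
  define h where "h v = v powr a * exp (- v)" for v :: real
  have K0: "K \<ge> 0" using A[of 0] by linarith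
  have step1: "((\<lambda>v. B (v / d) * exp (- v)) has_integral P V) {0..V}" if V: "V \<ge> 0" for V
  proof -
    let ?N = "{..nat \<lfloor>exp (V / d)\<rfloor>}"
    have "((\<lambda>v. \<Sum>n\<in>?N. f n / real n * (if v \<in> {d * ln (real n)..V} then exp (- v) else 0)) has_integral P V) {0..V}"
      unfolding P_def
    proof (rule has_integral_sum)
      fix n assume n: "n \<in> ?N"
      show "((\<lambda>v. f n / real n * (if v \<in> {d * ln (real n)..V} then exp (- v) else 0)) has_integral
         f n / real n * (real n powr (- d) - exp (- V))) {0..V}"
      proof (cases "n = 0")
        case False
        then have "ln (real n) \<le> V / d" using n by (simp add: le_nat_floor_exp_iff)
        then have le: "d * ln (real n) \<le> V" using d by (simp add: field_simps)
        have ge: "0 \<le> d * ln (real n)" using d False by simp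
        have "((\<lambda>v. exp (- v)) has_integral (- exp (- V) - (- exp (- (d * ln (real n)))))) {d * ln (real n)..V}"
          by (rule fundamental_theorem_of_calculus[OF le])
             (auto intro!: derivative_eq_intros simp: has_real_derivative_iff_has_vector_derivative[symmetric])
        moreover have "exp (- (d * ln (real n))) = real n powr (- d)"
          using False by (simp add: powr_def)
        ultimately have "((\<lambda>v. exp (- v)) has_integral (real n powr (- d) - exp (- V))) {d * ln (real n)..V}"
          by simp
        moreover have "{d * ln (real n)..V} \<subseteq> {0..V}" using ge by auto
        ultimately have "((\<lambda>v. if v \<in> {d * ln (real n)..V} then exp (- v) else 0) has_integral (real n powr (- d) - exp (- V))) {0..V}"
          by (subst has_integral_restrict)
        then show ?thesis by (rule has_integral_mult_right)
      qed auto
    qed auto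
    then show ?thesis
    proof (rule has_integral_eq[rotated])
      fix v assume v: "v \<in> {0..V}"
      have iff: "n \<le> nat \<lfloor>exp (v / d)\<rfloor> \<longleftrightarrow> n = 0 \<or> d * ln (real n) \<le> v" for n
        using d by (simp add: le_nat_floor_exp_iff pos_le_divide_eq mult.commute)
      have "(\<Sum>n\<in>?N. f n / real n * (if v \<in> {d * ln (real n)..V} then exp (- v) else 0))
         = (\<Sum>n\<le>nat \<lfloor>exp (v / d)\<rfloor>. f n / real n * exp (- v))"
      proof (rule sum.mono_neutral_cong_right)
        have "exp (v / d) \<le> exp (V / d)" using v d by (simp add: divide_right_mono)
        then have "nat \<lfloor>exp (v / d)\<rfloor> \<le> nat \<lfloor>exp (V / d)\<rfloor>" by (intro nat_mono floor_mono)
        then show "{..nat \<lfloor>exp (v / d)\<rfloor>} \<subseteq> ?N" by simp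
        show "\<forall>n\<in>?N - {..nat \<lfloor>exp (v / d)\<rfloor>}.
          f n / real n * (if v \<in> {d * ln (real n)..V} then exp (- v) else 0) = 0"
        proof
          fix n assume "n \<in> ?N - {..nat \<lfloor>exp (v / d)\<rfloor>}"
          then have "\<not> n \<le> nat \<lfloor>exp (v / d)\<rfloor>" by simp
          then have "\<not> d * ln (real n) \<le> v" unfolding iff by blast
          then show "f n / real n * (if v \<in> {d * ln (real n)..V} then exp (- v) else 0) = 0" by simp
        qed
        fix n
        show "f n / real n * (if v \<in> {d * ln (real n)..V} then exp (- v) else 0) = f n / real n * exp (- v)"
          if "n \<in> {..nat \<lfloor>exp (v / d)\<rfloor>}"
        proof -
          have "n \<le> nat \<lfloor>exp (v / d)\<rfloor>" using that by simp
          then have "n = 0 \<or> d * ln (real n) \<le> v" unfolding iff .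
          then show ?thesis using v by auto
        qed
      qed simp
      then show "(\<Sum>n\<in>?N. f n / real n * (if v \<in> {d * ln (real n)..V} then exp (- v) else 0)) = B (v / d) * exp (- v)"
        by (simp add: B_def sum_distrib_right)
    qed
  qed
  have step2: "\<bar>P V - C * d powr (- a) * integral {0..V} h\<bar> \<le> K" if V: "V \<ge> 0" for V
  proof -
    have hint: "h integrable_on {0..V}"
      unfolding h_def using a
      by (intro integrable_continuous_interval continuous_on_mult continuous_on_powr' continuous_intros) auto
    have "((\<lambda>v. B (v / d) * exp (- v) - C * d powr (- a) * h v) has_integral
        (P V - C * d powr (- a) * integral {0..V} h)) {0..V}"
      by (intro has_integral_diff step1 V has_integral_mult_right integrable_integral hint)
    moreover have "((\<lambda>v. K * exp (- v)) has_integral (K * (- exp (- V) - (- exp (- 0))))) {0..V}"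
      by (intro has_integral_mult_right fundamental_theorem_of_calculus V)
         (auto intro!: derivative_eq_intros simp: has_real_derivative_iff_has_vector_derivative[symmetric])
    moreover have "norm (B (v / d) * exp (- v) - C * d powr (- a) * h v) \<le> K * exp (- v)"
      if v: "v \<in> {0..V}" for v
    proof -
      have "(v / d) powr a = d powr (- a) * v powr a"
        using v d by (simp add: powr_divide powr_minus_divide)
      then have "B (v / d) * exp (- v) - C * d powr (- a) * h v = (B (v / d) - C * (v / d) powr a) * exp (- v)"
        by (simp add: h_def algebra_simps)
      moreover have "\<bar>B (v / d) - C * (v / d) powr a\<bar> \<le> K" unfolding B_def using v d by (intro A) auto
      ultimately show ?thesis by (simp add: abs_mult mult_right_mono)
    qed
    ultimately have "norm (P V - C * d powr (- a) * integral {0..V} h) \<le> K * (- exp (- V) - (- exp (- 0)))"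
      by (metis (no_types, lifting) has_integral_integrable integral_norm_bound_integral integral_unique)
    also have "\<dots> \<le> K" using K0 by (simp add: algebra_simps)
    finally show ?thesis by simp
  qed
  have lim1: "(\<lambda>k. \<Sum>n\<le>nat \<lfloor>exp (real k / d)\<rfloor>. f n * real n powr (- (1 + d))) \<longlonglongrightarrow> s"
  proof -
    have "(\<lambda>N. \<Sum>n\<le>N. f n * real n powr (- (1 + d))) \<longlonglongrightarrow> s" using sums by (simp add: sums_def_le)
    moreover have "filterlim (\<lambda>k. nat \<lfloor>exp (real k / d)\<rfloor>) at_top sequentially"
      using d by real_asymp
    ultimately show ?thesis by (rule filterlim_compose)
  qed
  have lim2: "(\<lambda>k. exp (- real k) * B (real k / d)) \<longlonglongrightarrow> 0"
  proof (rule Lim_null_comparison)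
    show "\<forall>\<^sub>F k in sequentially. norm (exp (- real k) * B (real k / d)) \<le> exp (- real k) * (K + \<bar>C\<bar> * (1 + real k / d))"
    proof (intro always_eventually allI)
      fix k
      have "\<bar>B (real k / d) - C * (real k / d) powr a\<bar> \<le> K" unfolding B_def using d by (intro A) auto
      moreover have "\<bar>C * (real k / d) powr a\<bar> = \<bar>C\<bar> * (real k / d) powr a" by (simp add: abs_mult)
      ultimately have "\<bar>B (real k / d)\<bar> \<le> K + \<bar>C\<bar> * (real k / d) powr a" by linarith
      also have "(real k / d) powr a \<le> 1 + real k / d"
      proof (cases "real k / d \<le> 1")
        case True
        then have "(real k / d) powr a \<le> 1 powr a" using a d by (intro powr_mono2) auto
        moreover have "0 \<le> real k / d" using d by simp
        ultimately show ?thesis unfolding powr_one_eq_one by linarith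
      next
        case False
        then have "(real k / d) powr a \<le> (real k / d) powr 1" using a by (intro powr_mono) auto
        then show ?thesis using False by simp
      qed
      finally have "\<bar>B (real k / d)\<bar> \<le> K + \<bar>C\<bar> * (1 + real k / d)" by (simp add: mult_left_mono)
      then show "norm (exp (- real k) * B (real k / d)) \<le> exp (- real k) * (K + \<bar>C\<bar> * (1 + real k / d))"
        by (simp add: abs_mult)
    qed
    have "(\<lambda>k. exp (- real k)) \<longlonglongrightarrow> 0" "(\<lambda>k. real k * exp (- real k)) \<longlonglongrightarrow> 0" by real_asymp+
    then have "(\<lambda>k. (K + \<bar>C\<bar>) * exp (- real k) + \<bar>C\<bar> / d * (real k * exp (- real k))) \<longlonglongrightarrow>
        (K + \<bar>C\<bar>) * 0 + \<bar>C\<bar> / d * 0"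
      by (intro tendsto_intros)
    then show "(\<lambda>k. exp (- real k) * (K + \<bar>C\<bar> * (1 + real k / d))) \<longlonglongrightarrow> 0"
      by (simp add: algebra_simps)
  qed
  have "P V = (\<Sum>n\<le>nat \<lfloor>exp (V / d)\<rfloor>. f n * real n powr (- (1 + d))) - exp (- V) * B (V / d)" for V
  proof -
    have "f n / real n * (real n powr (- d) - exp (- V)) = f n * real n powr (- (1 + d)) - exp (- V) * (f n / real n)" for n
    proof (cases "n = 0")
      case False
      then have "real n powr (- (1 + d)) = real n powr (- d) / real n"
        using powr_add[of "real n" "-1" "- d"] by (simp add: powr_minus divide_inverse)
      then show ?thesis by (simp add: algebra_simps)
    qed auto
    then show ?thesis by (simp add: P_def B_def sum_subtractf sum_distrib_left)
  qed
  then have "(\<lambda>k. P (real k)) \<longlonglongrightarrow> s - 0" by (simp only:) (intro tendsto_diff lim1 lim2)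
  then have "(\<lambda>k. \<bar>P (real k) - C * d powr (- a) * integral {0..real k} h\<bar>) \<longlonglongrightarrow> \<bar>s - 0 - C * d powr (- a) * Gamma (1 + a)\<bar>"
    unfolding h_def by (intro tendsto_intros Gamma_integral_tendsto a)
  then have "\<bar>s - 0 - C * d powr (- a) * Gamma (1 + a)\<bar> \<le> K"
    by (rule tendsto_upperbound) (auto intro!: always_eventually step2)
  then show ?thesis by simp
qed

definition rough :: "nat \<Rightarrow> nat set" where
  "rough P = {n. n > 0 \<and> (\<forall>p\<le>P. prime p \<longrightarrow> \<not> p dvd n)}"

lemma one_in_rough: "1 \<in> rough P" by (auto simp: rough_def)

lemma rough_gt: "n \<in> rough P \<Longrightarrow> n \<noteq> 1 \<Longrightarrow> n > P"
proof (rule ccontr)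
  assume n: "n \<in> rough P" "n \<noteq> 1" "\<not> n > P"
  then obtain p where p: "prime p" "p dvd n" using prime_factor_nat by blast
  then have "p \<le> n" using n by (auto simp: rough_def intro: dvd_imp_le)
  then show False using n p by (auto simp: rough_def)
qed

lemma rough_Suc_nonprime: "\<not> prime (Suc P) \<Longrightarrow> rough (Suc P) = rough P"
  by (auto simp: rough_def le_Suc_eq)

lemma rough_mult_prime:
  assumes "prime p" "p = Suc P"
  shows "p * n \<in> rough P \<longleftrightarrow> n \<in> rough P"
proof -
  have "q dvd p * n \<longleftrightarrow> q dvd n" if "q \<le> P" "prime q" for q
  proof -
    have "\<not> q dvd p" using that assms primes_dvd_imp_eq[of q p] by auto
    then show ?thesis using that by (simp add: prime_dvd_mult_iff)
  qed
  then show ?thesis using assms(2) by (auto simp: rough_def)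
qed

lemma infsum_rough_tendsto:
  fixes f :: "nat \<Rightarrow> real"
  assumes "summable (\<lambda>n. \<bar>f n\<bar>)" "f 1 = 1" "1 \<in> B"
  shows "(\<lambda>P. infsum f (B \<inter> rough P)) \<longlonglongrightarrow> 1"
proof -
  have s: "f summable_on UNIV" "(\<lambda>n. \<bar>f n\<bar>) summable_on UNIV"
    using assms(1) by (auto intro!: norm_summable_imp_summable_on)
  note sf = summable_on_subset_banach[OF s(1) subset_UNIV]
  note sa = summable_on_subset_banach[OF s(2) subset_UNIV]
  have bound: "norm (infsum f (B \<inter> rough P) - 1) \<le> (\<Sum>n. \<bar>f n\<bar>) - (\<Sum>n\<le>P. \<bar>f n\<bar>)" for P
  proof -
    have "B \<inter> rough P = {1} \<union> (B \<inter> rough P - {1})" using assms one_in_rough by auto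
    then have "infsum f (B \<inter> rough P) = infsum f ({1} \<union> (B \<inter> rough P - {1}))" by (rule arg_cong)
    also have "\<dots> = infsum f {1} + infsum f (B \<inter> rough P - {1})"
      by (rule infsum_Un_disjoint[OF sf sf]) auto
    finally have "infsum f (B \<inter> rough P) = infsum f {1} + infsum f (B \<inter> rough P - {1})" .
    then have "norm (infsum f (B \<inter> rough P) - 1) = norm (infsum f (B \<inter> rough P - {1}))"
      using assms by simp
    also have "\<dots> \<le> infsum (\<lambda>n. norm (f n)) (B \<inter> rough P - {1})"
      by (rule norm_infsum_bound) (use sa in auto)
    also have "\<dots> \<le> infsum (\<lambda>n. \<bar>f n\<bar>) {P<..}"
      unfolding real_norm_def using sa by (intro infsum_mono2) (auto intro: rough_gt simp del: One_nat_def)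
    also have "\<dots> = infsum (\<lambda>n. \<bar>f n\<bar>) UNIV - infsum (\<lambda>n. \<bar>f n\<bar>) {..P}"
    proof -
      have "UNIV = {..P} \<union> {P<..}" by auto
      moreover have "{..P} \<inter> {P<..} = {}" by auto
      ultimately show ?thesis using infsum_Un_disjoint[OF sa sa, of "{..P}" "{P<..}"] by simp
    qed
    also have "infsum (\<lambda>n. \<bar>f n\<bar>) UNIV = (\<Sum>n. \<bar>f n\<bar>)"
      using assms(1) by (intro infsumI norm_summable_imp_has_sum summable_sums) auto
    finally show ?thesis by simp
  qed
  have "(\<lambda>P. (\<Sum>n. \<bar>f n\<bar>) - (\<Sum>n\<le>P. \<bar>f n\<bar>)) \<longlonglongrightarrow> (\<Sum>n. \<bar>f n\<bar>) - (\<Sum>n. \<bar>f n\<bar>)"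
    by (intro tendsto_diff tendsto_const summable_LIMSEQ' assms)
  then have lim0: "(\<lambda>P. (\<Sum>n. \<bar>f n\<bar>) - (\<Sum>n\<le>P. \<bar>f n\<bar>)) \<longlonglongrightarrow> 0" by simp
  have "(\<lambda>P. infsum f (B \<inter> rough P) - 1) \<longlonglongrightarrow> 0"
    by (rule Lim_null_comparison[OF always_eventually[OF allI[OF bound]] lim0])
  then show ?thesis by (simp add: LIM_zero_iff)
qed

abbreviation primes_le :: "nat \<Rightarrow> nat set" where
  "primes_le P \<equiv> {p. p \<le> P \<and> prime p}"

lemma primes_le_Suc: "primes_le (Suc P) = (if prime (Suc P) then insert (Suc P) (primes_le P) else primes_le P)"
  by (auto simp: le_Suc_eq)

lemma euler_product:
  fixes f :: "nat \<Rightarrow> real"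
  assumes sm: "summable (\<lambda>n. \<bar>f n\<bar>)" and f: "f 0 = 0" "f 1 = 1" "\<And>m n. f (m * n) = f m * f n"
  shows "(\<lambda>P. (\<Sum>n. f n) * (\<Prod>p\<in>primes_le P. 1 - f p)) \<longlonglongrightarrow> 1"
proof -
  have s: "f summable_on UNIV" using sm by (intro norm_summable_imp_summable_on) auto
  note sf = summable_on_subset_banach[OF s(1) subset_UNIV]
  have "infsum f (rough P) = (\<Sum>n. f n) * (\<Prod>p\<in>primes_le P. 1 - f p)" for P
  proof (induction P)
    case 0
    have "infsum f (rough 0) = infsum f UNIV"
      by (rule infsum_cong_neutral) (auto simp: rough_def f)
    also have "\<dots> = (\<Sum>n. f n)"
      using sm summable_norm_cancel[of f]
      by (intro infsumI norm_summable_imp_has_sum summable_sums) auto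
    moreover have "(\<Prod>p\<in>primes_le 0. 1 - f p) = 1" by (rule prod.neutral) auto
    ultimately show ?case by simp
  next
    case (Suc P)
    show ?case
    proof (cases "prime (Suc P)")
      case True
      define p where "p = Suc P"
      have p: "prime p" using True p_def by simp
      have split: "rough P = rough p \<union> (*) p ` rough P"
      proof (intro equalityI subsetI)
        fix n assume n: "n \<in> rough P"
        show "n \<in> rough p \<union> (*) p ` rough P"
        proof (cases "p dvd n")
          case True
          then obtain m where "n = p * m" by (elim dvdE)
          then show ?thesis using n rough_mult_prime[OF p p_def] by auto
        qed (use n in \<open>auto simp: rough_def p_def le_Suc_eq\<close>)
      next
        fix n assume "n \<in> rough p \<union> (*) p ` rough P"
        then show "n \<in> rough P" using rough_mult_prime[OF p p_def] by (auto simp: rough_def p_def)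
      qed
      have disj: "rough p \<inter> (*) p ` rough P = {}" using p by (auto simp: rough_def)
      have "infsum f (rough P) = infsum f (rough p \<union> (*) p ` rough P)" using split by (rule arg_cong)
      also have "\<dots> = infsum f (rough p) + infsum f ((*) p ` rough P)"
        by (rule infsum_Un_disjoint[OF sf sf disj])
      also have "infsum f ((*) p ` rough P) = infsum (f \<circ> (*) p) (rough P)"
        using p by (intro infsum_reindex) (auto simp: inj_on_def)
      also have "\<dots> = f p * infsum f (rough P)"
        unfolding o_def f(3) by (rule infsum_cmult_right')
      finally have "infsum f (rough p) = infsum f (rough P) - f p * infsum f (rough P)" by linarith
      also have "\<dots> = infsum f (rough P) * (1 - f p)" by (simp add: algebra_simps)
      finally have "infsum f (rough p) = infsum f (rough P) * (1 - f p)" .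
      then show ?thesis using Suc True by (simp add: primes_le_Suc p_def)
    next
      case False
      then show ?thesis using Suc by (simp add: primes_le_Suc rough_Suc_nonprime)
    qed
  qed
  moreover have "(\<lambda>P. infsum f (UNIV \<inter> rough P)) \<longlonglongrightarrow> 1"
    by (intro infsum_rough_tendsto sm f) auto
  ultimately show ?thesis by simp
qed

lemma euler_product_G4:
  fixes f :: "nat \<Rightarrow> real"
  assumes sm: "summable (\<lambda>n. \<bar>f n\<bar>)" and f: "f 0 = 0" "f 1 = 1" "\<And>m n. f (m * n) = f m * f n"
  obtains T where "T \<longlonglongrightarrow> 1"
    "\<And>P. infsum f G4 = (\<Prod>p\<in>primes_le P. if p mod 4 = 1 then 1 + f p else 1) * T P"
proof
  have s: "f summable_on UNIV" using sm by (intro norm_summable_imp_summable_on) auto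
  note sf = summable_on_subset_banach[OF s(1) subset_UNIV]
  show "(\<lambda>P. infsum f (G4 \<inter> rough P)) \<longlonglongrightarrow> 1"
    by (intro infsum_rough_tendsto sm f one_in_G4)
  fix P
  show "infsum f G4 = (\<Prod>p\<in>primes_le P. if p mod 4 = 1 then 1 + f p else 1) * infsum f (G4 \<inter> rough P)"
  proof (induction P)
    case 0
    have "G4 \<inter> rough 0 = G4" by (auto simp: rough_def G4_pos)
    moreover have "(\<Prod>p\<in>primes_le 0. if p mod 4 = 1 then 1 + f p else 1) = 1"
      by (rule prod.neutral) auto
    ultimately show ?case by simp
  next
    case (Suc P)
    consider "\<not> prime (Suc P)" | "prime (Suc P)" "Suc P mod 4 \<noteq> 1" | "prime (Suc P)" "Suc P mod 4 = 1" by blast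
    then show ?case
    proof cases
      case 1
      then show ?thesis using Suc by (simp add: primes_le_Suc rough_Suc_nonprime)
    next
      case 2
      then have "G4 \<inter> rough (Suc P) = G4 \<inter> rough P"
        by (auto simp: rough_def le_Suc_eq dest: G4_prime_dvd)
      then show ?thesis using Suc 2 by (simp add: primes_le_Suc)
    next
      case 3
      define p where "p = Suc P"
      have p: "prime p" "p mod 4 = 1" using 3 p_def by auto
      have split: "G4 \<inter> rough P = (G4 \<inter> rough p) \<union> (*) p ` (G4 \<inter> rough p)"
      proof (intro equalityI subsetI)
        fix n assume n: "n \<in> G4 \<inter> rough P"
        show "n \<in> (G4 \<inter> rough p) \<union> (*) p ` (G4 \<inter> rough p)"
        proof (cases "p dvd n")
          case True
          then obtain m where m: "n = p * m" by (elim dvdE)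
          have "m \<in> G4" using n m by (auto intro: G4_dvd)
          moreover have "m \<in> rough P" using n m rough_mult_prime[OF p(1) p_def] by auto
          moreover have "\<not> p dvd m"
            using squarefree_not_dvd_div[OF G4_squarefree p(1) True] n m p by auto
          ultimately show ?thesis using m by (auto simp: rough_def p_def le_Suc_eq)
        qed (use n in \<open>auto simp: rough_def p_def le_Suc_eq\<close>)
      next
        fix n assume "n \<in> (G4 \<inter> rough p) \<union> (*) p ` (G4 \<inter> rough p)"
        then show "n \<in> G4 \<inter> rough P"
        proof
          assume "n \<in> (*) p ` (G4 \<inter> rough p)"
          then obtain m where m: "n = p * m" "m \<in> G4" "m \<in> rough p" by auto
          have "m \<in> rough P" "\<not> p dvd m" using m p by (auto simp: rough_def p_def)
          then show ?thesis
            using m G4_times_prime[OF m(2) p] rough_mult_prime[OF p(1) p_def] by (auto simp: mult.commute)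
        qed (auto simp: rough_def p_def)
      qed
      have disj: "(G4 \<inter> rough p) \<inter> (*) p ` (G4 \<inter> rough p) = {}" using p by (auto simp: rough_def)
      have "infsum f (G4 \<inter> rough P) = infsum f ((G4 \<inter> rough p) \<union> (*) p ` (G4 \<inter> rough p))"
        using split by (rule arg_cong)
      also have "\<dots> = infsum f (G4 \<inter> rough p) + infsum f ((*) p ` (G4 \<inter> rough p))"
        by (rule infsum_Un_disjoint[OF sf sf disj])
      also have "infsum f ((*) p ` (G4 \<inter> rough p)) = infsum (f \<circ> (*) p) (G4 \<inter> rough p)"
        using p by (intro infsum_reindex) (auto simp: inj_on_def)
      also have "\<dots> = f p * infsum f (G4 \<inter> rough p)"
        unfolding o_def f(3) by (rule infsum_cmult_right')
      also have "infsum f (G4 \<inter> rough p) + f p * infsum f (G4 \<inter> rough p) = infsum f (G4 \<inter> rough p) * (1 + f p)"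
        by (simp add: algebra_simps)
      finally have "infsum f (G4 \<inter> rough P) = infsum f (G4 \<inter> rough p) * (1 + f p)" .
      then show ?thesis using Suc 3 by (simp add: primes_le_Suc p_def)
    qed
  qed
qed

definition kappa_factor :: "nat \<Rightarrow> real" where
  "kappa_factor p = (if prime p \<and> p mod 4 = 1 then sqrt (1 - 1 / (real p)\<^sup>2) else 1)"

lemma kappa_factor_pos: "kappa_factor p > 0"
proof -
  have "1 / (real p)\<^sup>2 < 1" if "prime p"
  proof -
    have "1 < (real p)\<^sup>2" using prime_gt_1_nat[OF that] by (intro one_less_power) auto
    then show ?thesis by (intro divide_less_eq_1_pos[THEN iffD2]) linarith+
  qed
  then show ?thesis by (auto simp: kappa_factor_def)
qed

lemma convergent_prod_kappa_factor: "convergent_prod kappa_factor"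
proof (rule abs_convergent_prod_imp_convergent_prod, rule summable_imp_abs_convergent_prod,
       rule summable_comparison_test)
  show "\<exists>N. \<forall>n\<ge>N. norm (norm (kappa_factor n - 1)) \<le> inverse (real n ^ 2)"
  proof (intro exI[of _ 0] allI impI)
    fix p :: nat
    show "norm (norm (kappa_factor p - 1)) \<le> inverse (real p ^ 2)"
    proof (cases "prime p \<and> p mod 4 = 1")
      case True
      define y where "y = 1 - 1 / (real p)\<^sup>2"
      have "0 \<le> y" "y \<le> 1" using prime_gt_0_nat[of p] True
        by (auto simp: y_def field_simps power2_eq_square intro: mult_ge1_I)
      then have "y \<le> sqrt y" "sqrt y \<le> 1"
        by (auto intro!: real_le_rsqrt simp: power2_eq_square mult_left_le)
      then show ?thesis using True by (simp add: kappa_factor_def y_def inverse_eq_divide)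
    qed (auto simp: kappa_factor_def)
  qed
  show "summable (\<lambda>n. inverse (real n ^ 2))" by (rule inverse_power_summable) auto
qed

lemma kappa'_eq: "kappa' = prodinf kappa_factor"
  unfolding kappa'_def kappa_factor_def ..

lemma kappa'_pos: "kappa' > 0"
proof -
  have lim: "(\<lambda>n. \<Prod>i\<le>n. kappa_factor i) \<longlonglongrightarrow> kappa'"
    unfolding kappa'_eq by (rule convergent_prod_LIMSEQ[OF convergent_prod_kappa_factor])
  have "kappa' \<noteq> 0" unfolding kappa'_eq
    using kappa_factor_pos by (intro prodinf_nonzero convergent_prod_kappa_factor) (metis less_irrefl)
  moreover have "kappa' \<ge> 0"
    by (rule tendsto_lowerbound[OF lim])
       (auto intro!: always_eventually prod_nonneg less_imp_le[OF kappa_factor_pos])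
  ultimately show ?thesis by simp
qed

lemma kappa'_tendsto: "(\<lambda>P. \<Prod>p\<in>primes_le P. kappa_factor p) \<longlonglongrightarrow> kappa'"
proof -
  have "(\<Prod>p\<in>primes_le P. kappa_factor p) = (\<Prod>i\<le>P. kappa_factor i)" for P
    by (rule prod.mono_neutral_left) (auto simp: kappa_factor_def)
  then show ?thesis
    using convergent_prod_LIMSEQ[OF convergent_prod_kappa_factor] by (simp add: kappa'_eq)
qed

definition zf :: "real \<Rightarrow> nat \<Rightarrow> real" where "zf s n = real n powr (- s)"

text \<open>
  The factor at \<open>p\<close> of \<open>F(s)\<^sup>2 / (zeta(s) * L(s, chi4))\<close>, where \<open>F\<close> is the Dirichlet series of
  the indicator of \<^const>\<open>G4\<close>; the product of these factors still converges at \<open>s = 1\<close>.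
\<close>

definition euler_factor :: "real \<Rightarrow> nat \<Rightarrow> real" where
  "euler_factor s p = (if p mod 4 = 1 then 1 + zf s p else 1)\<^sup>2 * ((1 - zf s p) * (1 - chi4 p * zf s p))"

definition euler_partial :: "real \<Rightarrow> nat \<Rightarrow> real" where
  "euler_partial s P = (\<Prod>p\<in>primes_le P. euler_factor s p)"

lemma zf_mult: "zf s (m * n) = zf s m * zf s n"
  by (simp add: zf_def powr_mult)

lemma zf_simps [simp]: "zf s 0 = 0" "zf s 1 = 1" "zf s (Suc 0) = 1" by (simp_all add: zf_def)

lemma zf_nonneg: "zf s n \<ge> 0" by (simp add: zf_def)

lemma summable_zf: "s > 1 \<Longrightarrow> summable (zf s)"
  unfolding zf_def by (simp add: summable_real_powr_iff)

lemma summable_chi4_zf: "s > 1 \<Longrightarrow> summable (\<lambda>n. \<bar>chi4 n * zf s n\<bar>)"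
  by (rule summable_comparison_test'[OF summable_zf])
     (auto simp: abs_mult zf_nonneg intro!: mult_left_le_one_le abs_chi4_le)

lemma euler_partial_tendsto:
  assumes s: "s > 1"
  shows "(\<Sum>n. zf s n) \<noteq> 0" "(\<Sum>n. chi4 n * zf s n) \<noteq> 0"
    "euler_partial s \<longlonglongrightarrow> (infsum (zf s) G4)\<^sup>2 / ((\<Sum>n. zf s n) * (\<Sum>n. chi4 n * zf s n))"
proof -
  define Z where "Z = (\<Sum>n. zf s n)"
  define L where "L = (\<Sum>n. chi4 n * zf s n)"
  define F where "F = infsum (zf s) G4"
  define A where "A P = Z * (\<Prod>p\<in>primes_le P. 1 - zf s p)" for P
  define B where "B P = L * (\<Prod>p\<in>primes_le P. 1 - chi4 p * zf s p)" for P
  have sa: "summable (\<lambda>n. \<bar>zf s n\<bar>)" using summable_zf[OF s] by (simp add: zf_nonneg)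
  have A: "A \<longlonglongrightarrow> 1" unfolding A_def Z_def
    by (intro euler_product sa) (auto simp: zf_mult)
  have B: "B \<longlonglongrightarrow> 1" unfolding B_def L_def
    by (intro euler_product summable_chi4_zf s) (auto simp: zf_mult chi4_mult, simp add: chi4_def)
  obtain T where T: "T \<longlonglongrightarrow> 1"
    "\<And>P. F = (\<Prod>p\<in>primes_le P. if p mod 4 = 1 then 1 + zf s p else 1) * T P"
    unfolding F_def by (rule euler_product_G4[OF sa, OF _ _ zf_mult]) auto
  have Z0: "Z \<noteq> 0"
  proof
    assume "Z = 0"
    then have "A = (\<lambda>_. 0)" by (auto simp: A_def)
    then have "(\<lambda>_::nat. 0::real) \<longlonglongrightarrow> 1" using A by simp
    then show False by (simp add: LIMSEQ_const_iff)
  qed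
  have L0: "L \<noteq> 0"
  proof
    assume "L = 0"
    then have "B = (\<lambda>_. 0)" by (auto simp: B_def)
    then have "(\<lambda>_::nat. 0::real) \<longlonglongrightarrow> 1" using B by simp
    then show False by (simp add: LIMSEQ_const_iff)
  qed
  have eq: "F\<^sup>2 * (A P * B P) = Z * L * euler_partial s P * (T P)\<^sup>2" for P
    unfolding T(2)[of P] A_def B_def euler_partial_def euler_factor_def prod.distrib
    by (simp add: power_mult_distrib prod_power_distrib mult_ac)
  have "(\<lambda>P. F\<^sup>2 * (A P * B P) / (Z * L * (T P)\<^sup>2)) \<longlonglongrightarrow> F\<^sup>2 * (1 * 1) / (Z * L * 1\<^sup>2)"
    using Z0 L0 by (intro tendsto_intros A B T) auto
  moreover have "\<forall>\<^sub>F P in sequentially. T P \<noteq> 0"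
    using T(1) by (rule tendsto_imp_eventually_ne) auto
  then have "\<forall>\<^sub>F P in sequentially. F\<^sup>2 * (A P * B P) / (Z * L * (T P)\<^sup>2) = euler_partial s P"
    by eventually_elim (use Z0 L0 in \<open>simp add: eq\<close>)
  ultimately have "euler_partial s \<longlonglongrightarrow> F\<^sup>2 * (1 * 1) / (Z * L * 1\<^sup>2)"
    by (rule Lim_transform_eventually)
  then show "euler_partial s \<longlonglongrightarrow> (infsum (zf s) G4)\<^sup>2 / ((\<Sum>n. zf s n) * (\<Sum>n. chi4 n * zf s n))"
    by (simp add: F_def Z_def L_def)
  show "(\<Sum>n. zf s n) \<noteq> 0" "(\<Sum>n. chi4 n * zf s n) \<noteq> 0" using Z0 L0 by (simp_all add: Z_def L_def)
qed

lemma zf_le_inverse: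
  assumes "s \<ge> 1" "n \<ge> 1"
  shows "zf s n \<le> 1 / real n"
proof -
  have "zf s n \<le> real n powr (- 1)" unfolding zf_def using assms by (intro powr_mono) auto
  then show ?thesis using assms by (simp add: powr_minus_divide)
qed

lemma prime_mod_4_cases:
  assumes "prime (p::nat)"
  shows "p = 2 \<or> p mod 4 = 1 \<or> p mod 4 = 3"
proof (cases "p = 2")
  case False
  then have "odd p" using assms prime_odd_nat prime_ge_2_nat[of p] by force
  then show ?thesis by presburger
qed auto

lemma euler_factor_bounds:
  assumes s: "s \<ge> 1" and p: "prime p"
  shows "0 \<le> euler_factor s p" "euler_factor s p \<le> 1"
    "p \<ge> 3 \<Longrightarrow> 1 - euler_factor s p \<le> 2 / (real p)\<^sup>2"
proof -
  define x where "x = zf s p"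
  have p2: "p \<ge> 2" using p prime_ge_2_nat by blast
  have x: "0 \<le> x" "x \<le> 1 / real p" using zf_le_inverse[OF s, of p] p2 by (auto simp: x_def zf_nonneg)
  have "1 / real p \<le> 1 / 2" using p2 by (simp add: field_simps)
  then have x1: "x \<le> 1 / 2" using x by linarith
  have xx: "x\<^sup>2 \<le> 1 / (real p)\<^sup>2" using power_mono[OF x(2,1), of 2] by (simp add: power_divide)
  have xx1: "0 \<le> x\<^sup>2" "x\<^sup>2 \<le> 1" using x x1 by (auto simp: power_le_one)
  have "0 \<le> euler_factor s p \<and> euler_factor s p \<le> 1 \<and> (p \<ge> 3 \<longrightarrow> 1 - euler_factor s p \<le> 2 / (real p)\<^sup>2)"
    using prime_mod_4_cases[OF p]
  proof (elim disjE)
    assume "p = 2"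
    then have "euler_factor s p = 1 - x" by (simp add: euler_factor_def chi4_def x_def)
    then show ?thesis using x x1 \<open>p = 2\<close> by simp
  next
    assume "p mod 4 = 1"
    then have e: "euler_factor s p = (1 - x\<^sup>2)\<^sup>2"
      by (simp add: euler_factor_def chi4_def x_def power2_eq_square algebra_simps)
    have "1 - (1 - x\<^sup>2)\<^sup>2 = 2 * x\<^sup>2 - (x\<^sup>2)\<^sup>2" by (simp add: power2_eq_square algebra_simps)
    moreover have "0 \<le> (x\<^sup>2)\<^sup>2" by simp
    ultimately have "1 - (1 - x\<^sup>2)\<^sup>2 \<le> 2 * x\<^sup>2" by linarith
    then show ?thesis unfolding e using xx xx1 by (auto simp: power_le_one)
  next
    assume "p mod 4 = 3"
    then have e: "euler_factor s p = 1 - x\<^sup>2"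
      by (simp add: euler_factor_def chi4_def x_def power2_eq_square algebra_simps)
    have "0 \<le> 1 / (real p)\<^sup>2" "2 / (real p)\<^sup>2 = 1 / (real p)\<^sup>2 + 1 / (real p)\<^sup>2" by simp_all
    then show ?thesis unfolding e using xx xx1 by linarith
  qed
  then show "0 \<le> euler_factor s p" "euler_factor s p \<le> 1"
    "p \<ge> 3 \<Longrightarrow> 1 - euler_factor s p \<le> 2 / (real p)\<^sup>2" by auto
qed

lemma euler_partial_diff:
  assumes s: "s \<ge> 1" and PQ: "2 \<le> P" "P \<le> Q"
  shows "\<bar>euler_partial s P - euler_partial s Q\<bar> \<le> 2 / real P"
proof -
  have range: "0 \<le> euler_partial s Q" "euler_partial s Q \<le> 1" for Q
    unfolding euler_partial_def using euler_factor_bounds[OF s] by (auto intro!: prod_nonneg prod_le_1)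
  have "0 \<le> euler_partial s P - euler_partial s Q \<and> euler_partial s P - euler_partial s Q \<le> 2 / real P - 2 / real Q"
    using PQ(2)
  proof (induction Q rule: dec_induct)
    case (step Q)
    have Q: "Q \<ge> 2" using step PQ by simp
    have "0 \<le> euler_partial s Q - euler_partial s (Suc Q) \<and>
      euler_partial s Q - euler_partial s (Suc Q) \<le> 2 / (real (Suc Q))\<^sup>2"
    proof (cases "prime (Suc Q)")
      case True
      have e: "euler_partial s Q - euler_partial s (Suc Q) = euler_partial s Q * (1 - euler_factor s (Suc Q))"
        using True by (simp add: euler_partial_def primes_le_Suc algebra_simps)
      have "euler_partial s Q * (1 - euler_factor s (Suc Q)) \<le> 1 * (2 / (real (Suc Q))\<^sup>2)"
        using euler_factor_bounds[OF s True] Q range by (intro mult_mono) auto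
      then show ?thesis unfolding e using euler_factor_bounds[OF s True] range by auto
    qed (auto simp: euler_partial_def primes_le_Suc)
    moreover have "2 / (real (Suc Q))\<^sup>2 \<le> 2 / real Q - 2 / real (Suc Q)"
    proof -
      have "2 / real Q - 2 / real (Suc Q) = 2 / (real Q * real (Suc Q))" using Q by (simp add: field_simps)
      moreover have "2 / (real (Suc Q))\<^sup>2 \<le> 2 / (real Q * real (Suc Q))"
        using Q by (intro divide_left_mono) (auto simp: power2_eq_square)
      ultimately show ?thesis by simp
    qed
    ultimately show ?case using step by linarith
  qed auto
  moreover have "0 \<le> 2 / real Q" by simp
  ultimately show ?thesis by linarith
qed

lemma euler_partial_approx:
  assumes s: "s > 1" and P: "2 \<le> P"
  shows "\<bar>euler_partial s P * ((\<Sum>n. zf s n) * (\<Sum>n. chi4 n * zf s n)) - (infsum (zf s) G4)\<^sup>2\<bar>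
    \<le> 2 / real P * \<bar>(\<Sum>n. zf s n) * (\<Sum>n. chi4 n * zf s n)\<bar>"
proof -
  define D where "D = (\<Sum>n. zf s n) * (\<Sum>n. chi4 n * zf s n)"
  define F where "F = (infsum (zf s) G4)\<^sup>2"
  have D0: "D \<noteq> 0" using euler_partial_tendsto[OF s] by (simp add: D_def)
  have "(\<lambda>Q. \<bar>euler_partial s P - euler_partial s Q\<bar>) \<longlonglongrightarrow> \<bar>euler_partial s P - F / D\<bar>"
    unfolding F_def D_def by (intro tendsto_intros euler_partial_tendsto s)
  moreover have "\<forall>\<^sub>F Q in sequentially. \<bar>euler_partial s P - euler_partial s Q\<bar> \<le> 2 / real P"
    using eventually_ge_at_top[of P] by eventually_elim (use s P in \<open>intro euler_partial_diff, auto\<close>)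
  ultimately have "\<bar>euler_partial s P - F / D\<bar> \<le> 2 / real P" by (rule tendsto_upperbound) auto
  then have "\<bar>euler_partial s P - F / D\<bar> * \<bar>D\<bar> \<le> 2 / real P * \<bar>D\<bar>" by (rule mult_right_mono) auto
  moreover have "\<bar>euler_partial s P - F / D\<bar> * \<bar>D\<bar> = \<bar>euler_partial s P * D - F\<bar>"
    using D0 by (simp add: abs_mult[symmetric] left_diff_distrib)
  ultimately show ?thesis by (simp add: D_def F_def)
qed

lemma euler_partial_1_tendsto: "euler_partial 1 \<longlonglongrightarrow> 4 * kappa'\<^sup>2 / pi\<^sup>2"
proof -
  have z2: "(\<Sum>n. zf 2 n) = pi\<^sup>2 / 6"
  proof -
    have "(\<lambda>n. zf 2 (Suc n)) sums (pi\<^sup>2 / 6)"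
      using inverse_squares_sums by (simp add: zf_def powr_minus_divide powr_numeral)
    then have "zf 2 sums (pi\<^sup>2 / 6 + zf 2 0)" by (subst (asm) sums_Suc_iff) simp
    then show ?thesis by (simp add: sums_iff)
  qed
  have "(\<lambda>P. (\<Sum>n. zf 2 n) * (\<Prod>p\<in>primes_le P. 1 - zf 2 p)) \<longlonglongrightarrow> 1"
    using summable_zf[of 2] by (intro euler_product) (auto simp: zf_mult zf_nonneg)
  then have "(\<lambda>P. (pi\<^sup>2 / 6 * (\<Prod>p\<in>primes_le P. 1 - zf 2 p)) * (6 / pi\<^sup>2)) \<longlonglongrightarrow> 1 * (6 / pi\<^sup>2)"
    unfolding z2 by (intro tendsto_intros)
  then have lim: "(\<lambda>P. \<Prod>p\<in>primes_le P. 1 - zf 2 p) \<longlonglongrightarrow> 6 / pi\<^sup>2" by simp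
  have "euler_partial 1 P = 2 / 3 * ((\<Prod>p\<in>primes_le P. 1 - zf 2 p) * (\<Prod>p\<in>primes_le P. kappa_factor p)\<^sup>2)"
    if P: "P \<ge> 2" for P
  proof -
    have "euler_partial 1 P = (\<Prod>p\<in>primes_le P. (1 - zf 2 p) * (kappa_factor p)\<^sup>2 * (if p = 2 then 2 / 3 else 1))"
      unfolding euler_partial_def
    proof (intro prod.cong refl)
      fix p assume "p \<in> primes_le P"
      then have p: "prime p" by auto
      have p0: "real p > 0" using p prime_gt_0_nat by simp
      have z1: "zf 1 p = 1 / real p" using p0 by (simp add: zf_def powr_minus_divide)
      have z2: "zf 2 p = 1 / (real p)\<^sup>2" using p0 by (simp add: zf_def powr_minus_divide powr_numeral)
      show "euler_factor 1 p = (1 - zf 2 p) * (kappa_factor p)\<^sup>2 * (if p = 2 then 2 / 3 else 1)"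
        using prime_mod_4_cases[OF p]
      proof (elim disjE)
        assume "p = 2"
        then show ?thesis by (simp add: euler_factor_def chi4_def z1[unfolded \<open>p = 2\<close>] z2[unfolded \<open>p = 2\<close>] kappa_factor_def)
      next
        assume m: "p mod 4 = 1"
        have "1 / (real p)\<^sup>2 \<le> 1" using p0 by (simp add: field_simps)
        then have "(kappa_factor p)\<^sup>2 = 1 - 1 / (real p)\<^sup>2" using m p by (simp add: kappa_factor_def)
        moreover have "euler_factor 1 p = (1 - (zf 1 p)\<^sup>2) * (1 - (zf 1 p)\<^sup>2)"
          using m by (simp add: euler_factor_def chi4_def power2_eq_square algebra_simps)
        moreover have "p \<noteq> 2" using m by auto
        ultimately show ?thesis by (simp add: z1 z2 power_divide)
      next
        assume m: "p mod 4 = 3"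
        have "euler_factor 1 p = 1 - (zf 1 p)\<^sup>2"
          using m by (simp add: euler_factor_def chi4_def power2_eq_square algebra_simps)
        moreover have "p \<noteq> 2" using m by auto
        ultimately show ?thesis using m by (simp add: z1 z2 kappa_factor_def power_divide)
      qed
    qed
    also have "\<dots> = (\<Prod>p\<in>primes_le P. 1 - zf 2 p) * (\<Prod>p\<in>primes_le P. kappa_factor p)\<^sup>2
       * (\<Prod>p\<in>primes_le P. if p = 2 then 2 / 3 else 1)"
      by (simp add: prod.distrib prod_power_distrib)
    also have "(\<Prod>p\<in>primes_le P. if p = 2 then 2 / 3 else 1) = (2 / 3 :: real)"
      using P by (subst prod.delta) auto
    finally show ?thesis by simp
  qed
  then have "\<forall>\<^sub>F P in sequentially. 2 / 3 * ((\<Prod>p\<in>primes_le P. 1 - zf 2 p) * (\<Prod>p\<in>primes_le P. kappa_factor p)\<^sup>2) = euler_partial 1 P"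
    by (intro eventually_sequentiallyI[of 2]) (rule sym)
  moreover have "(\<lambda>P. 2 / 3 * ((\<Prod>p\<in>primes_le P. 1 - zf 2 p) * (\<Prod>p\<in>primes_le P. kappa_factor p)\<^sup>2))
      \<longlonglongrightarrow> 2 / 3 * (6 / pi\<^sup>2 * kappa'\<^sup>2)"
    by (intro tendsto_intros lim kappa'_tendsto)
  ultimately have "euler_partial 1 \<longlonglongrightarrow> 2 / 3 * (6 / pi\<^sup>2 * kappa'\<^sup>2)"
    by (rule Lim_transform_eventually[rotated])
  then show ?thesis by simp
qed

lemma harmonic_ln:
  assumes "n \<ge> 1"
  shows "ln (real n) \<le> (\<Sum>k\<le>n. 1 / real k)" "(\<Sum>k\<le>n. 1 / real k) \<le> 1 + ln (real n)"
proof -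
  have "ln (real n) \<le> (\<Sum>k\<le>n. 1 / real k) - 1 / real n \<and> (\<Sum>k\<le>n. 1 / real k) \<le> 1 + ln (real n)"
    using assms
  proof (induction n rule: dec_induct)
    case (step n)
    have n: "real n > 0" using step by simp
    have "ln (real (Suc n)) - ln (real n) = ln (1 + 1 / real n)"
      using n ln_div[of "real (Suc n)" "real n"] by (simp add: add_divide_distrib add.commute)
    also have "\<dots> \<le> 1 / real n" using n by (intro ln_add_one_self_le_self) auto
    finally have 1: "ln (real (Suc n)) - ln (real n) \<le> 1 / real n" .
    have "ln (real n / real (Suc n)) \<le> real n / real (Suc n) - 1" using n by (intro ln_le_minus_one) auto
    also have "\<dots> = - (1 / real (Suc n))" by (simp add: field_simps)
    finally have 2: "1 / real (Suc n) \<le> ln (real (Suc n)) - ln (real n)" using n by (simp add: ln_div)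
    show ?case using 1 2 step n by simp
  qed auto
  moreover have "1 / real n \<ge> 0" by simp
  ultimately show "ln (real n) \<le> (\<Sum>k\<le>n. 1 / real k)" "(\<Sum>k\<le>n. 1 / real k) \<le> 1 + ln (real n)" by linarith+
qed

lemma zeta_approx:
  assumes d: "d > 0"
  shows "\<bar>(\<Sum>n. zf (1 + d) n) - 1 / d\<bar> \<le> 2"
proof -
  have "\<bar>(\<Sum>n. zf (1 + d) n) - 1 * d powr (- 1) * Gamma (1 + 1)\<bar> \<le> 2"
  proof (rule dirichlet_series_laplace[OF d, where f = "\<lambda>_. 1"])
    show "(\<lambda>n. 1 * real n powr (- (1 + d))) sums (\<Sum>n. zf (1 + d) n)"
      using summable_sums[OF summable_zf[of "1 + d"]] d unfolding zf_def by simp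
    fix u :: real assume u: "u \<ge> 0"
    define n where "n = nat \<lfloor>exp u\<rfloor>"
    have e1: "exp u \<ge> 1" using u by simp
    have n: "n \<ge> 1" "real n \<le> exp u" "exp u \<le> 2 * real n"
    proof -
      have "real n = real_of_int \<lfloor>exp u\<rfloor>" "\<lfloor>exp u\<rfloor> \<ge> 1" using e1 unfolding n_def by (auto simp: le_floor_iff)
      then show "n \<ge> 1" "real n \<le> exp u" "exp u \<le> 2 * real n" by linarith+
    qed
    have "ln (real n) \<le> u" using n by (simp add: ln_le_cancel_iff[symmetric, of "real n" "exp u"])
    moreover have "u \<le> ln (2 * real n)" using n by (simp add: ln_ge_iff)
    then have "u \<le> ln 2 + ln (real n)" using n by (simp add: ln_mult)
    ultimately show "\<bar>(\<Sum>n\<le>nat \<lfloor>exp u\<rfloor>. 1 / real n) - 1 * u powr 1\<bar> \<le> 2"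
      using harmonic_ln[OF n(1)] ln_2_less_1 u by (simp add: n_def[symmetric])
  qed auto
  moreover have "Gamma (1 + 1 :: real) = 1" using Gamma_numeral[of "num.Bit0 num.One"] by simp
  ultimately show ?thesis using d by (simp only:) (simp add: powr_minus_divide)
qed

lemma G4_series_approx:
  assumes d: "d > 0" and C: "\<And>x. x \<ge> 1 \<Longrightarrow> \<bar>LG x - C * sqrt (ln x)\<bar> \<le> K"
  shows "\<bar>infsum (zf (1 + d)) G4 - C * (sqrt pi / 2) / sqrt d\<bar> \<le> K"
proof -
  have "\<bar>infsum (zf (1 + d)) G4 - C * d powr (- (1/2)) * Gamma (1 + 1/2)\<bar> \<le> K"
  proof (rule dirichlet_series_laplace[OF d, where f = "\<lambda>n. if n \<in> G4 then 1 else 0"])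
    define g where "g n = (if n \<in> G4 then zf (1 + d) n else 0)" for n
    have sg: "summable g"
      by (rule summable_comparison_test'[OF summable_zf[of "1 + d"]]) (use d in \<open>auto simp: g_def zf_nonneg\<close>)
    have "infsum (zf (1 + d)) G4 = infsum g UNIV"
      by (rule infsum_cong_neutral) (auto simp: g_def)
    also have "\<dots> = suminf g"
    proof (intro infsumI norm_summable_imp_has_sum summable_sums sg)
      have "norm (g n) = g n" for n by (simp add: g_def zf_nonneg)
      then show "summable (\<lambda>n. norm (g n))" using sg by simp
    qed
    finally have "g sums infsum (zf (1 + d)) G4" using sg by (simp add: summable_sums)
    moreover have "g = (\<lambda>n. (if n \<in> G4 then 1 else 0) * real n powr (- (1 + d)))"
      by (auto simp: g_def zf_def)
    ultimately show "(\<lambda>n. (if n \<in> G4 then 1 else 0) * real n powr (- (1 + d))) sums infsum (zf (1 + d)) G4" by simp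
    fix u :: real assume u: "u \<ge> 0"
    have "(\<Sum>n\<le>nat \<lfloor>exp u\<rfloor>. (if n \<in> G4 then 1 else 0) / real n) = LG (exp u)"
      unfolding LG_def
    proof (rule sum.mono_neutral_cong_right)
      show "{m. m \<in> G4 \<and> real m \<le> exp u} \<subseteq> {..nat \<lfloor>exp u\<rfloor>}" by (auto simp: le_nat_floor)
      show "\<forall>i\<in>{..nat \<lfloor>exp u\<rfloor>} - {m. m \<in> G4 \<and> real m \<le> exp u}. (if i \<in> G4 then 1 else 0) / real i = 0"
        by (auto simp: le_nat_floor_exp_iff, (metis G4_pos exp_ge_zero exp_le_cancel_iff exp_ln of_nat_0_less_iff order.refl)+)
    qed auto
    then show "\<bar>(\<Sum>n\<le>nat \<lfloor>exp u\<rfloor>. (if n \<in> G4 then 1 else 0) / real n) - C * u powr (1/2)\<bar> \<le> K"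
      using C[of "exp u"] u by (simp add: powr_half_sqrt)
  qed auto
  moreover have G: "Gamma (1 + 1/2 :: real) = sqrt pi / 2"
  proof -
    have "(1/2 :: real) \<notin> \<int>\<^sub>\<le>\<^sub>0" by (auto dest: nonpos_Ints_nonpos)
    then show ?thesis using Gamma_plus1[of "1/2 :: real"] by (simp add: Gamma_one_half_real add.commute)
  qed
  moreover have P: "d powr (- (1/2)) = 1 / sqrt d" using d powr_minus_divide[of d "1/2"] by (simp add: powr_half_sqrt)
  have "C * d powr (- (1/2)) * Gamma (1 + 1/2) = C * (sqrt pi / 2) / sqrt d" unfolding G P by simp
  ultimately show ?thesis by (simp only:)
qed

lemma zf_tendsto: "((\<lambda>d. zf (1 + d) n) \<longlongrightarrow> zf 1 n) (at_right 0)"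
proof (cases "n = 0")
  case False
  then have "((\<lambda>d. real n powr (- (1 + d))) \<longlongrightarrow> real n powr (- (1 + 0))) (at_right 0)"
    by (intro tendsto_intros) auto
  then show ?thesis by (simp only: zf_def add_0_right)
qed simp

lemma chi4_series_tendsto: "((\<lambda>d. \<Sum>n. chi4 n * zf (1 + d) n) \<longlongrightarrow> pi / 4) (at_right 0)"
proof (rule tendstoI)
  fix e :: real assume e: "e > 0"
  define N where "N = nat \<lceil>4 / e\<rceil> + 1"
  have N: "2 / real N < e / 2" "N \<ge> 1"
  proof -
    have "real N > 4 / e" unfolding N_def by linarith
    then have "4 < e * real N" using e by (simp add: pos_divide_less_eq mult.commute)
    moreover have "real N > 0" by (simp add: N_def)
    ultimately show "2 / real N < e / 2" by (simp add: pos_divide_less_eq)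
    show "N \<ge> 1" by (simp add: N_def)
  qed
  have tail: "\<bar>(\<Sum>n. chi4 n * zf (1 + d) n) - (\<Sum>n\<le>N. chi4 n * zf (1 + d) n)\<bar> \<le> 1 / real N" if d: "d > 0" for d
  proof -
    have sm: "summable (\<lambda>n. chi4 n * zf (1 + d) n)"
      using summable_chi4_zf[of "1 + d"] d by (auto intro: summable_rabs_cancel)
    have "(\<lambda>M. \<bar>(\<Sum>n\<le>M. chi4 n * zf (1 + d) n) - (\<Sum>n\<le>N. chi4 n * zf (1 + d) n)\<bar>)
       \<longlonglongrightarrow> \<bar>(\<Sum>n. chi4 n * zf (1 + d) n) - (\<Sum>n\<le>N. chi4 n * zf (1 + d) n)\<bar>"
      by (intro tendsto_intros summable_LIMSEQ' sm)
    moreover have "\<forall>\<^sub>F M in sequentially. \<bar>(\<Sum>n\<le>M. chi4 n * zf (1 + d) n) - (\<Sum>n\<le>N. chi4 n * zf (1 + d) n)\<bar> \<le> 1 / real N"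
      using eventually_gt_at_top[of N]
    proof eventually_elim
      case (elim M)
      have "{..M} = {..N} \<union> {Suc N..M}" using elim by auto
      then have "(\<Sum>n\<le>M. chi4 n * zf (1 + d) n) - (\<Sum>n\<le>N. chi4 n * zf (1 + d) n) = (\<Sum>n=Suc N..M. chi4 n * zf (1 + d) n)"
        by (simp add: sum.union_disjoint ivl_disj_int)
      moreover have "\<bar>\<Sum>n=Suc N..M. chi4 n * zf (1 + d) n\<bar> \<le> 1 * zf (1 + d) (Suc N)"
        using elim d by (intro abel_bound sum_chi4_abs_le) (auto simp: zf_nonneg, auto simp: zf_def intro!: powr_mono2')
      moreover have "zf (1 + d) (Suc N) \<le> 1 / real (Suc N)" using d by (intro zf_le_inverse) auto
      moreover have "1 / real (Suc N) \<le> 1 / real N" using N by (intro divide_left_mono) auto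
      ultimately show ?case by linarith
    qed
    ultimately show ?thesis by (rule tendsto_upperbound) auto
  qed
  have fin: "\<bar>(\<Sum>n\<le>N. chi4 n * zf 1 n) - pi / 4\<bar> \<le> 1 / real N"
  proof -
    have "(\<Sum>n\<le>N. chi4 n * zf 1 n) = (\<Sum>n=1..N. chi4 n / real n)"
      by (rule sum.mono_neutral_cong_right) (auto simp: zf_def powr_minus_divide)
    moreover have "1 / (real N + 1) \<le> 1 / real N" using N by (intro divide_left_mono) auto
    ultimately show ?thesis using chi4_partial[of N] by linarith
  qed
  have "((\<lambda>d. \<Sum>n\<le>N. chi4 n * zf (1 + d) n) \<longlongrightarrow> (\<Sum>n\<le>N. chi4 n * zf 1 n)) (at_right 0)"
    by (intro tendsto_sum tendsto_mult tendsto_const zf_tendsto)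
  then have "\<forall>\<^sub>F d in at_right 0. dist (\<Sum>n\<le>N. chi4 n * zf (1 + d) n) (\<Sum>n\<le>N. chi4 n * zf 1 n) < e / 2"
    by (rule tendstoD) (use e in auto)
  moreover have "\<forall>\<^sub>F d in at_right (0::real). d > 0" by (rule eventually_at_right_less)
  ultimately show "\<forall>\<^sub>F d in at_right 0. dist (\<Sum>n. chi4 n * zf (1 + d) n) (pi / 4) < e"
  proof eventually_elim
    case (elim d)
    have "2 / real N = 1 / real N + 1 / real N" by simp
    then show ?case using elim(1) tail[OF elim(2)] fin N unfolding dist_real_def by linarith
  qed
qed

lemma LG_constant:
  assumes C0: "C \<ge> 0" and C: "\<And>x. x \<ge> 1 \<Longrightarrow> \<bar>LG x - C * sqrt (ln x)\<bar> \<le> K"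
  shows "C = 2 * kappa' / pi"
proof -
  define Z where "Z d = (\<Sum>n. zf (1 + d) n)" for d
  define L where "L d = (\<Sum>n. chi4 n * zf (1 + d) n)" for d
  define F where "F d = infsum (zf (1 + d)) G4" for d
  have pos: "\<forall>\<^sub>F d in at_right (0::real). d > 0" by (rule eventually_at_right_less)
  have sq0: "((\<lambda>d. sqrt d * K) \<longlongrightarrow> 0) (at_right 0)"
    by (auto intro!: tendsto_eq_intros)
  have F: "((\<lambda>d. sqrt d * F d - C * (sqrt pi / 2)) \<longlongrightarrow> 0) (at_right 0)"
  proof (rule Lim_null_comparison[OF _ sq0])
    show "\<forall>\<^sub>F d in at_right 0. norm (sqrt d * F d - C * (sqrt pi / 2)) \<le> sqrt d * K"
      using pos
    proof eventually_elim
      case (elim d)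
      have "sqrt d * \<bar>F d - C * (sqrt pi / 2) / sqrt d\<bar> \<le> sqrt d * K"
        unfolding F_def using elim by (intro mult_left_mono G4_series_approx C) auto
      moreover have "sqrt d * F d - C * (sqrt pi / 2) = sqrt d * (F d - C * (sqrt pi / 2) / sqrt d)"
        using elim by (simp add: right_diff_distrib)
      ultimately show ?case using elim by (simp add: abs_mult)
    qed
  qed
  then have F': "((\<lambda>d. sqrt d * F d) \<longlongrightarrow> C * (sqrt pi / 2)) (at_right 0)" by (simp add: LIM_zero_iff)
  have Z: "((\<lambda>d. d * Z d - 1) \<longlongrightarrow> 0) (at_right 0)"
  proof (rule Lim_null_comparison)
    show "((\<lambda>d::real. d * 2) \<longlongrightarrow> 0) (at_right 0)" by (auto intro!: tendsto_eq_intros)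
    show "\<forall>\<^sub>F d in at_right 0. norm (d * Z d - 1) \<le> d * 2"
      using pos
    proof eventually_elim
      case (elim d)
      have "d * \<bar>Z d - 1 / d\<bar> \<le> d * 2"
        unfolding Z_def using elim by (intro mult_left_mono zeta_approx) auto
      moreover have "d * Z d - 1 = d * (Z d - 1 / d)" using elim by (simp add: right_diff_distrib)
      ultimately show ?case using elim by (simp add: abs_mult)
    qed
  qed
  then have Z': "((\<lambda>d. d * Z d) \<longlongrightarrow> 1) (at_right 0)" by (simp add: LIM_zero_iff)
  have L: "(L \<longlongrightarrow> pi / 4) (at_right 0)" unfolding L_def by (rule chi4_series_tendsto)
  have bound: "\<bar>euler_partial 1 P - C\<^sup>2\<bar> \<le> 2 / real P" if P: "P \<ge> 2" for P
  proof -
    have W: "((\<lambda>d. euler_partial (1 + d) P) \<longlongrightarrow> euler_partial 1 P) (at_right 0)"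
      unfolding euler_partial_def
    proof (intro tendsto_prod)
      fix p
      show "((\<lambda>d. euler_factor (1 + d) p) \<longlongrightarrow> euler_factor 1 p) (at_right 0)"
        unfolding euler_factor_def
        by (cases "p mod 4 = 1") (simp_all only: if_True if_False simp_thms, (intro tendsto_intros zf_tendsto)+)
    qed
    have "((\<lambda>d. \<bar>euler_partial (1 + d) P * ((d * Z d) * L d) - (sqrt d * F d)\<^sup>2\<bar>) \<longlongrightarrow>
        \<bar>euler_partial 1 P * (1 * (pi / 4)) - (C * (sqrt pi / 2))\<^sup>2\<bar>) (at_right 0)"
      by (intro tendsto_intros W Z' L F')
    moreover have "((\<lambda>d. 2 / real P * \<bar>(d * Z d) * L d\<bar>) \<longlongrightarrow> 2 / real P * \<bar>1 * (pi / 4)\<bar>) (at_right 0)"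
      by (intro tendsto_intros Z' L)
    moreover have "\<forall>\<^sub>F d in at_right 0.
      \<bar>euler_partial (1 + d) P * ((d * Z d) * L d) - (sqrt d * F d)\<^sup>2\<bar> \<le> 2 / real P * \<bar>(d * Z d) * L d\<bar>"
      using pos
    proof eventually_elim
      case (elim d)
      have "\<bar>euler_partial (1 + d) P * (Z d * L d) - (F d)\<^sup>2\<bar> \<le> 2 / real P * \<bar>Z d * L d\<bar>"
        unfolding Z_def L_def F_def using elim P by (intro euler_partial_approx) auto
      then have "d * \<bar>euler_partial (1 + d) P * (Z d * L d) - (F d)\<^sup>2\<bar> \<le> d * (2 / real P * \<bar>Z d * L d\<bar>)"
        using elim by (intro mult_left_mono) auto
      moreover have "d * \<bar>euler_partial (1 + d) P * (Z d * L d) - (F d)\<^sup>2\<bar>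
         = \<bar>euler_partial (1 + d) P * ((d * Z d) * L d) - (sqrt d * F d)\<^sup>2\<bar>"
      proof -
        have "euler_partial (1 + d) P * ((d * Z d) * L d) - (sqrt d * F d)\<^sup>2
            = d * (euler_partial (1 + d) P * (Z d * L d) - (F d)\<^sup>2)"
          using elim by (simp add: power_mult_distrib algebra_simps)
        then show ?thesis using elim by (simp add: abs_mult)
      qed
      ultimately show ?case using elim by (simp add: abs_mult mult_ac)
    qed
    ultimately have "\<bar>euler_partial 1 P * (1 * (pi / 4)) - (C * (sqrt pi / 2))\<^sup>2\<bar> \<le> 2 / real P * \<bar>1 * (pi / 4)\<bar>"
      by (intro tendsto_le[of "at_right (0::real)"]) auto
    moreover have "euler_partial 1 P * (1 * (pi / 4)) - (C * (sqrt pi / 2))\<^sup>2 = (euler_partial 1 P - C\<^sup>2) * (pi / 4)"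
      by (simp add: power_mult_distrib power_divide algebra_simps)
    ultimately have "\<bar>euler_partial 1 P - C\<^sup>2\<bar> * (pi / 4) \<le> 2 / real P * (pi / 4)"
      by (simp add: abs_mult)
    then show ?thesis by (rule mult_right_le_imp_le) simp
  qed
  have "(\<lambda>P. euler_partial 1 P - C\<^sup>2) \<longlonglongrightarrow> 0"
  proof (rule Lim_null_comparison)
    show "\<forall>\<^sub>F P in sequentially. norm (euler_partial 1 P - C\<^sup>2) \<le> 2 / real P"
      using eventually_ge_at_top[of 2] by eventually_elim (use bound in auto)
    show "(\<lambda>P. 2 / real P) \<longlonglongrightarrow> 0" by real_asymp
  qed
  then have "euler_partial 1 \<longlonglongrightarrow> C\<^sup>2" by (simp add: LIM_zero_iff)
  with euler_partial_1_tendsto have "C\<^sup>2 = 4 * kappa'\<^sup>2 / pi\<^sup>2" by (rule LIMSEQ_unique[symmetric])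
  then have "C\<^sup>2 = (2 * kappa' / pi)\<^sup>2" by (simp add: power_divide power_mult_distrib)
  then show ?thesis using C0 kappa'_pos by (simp add: power2_eq_iff_nonneg)
qed

lemma LG_sqrt_ln: "\<exists>K. \<forall>x\<ge>1. \<bar>LG x - 2 * kappa' / pi * sqrt (ln x)\<bar> \<le> K"
  using LG_asymptotic LG_constant by blast

section \<open>Lattice points in circle segments\<close>

lemma antimono_sum_integral:
  fixes k :: "real \<Rightarrow> real"
  assumes z: "z \<ge> 0" and cont: "continuous_on {0..z} k"
    and dec: "\<And>x y. 0 \<le> x \<Longrightarrow> x \<le> y \<Longrightarrow> y \<le> z \<Longrightarrow> k y \<le> k x"
    and nonneg: "\<And>x. 0 \<le> x \<Longrightarrow> x \<le> z \<Longrightarrow> 0 \<le> k x"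
  shows "\<bar>(\<Sum>Y=1..nat \<lfloor>z\<rfloor>. k (real Y)) - integral {0..z} k\<bar> \<le> k 0"
proof -
  have int: "k integrable_on {a..b}" if "0 \<le> a" "b \<le> z" for a b
    by (intro integrable_continuous_interval continuous_on_subset[OF cont]) (use that in auto)
  have bnd: "k b * (b - a) \<le> integral {a..b} k" "integral {a..b} k \<le> k a * (b - a)"
    if "0 \<le> a" "a \<le> b" "b \<le> z" for a b
  proof -
    have "integral {a..b} (\<lambda>_. k b) \<le> integral {a..b} k"
      using that by (intro integral_le int) (auto intro: dec)
    then show "k b * (b - a) \<le> integral {a..b} k" using that by (simp add: mult.commute)
    have "integral {a..b} k \<le> integral {a..b} (\<lambda>_. k a)"
      using that by (intro integral_le int) (auto intro: dec)
    then show "integral {a..b} k \<le> k a * (b - a)" using that by (simp add: mult.commute)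
  qed
  have main: "(\<Sum>Y=1..n. k (real Y)) \<le> integral {0..real n} k \<and>
      integral {0..real n} k \<le> (\<Sum>Y=1..n. k (real Y)) + k 0 - k (real n)" if "real n \<le> z" for n
    using that
  proof (induction n)
    case (Suc n)
    have "integral {0..real n} k + integral {real n..real (Suc n)} k = integral {0..real (Suc n)} k"
      using Suc.prems by (intro Henstock_Kurzweil_Integration.integral_combine int) auto
    moreover have "k (real (Suc n)) \<le> integral {real n..real (Suc n)} k" "integral {real n..real (Suc n)} k \<le> k (real n)"
      using bnd[of "real n" "real (Suc n)"] Suc.prems by auto
    ultimately show ?case using Suc by auto
  qed auto
  define n where "n = nat \<lfloor>z\<rfloor>"
  have n: "real n \<le> z" "z \<le> real n + 1" using z unfolding n_def by linarith+
  have "integral {0..real n} k + integral {real n..z} k = integral {0..z} k"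
    using n by (intro Henstock_Kurzweil_Integration.integral_combine int) auto
  moreover have "0 \<le> integral {real n..z} k"
    by (intro integral_nonneg int) (use n in \<open>auto intro: nonneg\<close>)
  moreover have "integral {real n..z} k \<le> k (real n) * (z - real n)" using n by (intro bnd) auto
  moreover have "k (real n) * (z - real n) \<le> k (real n) * 1"
    using n nonneg[of "real n"] by (intro mult_left_mono) auto
  ultimately show ?thesis using main[of n] n(1) by (simp add: n_def[symmetric])
qed

lemma card_nat_le_real: "r \<ge> 0 \<Longrightarrow> card {j::nat. real j \<le> r} = nat \<lfloor>r\<rfloor> + 1"
proof -
  assume "r \<ge> 0"
  then have "{j::nat. real j \<le> r} = {..nat \<lfloor>r\<rfloor>}" by (auto simp: le_nat_floor) linarith
  then show ?thesis by simp
qed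

text \<open>For \<open>e = 2\<close> the pair \<open>(X, Y)\<close> stands for the Gaussian integer \<open>(X + \<i> * Y) / (1 + \<i>)\<close>.\<close>

definition par :: "nat \<Rightarrow> nat \<Rightarrow> nat \<Rightarrow> bool" where
  "par e X Y \<longleftrightarrow> (e = 2 \<longrightarrow> even (X + Y))"

lemma card_par:
  assumes e: "e \<in> {1,2}" and r: "r \<ge> 0"
  shows "\<bar>real (card {X. par e X Y \<and> real X \<le> r}) - r / real e\<bar> \<le> 1"
proof (cases "e = 1")
  case True
  then have "{X. par e X Y \<and> real X \<le> r} = {X. real X \<le> r}" by (auto simp: par_def)
  then have "card {X. par e X Y \<and> real X \<le> r} = nat \<lfloor>r\<rfloor> + 1" using card_nat_le_real[OF r] by simp
  moreover have "real (nat \<lfloor>r\<rfloor>) = real_of_int \<lfloor>r\<rfloor>" using r by simp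
  ultimately show ?thesis using True by simp linarith
next
  case False
  then have e2: "e = 2" using e by auto
  define t where "t = Y mod 2"
  have t: "t \<le> 1" by (simp add: t_def)
  have set: "{X. par e X Y \<and> real X \<le> r} = (\<lambda>j. 2 * j + t) ` {j. real j \<le> (r - real t) / 2}"
  proof (intro equalityI subsetI)
    fix X assume X: "X \<in> {X. par e X Y \<and> real X \<le> r}"
    then have "even (X + Y)" using e2 by (auto simp: par_def)
    then have "X mod 2 = t" unfolding t_def by presburger
    then have "X = 2 * (X div 2) + t" by presburger
    moreover have "real (X div 2) \<le> (r - real t) / 2"
    proof -
      have "real X = 2 * real (X div 2) + real t" using \<open>X = 2 * (X div 2) + t\<close>
        by (metis of_nat_add of_nat_mult of_nat_numeral)
      then show ?thesis using X by simp
    qed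
    ultimately show "X \<in> (\<lambda>j. 2 * j + t) ` {j. real j \<le> (r - real t) / 2}" by blast
  next
    fix X assume "X \<in> (\<lambda>j. 2 * j + t) ` {j. real j \<le> (r - real t) / 2}"
    then obtain j where j: "X = 2 * j + t" "real j \<le> (r - real t) / 2" by auto
    have "even (X + Y)" unfolding j(1) t_def by presburger
    then show "X \<in> {X. par e X Y \<and> real X \<le> r}" using j by (simp add: par_def)
  qed
  have card: "card {X. par e X Y \<and> real X \<le> r} = card {j::nat. real j \<le> (r - real t) / 2}"
    unfolding set by (intro card_image) (auto simp: inj_on_def)
  show ?thesis
  proof (cases "r \<ge> real t")
    case True
    then have "card {X. par e X Y \<and> real X \<le> r} = nat \<lfloor>(r - real t) / 2\<rfloor> + 1"
      unfolding card by (intro card_nat_le_real) auto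
    moreover have "real (nat \<lfloor>(r - real t) / 2\<rfloor>) = real_of_int \<lfloor>(r - real t) / 2\<rfloor>" using True by simp
    moreover have "real t \<le> 1" using t by simp
    moreover have "(r - real t) / 2 - 1 < real_of_int \<lfloor>(r - real t) / 2\<rfloor>"
      "real_of_int \<lfloor>(r - real t) / 2\<rfloor> \<le> (r - real t) / 2" by linarith+
    ultimately show ?thesis unfolding e2 by (simp add: abs_le_iff field_simps)
  next
    case False
    have "{j::nat. real j \<le> (r - real t) / 2} = {}"
    proof -
      have "\<not> real j \<le> (r - real t) / 2" for j :: nat
      proof -
        have "(r - real t) / 2 < 0" using False by simp
        then show ?thesis by linarith
      qed
      then show ?thesis by simp
    qed
    moreover have "r \<le> 1" using False t by simp
    ultimately show ?thesis unfolding card using r e2 by simp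
  qed
qed

lemma I_fun_integrand_continuous: "continuous_on S (\<lambda>t::real. sqrt (1 - c * t\<^sup>2))"
  by (intro continuous_intros)

lemma I_fun_bounds:
  assumes "0 \<le> c" "c \<le> 1"
  shows "2 / pi \<le> I_fun c" "I_fun c \<le> 4 / pi"
proof -
  have int: "(\<lambda>t. sqrt (1 - c * t\<^sup>2)) integrable_on {0..1}"
    by (intro integrable_continuous_interval I_fun_integrand_continuous)
  have ct: "c * t\<^sup>2 \<le> t" "0 \<le> c * t\<^sup>2" if "t \<in> {0..1}" for t
  proof -
    have "c * t\<^sup>2 \<le> 1 * t\<^sup>2" using assms by (intro mult_right_mono) auto
    also have "\<dots> \<le> t" using that by (simp add: power2_eq_square mult_left_le)
    finally show "c * t\<^sup>2 \<le> t" .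
    show "0 \<le> c * t\<^sup>2" using assms by simp
  qed
  have "integral {0..1} (\<lambda>t. sqrt (1 - c * t\<^sup>2)) \<le> integral {0..1} (\<lambda>t::real. 1)"
    by (intro integral_le int) (use ct in auto)
  then have "integral {0..1} (\<lambda>t. sqrt (1 - c * t\<^sup>2)) \<le> 1" by simp
  then show "I_fun c \<le> 4 / pi" unfolding I_fun_def by (simp add: mult_left_le divide_right_mono)
  have lin: "((\<lambda>t::real. 1 - t) has_integral ((1 - 1\<^sup>2 / 2) - (0 - 0\<^sup>2 / 2))) {0..1}"
    by (rule fundamental_theorem_of_calculus)
       (auto intro!: derivative_eq_intros simp: has_real_derivative_iff_has_vector_derivative[symmetric])
  have "1 - t \<le> sqrt (1 - c * t\<^sup>2)" if "t \<in> {0..1}" for t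
  proof (rule real_le_rsqrt)
    have "(1 - t)\<^sup>2 \<le> 1 - t" using that by (simp add: power2_eq_square mult_left_le)
    then show "(1 - t)\<^sup>2 \<le> 1 - c * t\<^sup>2" using ct[OF that] by linarith
  qed
  then have "integral {0..1} (\<lambda>t::real. 1 - t) \<le> integral {0..1} (\<lambda>t. sqrt (1 - c * t\<^sup>2))"
    using lin by (intro integral_le int) auto
  then have "1 / 2 \<le> integral {0..1} (\<lambda>t. sqrt (1 - c * t\<^sup>2))" using integral_unique[OF lin] by simp
  then have "4 / pi * (1 / 2) \<le> I_fun c" unfolding I_fun_def by (intro mult_left_mono) auto
  then show "2 / pi \<le> I_fun c" by simp
qed

lemma circle_segment_integral:
  assumes z: "z > 0" and R: "z \<le> R"
  shows "integral {0..z} (\<lambda>y. sqrt (R\<^sup>2 - y\<^sup>2)) = z * R * (pi / 4 * I_fun (z\<^sup>2 / R\<^sup>2))"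
proof -
  define c where "c = z\<^sup>2 / R\<^sup>2"
  have "((\<lambda>y. sqrt (R\<^sup>2 - y\<^sup>2)) has_integral integral {0..z} (\<lambda>y. sqrt (R\<^sup>2 - y\<^sup>2))) {0..z}"
    by (intro integrable_integral integrable_continuous_interval continuous_intros)
  then have "((\<lambda>t. sqrt (R\<^sup>2 - (z * t)\<^sup>2)) has_integral (1 / \<bar>z\<bar>) *\<^sub>R integral {0..z} (\<lambda>y. sqrt (R\<^sup>2 - y\<^sup>2)))
      ((\<lambda>x. x / z) ` {0..z})"
    by (rule has_integral_stretch_real) (use z in auto)
  moreover have "(\<lambda>x. x / z) ` {0..z} = {0..1}"
    using z image_divide_atLeastAtMost[of z 0 z] by simp
  moreover have "sqrt (R\<^sup>2 - (z * t)\<^sup>2) = R * sqrt (1 - c * t\<^sup>2)" for t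
  proof -
    have "R\<^sup>2 - (z * t)\<^sup>2 = R\<^sup>2 * (1 - c * t\<^sup>2)"
      using z R by (simp add: c_def power_mult_distrib algebra_simps)
    then show ?thesis using z R by (simp add: real_sqrt_mult)
  qed
  ultimately have "((\<lambda>t. R * sqrt (1 - c * t\<^sup>2)) has_integral (1 / z) * integral {0..z} (\<lambda>y. sqrt (R\<^sup>2 - y\<^sup>2))) {0..1}"
    using z by simp
  moreover have "((\<lambda>t. R * sqrt (1 - c * t\<^sup>2)) has_integral R * integral {0..1} (\<lambda>t. sqrt (1 - c * t\<^sup>2))) {0..1}"
    by (intro has_integral_mult_right integrable_integral integrable_continuous_interval I_fun_integrand_continuous)
  ultimately have "(1 / z) * integral {0..z} (\<lambda>y. sqrt (R\<^sup>2 - y\<^sup>2)) = R * integral {0..1} (\<lambda>t. sqrt (1 - c * t\<^sup>2))"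
    by (rule has_integral_unique)
  then have "integral {0..z} (\<lambda>y. sqrt (R\<^sup>2 - y\<^sup>2)) = z * R * integral {0..1} (\<lambda>t. sqrt (1 - c * t\<^sup>2))"
    using z by (simp add: field_simps)
  moreover have "integral {0..1} (\<lambda>t. sqrt (1 - c * t\<^sup>2)) = pi / 4 * I_fun c"
    by (simp add: I_fun_def)
  ultimately show ?thesis by (simp add: c_def)
qed

definition Qset :: "nat \<Rightarrow> nat \<Rightarrow> real \<Rightarrow> real \<Rightarrow> (nat \<times> nat) set" where
  "Qset e m N M = {(X, Y). 1 \<le> Y \<and> par e X Y \<and> real m * ((real X)\<^sup>2 + (real Y)\<^sup>2) \<le> real e * N \<and>
      4 * real m * (real Y)\<^sup>2 \<le> real e * M\<^sup>2}"

lemma Qset_swap_eq: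
  assumes e: "e \<in> {1,2}" and m: "m \<ge> 1" and M: "0 < M" "M \<le> 2 * sqrt N"
  defines "R \<equiv> sqrt (real e * N / real m)" and "z \<equiv> sqrt (real e * M\<^sup>2 / (4 * real m))"
  shows "Qset e m N M = prod.swap ` (SIGMA Y:{1..nat \<lfloor>z\<rfloor>}. {X. par e X Y \<and> real X \<le> sqrt (R\<^sup>2 - (real Y)\<^sup>2)})"
    and "0 < z" "z \<le> R"
proof -
  have e0: "real e > 0" using e by auto
  have m0: "real m > 0" using m by simp
  have "sqrt N > 0" using M by linarith
  then have N: "N > 0" by simp
  have MN: "M\<^sup>2 \<le> 4 * N" using power_mono[OF M(2), of 2] M N by (simp add: power_mult_distrib)
  show z0: "0 < z" unfolding z_def using e0 m0 M by simp
  have R2: "R\<^sup>2 = real e * N / real m" unfolding R_def using e0 m0 N by simp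
  have z2: "z\<^sup>2 = real e * M\<^sup>2 / (4 * real m)" unfolding z_def using e0 m0 by simp
  have "real e * M\<^sup>2 / (4 * real m) \<le> real e * N / real m"
  proof -
    have "real e * M\<^sup>2 / (4 * real m) = real e / real m * (M\<^sup>2 / 4)" by simp
    also have "\<dots> \<le> real e / real m * N" using MN e0 m0 by (intro mult_left_mono) auto
    finally show ?thesis by simp
  qed
  then show zR: "z \<le> R" unfolding z_def R_def by simp
  have Yz: "4 * real m * (real Y)\<^sup>2 \<le> real e * M\<^sup>2 \<longleftrightarrow> Y \<le> nat \<lfloor>z\<rfloor>" for Y
  proof -
    have "4 * real m * (real Y)\<^sup>2 \<le> real e * M\<^sup>2 \<longleftrightarrow> (real Y)\<^sup>2 \<le> z\<^sup>2"
      unfolding z2 using m0 by (simp add: field_simps)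
    also have "\<dots> \<longleftrightarrow> real Y \<le> z" using z0 by (simp add: abs_le_square_iff[symmetric])
    also have "\<dots> \<longleftrightarrow> Y \<le> nat \<lfloor>z\<rfloor>" using z0 by (auto simp: le_nat_floor) linarith
    finally show ?thesis .
  qed
  have XY: "real m * ((real X)\<^sup>2 + (real Y)\<^sup>2) \<le> real e * N \<longleftrightarrow> real X \<le> sqrt (R\<^sup>2 - (real Y)\<^sup>2)" for X Y
  proof -
    have "real m * ((real X)\<^sup>2 + (real Y)\<^sup>2) \<le> real e * N \<longleftrightarrow> (real X)\<^sup>2 \<le> R\<^sup>2 - (real Y)\<^sup>2"
      unfolding R2 using m0 by (simp add: field_simps)
    also have "\<dots> \<longleftrightarrow> real X \<le> sqrt (R\<^sup>2 - (real Y)\<^sup>2)"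
      by (metis of_nat_0_le_iff real_le_rsqrt real_sqrt_le_iff real_sqrt_unique)
    finally show ?thesis .
  qed
  show "Qset e m N M = prod.swap ` (SIGMA Y:{1..nat \<lfloor>z\<rfloor>}. {X. par e X Y \<and> real X \<le> sqrt (R\<^sup>2 - (real Y)\<^sup>2)})"
    unfolding Qset_def XY Yz by (auto simp: image_iff)
qed

lemma finite_Qset:
  assumes "e \<in> {1,2}" "m \<ge> 1" "0 < M" "M \<le> 2 * sqrt N"
  shows "finite (Qset e m N M)"
  unfolding Qset_swap_eq(1)[OF assms] by (intro finite_imageI finite_SigmaI) auto

lemma card_Qset:
  assumes e: "e \<in> {1,2}" and m: "m \<ge> 1" and M: "0 < M" "M \<le> 2 * sqrt N"
  shows "\<bar>real (card (Qset e m N M)) - M * sqrt N / (2 * real m) * (pi / 4 * I_fun (M\<^sup>2 / (4 * N)))\<bar>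
     \<le> 2 * sqrt (real e * N / real m)"
proof -
  define R where "R = sqrt (real e * N / real m)"
  define z where "z = sqrt (real e * M\<^sup>2 / (4 * real m))"
  define k where "k y = sqrt (R\<^sup>2 - y\<^sup>2)" for y
  note Q = Qset_swap_eq[OF assms, folded R_def z_def]
  have e0: "real e > 0" using e by auto
  have m0: "real m > 0" using m by simp
  have N: "N > 0"
  proof -
    have "sqrt N > 0" using M by linarith
    then show ?thesis by simp
  qed
  let ?A = "\<lambda>Y. {X. par e X Y \<and> real X \<le> k (real Y)}"
  have "card (Qset e m N M) = card (SIGMA Y:{1..nat \<lfloor>z\<rfloor>}. ?A Y)"
    unfolding Q(1) k_def by (rule card_image) auto
  also have "\<dots> = (\<Sum>Y=1..nat \<lfloor>z\<rfloor>. card (?A Y))" by (rule card_SigmaI) auto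
  finally have card: "real (card (Qset e m N M)) = (\<Sum>Y=1..nat \<lfloor>z\<rfloor>. real (card (?A Y)))" by simp
  have sq_le: "y\<^sup>2 \<le> R\<^sup>2" if "0 \<le> y" "y \<le> z" for y using that Q by (intro power_mono) auto
  have "\<bar>real (card (Qset e m N M)) - (\<Sum>Y=1..nat \<lfloor>z\<rfloor>. k (real Y) / real e)\<bar>
      \<le> (\<Sum>Y=1..nat \<lfloor>z\<rfloor>. \<bar>real (card (?A Y)) - k (real Y) / real e\<bar>)"
    unfolding card sum_subtractf[symmetric] by (rule sum_abs)
  also have "\<dots> \<le> (\<Sum>Y=1..nat \<lfloor>z\<rfloor>. 1)"
  proof (intro sum_mono card_par e)
    fix Y assume "Y \<in> {1..nat \<lfloor>z\<rfloor>}"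
    then have "real Y \<le> z" using Q(2) by (auto simp: le_nat_iff) linarith
    then show "0 \<le> k (real Y)" unfolding k_def using sq_le[of "real Y"] by simp
  qed
  also have "\<dots> \<le> R" using Q(2,3) by simp linarith
  finally have 1: "\<bar>real (card (Qset e m N M)) - (\<Sum>Y=1..nat \<lfloor>z\<rfloor>. k (real Y)) / real e\<bar> \<le> R"
    by (simp add: sum_divide_distrib)
  have "\<bar>(\<Sum>Y=1..nat \<lfloor>z\<rfloor>. k (real Y)) - integral {0..z} k\<bar> \<le> k 0"
  proof (rule antimono_sum_integral)
    show "z \<ge> 0" using Q by simp
    show "continuous_on {0..z} k" unfolding k_def by (intro continuous_intros)
    show "k y \<le> k x" if "0 \<le> x" "x \<le> y" "y \<le> z" for x y
      unfolding k_def using that by (simp add: power_mono)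
    show "0 \<le> k x" if "0 \<le> x" "x \<le> z" for x unfolding k_def using sq_le[OF that] by simp
  qed
  moreover have "k 0 = R" using Q unfolding k_def by simp
  ultimately have "\<bar>(\<Sum>Y=1..nat \<lfloor>z\<rfloor>. k (real Y)) - integral {0..z} k\<bar> / real e \<le> R / real e"
    using e0 by (simp add: divide_right_mono)
  also have "\<dots> \<le> R" using e Q by auto
  finally have 2: "\<bar>(\<Sum>Y=1..nat \<lfloor>z\<rfloor>. k (real Y)) / real e - integral {0..z} k / real e\<bar> \<le> R"
    using e0 by (simp add: diff_divide_distrib[symmetric])
  have "z\<^sup>2 / R\<^sup>2 = M\<^sup>2 / (4 * N)"
    unfolding z_def R_def using e0 m0 N by (simp add: field_simps)
  then have "integral {0..z} k = z * R * (pi / 4 * I_fun (M\<^sup>2 / (4 * N)))"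
    unfolding k_def using circle_segment_integral[OF Q(2,3)] by simp
  moreover have "z * R = real e * (M * sqrt N / (2 * real m))"
  proof -
    have "z * R = sqrt ((real e * M\<^sup>2 / (4 * real m)) * (real e * N / real m))"
      unfolding z_def R_def by (rule real_sqrt_mult[symmetric])
    also have "(real e * M\<^sup>2 / (4 * real m)) * (real e * N / real m) = (real e * M / (2 * real m))\<^sup>2 * N"
      by (simp add: power2_eq_square mult_ac)
    also have "sqrt \<dots> = real e * M / (2 * real m) * sqrt N"
      using e0 m0 M by (simp add: real_sqrt_mult)
    finally show ?thesis by simp
  qed
  ultimately have "integral {0..z} k / real e = M * sqrt N / (2 * real m) * (pi / 4 * I_fun (M\<^sup>2 / (4 * N)))"
    using e0 by simp
  then show ?thesis using 1 2 unfolding R_def by linarith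
qed

lemma sum_inverse_sqrt_le: "(\<Sum>m=1..n. 1 / sqrt (real m)) \<le> 2 * sqrt (real n)"
proof (induction n)
  case (Suc n)
  define a where "a = sqrt (real n)"
  define b where "b = sqrt (real (Suc n))"
  have ab: "0 \<le> a" "a \<le> b" "b > 0" "b\<^sup>2 - a\<^sup>2 = 1" by (auto simp: a_def b_def)
  have "1 = (b - a) * (b + a)" using ab(4) by (simp add: power2_eq_square algebra_simps)
  also have "\<dots> \<le> (b - a) * (2 * b)" using ab by (intro mult_left_mono) auto
  finally have "1 / b \<le> 2 * b - 2 * a" using ab(3) by (simp add: field_simps)
  then show ?case using Suc unfolding a_def b_def by simp
qed auto

lemma sum_G4_inverse_sqrt_le:
  assumes "x \<ge> 0"
  shows "(\<Sum>m | m \<in> G4 \<and> real m \<le> x. 1 / sqrt (real m)) \<le> 2 * sqrt x"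
proof -
  have "(\<Sum>m | m \<in> G4 \<and> real m \<le> x. 1 / sqrt (real m)) \<le> (\<Sum>m=1..nat \<lfloor>x\<rfloor>. 1 / sqrt (real m))"
    by (intro sum_mono2) (auto simp: le_nat_floor Suc_le_eq G4_pos)
  also have "\<dots> \<le> 2 * sqrt (real (nat \<lfloor>x\<rfloor>))" by (rule sum_inverse_sqrt_le)
  also have "\<dots> \<le> 2 * sqrt x" using assms by simp
  finally show ?thesis .
qed

lemma sum_card_Qset:
  assumes e: "e \<in> {1,2}" and M: "0 < M" "M \<le> 2 * sqrt N"
  shows "\<bar>(\<Sum>m | m \<in> G4 \<and> real m \<le> real e * M\<^sup>2 / 4. real (card (Qset e m N M)))
      - M * sqrt N * (pi / 8 * I_fun (M\<^sup>2 / (4 * N))) * LG (real e * M\<^sup>2 / 4)\<bar> \<le> 4 * M * sqrt N"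
proof -
  let ?G = "{m. m \<in> G4 \<and> real m \<le> real e * M\<^sup>2 / 4}"
  define A where "A = M * sqrt N * (pi / 8 * I_fun (M\<^sup>2 / (4 * N)))"
  have N: "N > 0"
  proof -
    have "sqrt N > 0" using M by linarith
    then show ?thesis by simp
  qed
  have "\<bar>(\<Sum>m\<in>?G. real (card (Qset e m N M))) - A * LG (real e * M\<^sup>2 / 4)\<bar>
     = \<bar>\<Sum>m\<in>?G. real (card (Qset e m N M)) - A / real m\<bar>"
    by (simp add: LG_def sum_distrib_left sum_subtractf)
  also have "\<dots> \<le> (\<Sum>m\<in>?G. 2 * sqrt (real e * N) * (1 / sqrt (real m)))"
  proof (intro order.trans[OF sum_abs] sum_mono)
    fix m assume "m \<in> ?G"
    then have m: "m \<ge> 1" using G4_pos[of m] by auto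
    have "A / real m = M * sqrt N / (2 * real m) * (pi / 4 * I_fun (M\<^sup>2 / (4 * N)))" by (simp add: A_def)
    then show "\<bar>real (card (Qset e m N M)) - A / real m\<bar> \<le> 2 * sqrt (real e * N) * (1 / sqrt (real m))"
      using card_Qset[OF e m M] by (simp add: real_sqrt_divide)
  qed
  also have "\<dots> = 2 * sqrt (real e * N) * (\<Sum>m\<in>?G. 1 / sqrt (real m))" by (simp add: sum_distrib_left)
  also have "\<dots> \<le> 2 * sqrt (real e * N) * (2 * sqrt (real e * M\<^sup>2 / 4))"
    using e N by (intro mult_left_mono sum_G4_inverse_sqrt_le) auto
  also have "\<dots> = 2 * real e * M * sqrt N"
    using e M by (auto simp: real_sqrt_mult real_sqrt_divide)
  also have "\<dots> \<le> 4 * M * sqrt N" using e M N by auto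
  finally show ?thesis by (simp add: A_def)
qed

lemma LG_scaled:
  "\<exists>K\<ge>0. \<forall>e\<in>{1,2}. \<forall>M\<ge>1. \<bar>LG (real e * M\<^sup>2 / 4) - 2 * kappa' / pi * sqrt (2 * ln M)\<bar> \<le> K"
proof -
  obtain K where K: "\<And>x. x \<ge> 1 \<Longrightarrow> \<bar>LG x - 2 * kappa' / pi * sqrt (ln x)\<bar> \<le> K"
    using LG_sqrt_ln by blast
  define C where "C = 2 * kappa' / pi"
  have C0: "C > 0" using kappa'_pos by (simp add: C_def)
  have K0: "K \<ge> 0" using K[of 1] by simp
  have ln4: "ln (4::real) \<le> 4" using ln_le_minus_one[of 4] by simp
  have "\<bar>LG (real e * M\<^sup>2 / 4) - C * sqrt (2 * ln M)\<bar> \<le> K + 2 * C" if e: "e \<in> {1,2}" and M: "M \<ge> 1" for e M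
  proof (cases "real e * M\<^sup>2 / 4 \<ge> 1")
    case True
    define x where "x = real e * M\<^sup>2 / 4"
    have lnM: "ln M \<ge> 0" using M by simp
    have e4: "ln (real e / 4) \<le> 0" "- 4 \<le> ln (real e / 4)"
    proof -
      show "ln (real e / 4) \<le> 0" using e by auto
      have "ln (1 / 4) \<le> ln (real e / 4)" using e by (intro ln_mono) auto
      moreover have "ln (1 / 4 :: real) = - ln 4" by (simp add: ln_div)
      ultimately show "- 4 \<le> ln (real e / 4)" using ln4 by linarith
    qed
    have "ln x = ln ((real e / 4) * M\<^sup>2)" by (simp add: x_def)
    also have "\<dots> = ln (real e / 4) + ln (M\<^sup>2)" using e M by (intro ln_mult_pos) auto
    also have "ln (M\<^sup>2) = 2 * ln M" using M by (simp add: ln_realpow)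
    finally have lx: "ln x = ln (real e / 4) + 2 * ln M" .
    have lx0: "ln x \<ge> 0" using True by (simp add: x_def)
    have up: "sqrt (ln x) \<le> sqrt (2 * ln M)" using lx e4 by simp
    have "2 * ln M \<le> ln x + 4" using lx e4 by linarith
    then have "sqrt (2 * ln M) \<le> sqrt (ln x + 4)" by simp
    also have "\<dots> \<le> sqrt (ln x) + sqrt 4" using lx0 by (intro sqrt_add_le_add_sqrt) auto
    finally have lo: "sqrt (2 * ln M) \<le> sqrt (ln x) + 2" by simp
    have "C * sqrt (ln x) \<le> C * sqrt (2 * ln M)" "C * sqrt (2 * ln M) \<le> C * (sqrt (ln x) + 2)"
      using up lo C0 by (auto intro!: mult_left_mono)
    moreover have "\<bar>LG x - C * sqrt (ln x)\<bar> \<le> K" unfolding C_def using True by (intro K) (simp add: x_def)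
    ultimately show ?thesis unfolding x_def by (simp add: algebra_simps)
  next
    case False
    have "{m. m \<in> G4 \<and> real m \<le> real e * M\<^sup>2 / 4} = {}"
    proof -
      have "\<not> real m \<le> real e * M\<^sup>2 / 4" if "m \<in> G4" for m
        using G4_pos[OF that] False by linarith
      then show ?thesis by auto
    qed
    then have LG0: "LG (real e * M\<^sup>2 / 4) = 0" unfolding LG_def by (simp only: sum.empty)
    have "1 * M\<^sup>2 \<le> real e * M\<^sup>2" using e by (intro mult_right_mono) auto
    then have "M\<^sup>2 < 4" using False by linarith
    then have "ln (M\<^sup>2) \<le> ln 4" using M by (intro ln_mono) auto
    moreover have "ln (M\<^sup>2) = 2 * ln M" using M by (simp add: ln_realpow)
    ultimately have "sqrt (2 * ln M) \<le> sqrt 4" using ln4 by (intro real_sqrt_le_mono) linarith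
    then have "C * sqrt (2 * ln M) \<le> C * 2" using C0 by (intro mult_left_mono) auto
    moreover have "0 \<le> C * sqrt (2 * ln M)" using C0 M by simp
    ultimately show ?thesis using LG0 K0 by (simp add: abs_le_iff)
  qed
  then show ?thesis using K0 C0 unfolding C_def by (intro exI[of _ "K + 2 * C"]) (auto simp: C_def)
qed

lemma Qset_total:
  "\<exists>K. \<forall>N M. 1 \<le> M \<longrightarrow> M \<le> 2 * sqrt N \<longrightarrow>
    \<bar>(\<Sum>e\<in>{1,2}. \<Sum>m | m \<in> G4 \<and> real m \<le> real e * M\<^sup>2 / 4. real (card (Qset e m N M)))
      - kappa' / 2 * I_fun (M\<^sup>2 / (4 * N)) * M * sqrt N * sqrt (2 * ln M)\<bar> \<le> K * (M * sqrt N)"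
proof -
  obtain K where K: "K \<ge> 0" "\<And>e M. e \<in> {1,2} \<Longrightarrow> M \<ge> 1 \<Longrightarrow>
      \<bar>LG (real e * M\<^sup>2 / 4) - 2 * kappa' / pi * sqrt (2 * ln M)\<bar> \<le> K"
    using LG_scaled by blast
  have "\<bar>(\<Sum>e\<in>{1,2}. \<Sum>m | m \<in> G4 \<and> real m \<le> real e * M\<^sup>2 / 4. real (card (Qset e m N M)))
      - kappa' / 2 * I_fun (M\<^sup>2 / (4 * N)) * M * sqrt N * sqrt (2 * ln M)\<bar> \<le> (8 + K) * (M * sqrt N)"
    if M: "1 \<le> M" "M \<le> 2 * sqrt N" for N M
  proof -
    have N: "N > 0"
    proof -
      have "sqrt N > 0" using M by linarith
      then show ?thesis by simp
    qed
    define c where "c = M\<^sup>2 / (4 * N)"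
    have "M\<^sup>2 \<le> 4 * N" using power_mono[OF M(2), of 2] M N by (simp add: power_mult_distrib)
    then have c: "0 \<le> c" "c \<le> 1" using N by (auto simp: c_def field_simps)
    note I = I_fun_bounds[OF c]
    have I0: "0 \<le> I_fun c" using I(1) pi_gt_zero by (meson divide_nonneg_pos order.trans zero_le_numeral)
    define A where "A = M * sqrt N * (pi / 8 * I_fun c)"
    have A0: "0 \<le> A" using M N I0 by (simp add: A_def)
    have A1: "A \<le> M * sqrt N / 2"
    proof -
      have "pi / 8 * I_fun c \<le> pi / 8 * (4 / pi)" using I(2) by (intro mult_left_mono) auto
      also have "\<dots> = 1 / 2" by simp
      finally have "M * sqrt N * (pi / 8 * I_fun c) \<le> M * sqrt N * (1 / 2)"
        using M N by (intro mult_left_mono) auto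
      then show ?thesis by (simp add: A_def)
    qed
    define S where "S e = (\<Sum>m | m \<in> G4 \<and> real m \<le> real e * M\<^sup>2 / 4. real (card (Qset e m N M)))" for e :: nat
    define L where "L = 2 * kappa' / pi * sqrt (2 * ln M)"
    have each: "\<bar>S e - A * L\<bar> \<le> (4 + K / 2) * (M * sqrt N)" if e: "e \<in> {1,2}" for e
    proof -
      have "\<bar>S e - A * LG (real e * M\<^sup>2 / 4)\<bar> \<le> 4 * M * sqrt N"
        unfolding S_def A_def c_def using e M by (intro sum_card_Qset) auto
      moreover have "\<bar>A * LG (real e * M\<^sup>2 / 4) - A * L\<bar> \<le> M * sqrt N / 2 * K"
      proof -
        have "\<bar>A * LG (real e * M\<^sup>2 / 4) - A * L\<bar> = A * \<bar>LG (real e * M\<^sup>2 / 4) - L\<bar>"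
          using A0 by (simp add: right_diff_distrib[symmetric] abs_mult)
        also have "\<dots> \<le> M * sqrt N / 2 * K"
          unfolding L_def using A0 A1 K e M by (intro mult_mono) auto
        finally show ?thesis .
      qed
      moreover have "(4 + K / 2) * (M * sqrt N) = 4 * M * sqrt N + M * sqrt N / 2 * K"
        by (simp add: algebra_simps)
      ultimately show ?thesis by linarith
    qed
    have "2 * (A * L) = kappa' / 2 * I_fun c * M * sqrt N * sqrt (2 * ln M)"
      by (simp add: A_def L_def field_simps)
    moreover have "(\<Sum>e\<in>{1,2}. S e) = S 1 + S 2" by simp
    ultimately have "\<bar>(\<Sum>e\<in>{1,2}. S e) - kappa' / 2 * I_fun c * M * sqrt N * sqrt (2 * ln M)\<bar> \<le> (8 + K) * (M * sqrt N)"
      using each[of 1] each[of 2] by (simp add: algebra_simps)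
    then show ?thesis unfolding S_def c_def .
  qed
  then show ?thesis by blast
qed

section \<open>Gaussian integers and invariants of classes\<close>

definition gi :: "int \<Rightarrow> int \<Rightarrow> complex" where
  "gi a b = Complex (real_of_int a) (real_of_int b)"

lemma gi_sel [simp]: "Re (gi a b) = real_of_int a" "Im (gi a b) = real_of_int b"
  by (simp_all add: gi_def)

lemma gauss_intsE:
  assumes "z \<in> gauss_ints"
  obtains a b where "z = gi a b"
  using assms unfolding gauss_ints_def gi_def
  by (metis (mono_tags, lifting) Ints_cases complex.collapse mem_Collect_eq)

lemma gi_in [simp]: "gi a b \<in> gauss_ints" by (simp add: gauss_ints_def)

lemma gauss_ints_closed [simp, intro]:
  "0 \<in> gauss_ints" "1 \<in> gauss_ints" "\<i> \<in> gauss_ints" "of_int k \<in> gauss_ints" "of_nat n \<in> gauss_ints"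
  "x \<in> gauss_ints \<Longrightarrow> y \<in> gauss_ints \<Longrightarrow> x + y \<in> gauss_ints"
  "x \<in> gauss_ints \<Longrightarrow> y \<in> gauss_ints \<Longrightarrow> x - y \<in> gauss_ints"
  "x \<in> gauss_ints \<Longrightarrow> y \<in> gauss_ints \<Longrightarrow> x * y \<in> gauss_ints"
  "x \<in> gauss_ints \<Longrightarrow> - x \<in> gauss_ints"
  "x \<in> gauss_ints \<Longrightarrow> cnj x \<in> gauss_ints"
  by (auto simp: gauss_ints_def)

definition gnorm :: "complex \<Rightarrow> nat" where "gnorm z = nat \<lfloor>(cmod z)\<^sup>2\<rfloor>"

lemma cmod_gi: "(cmod (gi a b))\<^sup>2 = real_of_int (a\<^sup>2 + b\<^sup>2)"
  by (simp add: cmod_power2)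

lemma gnorm_gi: "int (gnorm (gi a b)) = a\<^sup>2 + b\<^sup>2"
  unfolding gnorm_def cmod_gi floor_of_int by simp

lemma real_gnorm: "z \<in> gauss_ints \<Longrightarrow> real (gnorm z) = (cmod z)\<^sup>2"
proof -
  assume "z \<in> gauss_ints"
  then obtain a b where z: "z = gi a b" by (elim gauss_intsE)
  have "real (gnorm z) = real_of_int (int (gnorm z))" by simp
  then show ?thesis unfolding z cmod_gi gnorm_gi .
qed

lemma gnorm_mult:
  assumes "x \<in> gauss_ints" "y \<in> gauss_ints"
  shows "gnorm (x * y) = gnorm x * gnorm y"
proof -
  have "real (gnorm (x * y)) = real (gnorm x * gnorm y)"
    using assms by (simp add: real_gnorm norm_mult power_mult_distrib)
  then show ?thesis by linarith
qed

lemma gnorm_cnj: "gnorm (cnj x) = gnorm x" by (simp add: gnorm_def)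

lemma gnorm_eq_0_iff: "x \<in> gauss_ints \<Longrightarrow> gnorm x = 0 \<longleftrightarrow> x = 0"
proof -
  assume x: "x \<in> gauss_ints"
  have "gnorm x = 0 \<longleftrightarrow> real (gnorm x) = 0" by simp
  also have "\<dots> \<longleftrightarrow> x = 0" unfolding real_gnorm[OF x] by simp
  finally show ?thesis .
qed

lemma gnorm_pos: "x \<in> gauss_ints \<Longrightarrow> x \<noteq> 0 \<Longrightarrow> gnorm x \<ge> 1"
  using gnorm_eq_0_iff[of x] by linarith

lemma mult_cnj_gnorm: "x \<in> gauss_ints \<Longrightarrow> x * cnj x = of_nat (gnorm x)"
  using real_gnorm[of x] by (metis complex_norm_square of_real_of_nat_eq)

lemma cmod_ge_1: "x \<in> gauss_ints \<Longrightarrow> x \<noteq> 0 \<Longrightarrow> cmod x \<ge> 1"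
proof -
  assume x: "x \<in> gauss_ints" "x \<noteq> 0"
  have "1\<^sup>2 \<le> (cmod x)\<^sup>2" using real_gnorm[OF x(1)] gnorm_pos[OF x] by simp
  then show ?thesis by (rule power2_le_imp_le) simp
qed

lemma gauss_units_iff: "z \<in> gauss_units \<longleftrightarrow> z \<in> gauss_ints \<and> gnorm z = 1"
proof
  assume "z \<in> gauss_units"
  then show "z \<in> gauss_ints \<and> gnorm z = 1" by (auto simp: gauss_units_def gnorm_def)
next
  assume z: "z \<in> gauss_ints \<and> gnorm z = 1"
  then obtain a b where ab: "z = gi a b" by (auto elim: gauss_intsE)
  then have n: "a\<^sup>2 + b\<^sup>2 = 1" using gnorm_gi[of a b] z by simp
  have "a\<^sup>2 \<le> 1" "b\<^sup>2 \<le> 1" using n zero_le_power2[of a] zero_le_power2[of b] by linarith+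
  then have "\<bar>a\<bar> \<le> 1" "\<bar>b\<bar> \<le> 1" by (simp_all add: abs_square_le_1)
  then have "a \<in> {-1,0,1}" "b \<in> {-1,0,1}" by auto
  then show "z \<in> gauss_units" using n unfolding ab gauss_units_def gi_def
    by (auto simp: complex_eq_iff)
qed

lemma gauss_units_props:
  assumes "u \<in> gauss_units"
  shows "u \<in> gauss_ints" "cmod u = 1" "u * cnj u = 1" "cnj u * u = 1" "u \<noteq> 0" "cnj u \<in> gauss_units"
  using assms by (auto simp: gauss_units_def)

lemma gauss_units_mult: "u \<in> gauss_units \<Longrightarrow> v \<in> gauss_units \<Longrightarrow> u * v \<in> gauss_units"
  by (auto simp: gauss_units_iff gnorm_mult)

lemma gauss_dvd_refl: "gauss_dvd x x" unfolding gauss_dvd_def by (rule bexI[of _ 1]) auto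

lemma gauss_dvd_trans: "gauss_dvd x y \<Longrightarrow> gauss_dvd y z \<Longrightarrow> gauss_dvd x z"
  unfolding gauss_dvd_def by (metis gauss_ints_closed(8) mult.assoc)

lemma gauss_dvd_cnj: "gauss_dvd x y \<Longrightarrow> gauss_dvd (cnj x) (cnj y)"
  unfolding gauss_dvd_def by (metis complex_cnj_mult gauss_ints_closed(10))

lemma gauss_division:
  assumes "c \<in> gauss_ints" "g \<in> gauss_ints" "g \<noteq> 0"
  obtains q where "q \<in> gauss_ints" "cmod (c - g * q) < cmod g"
proof -
  define q where "q = gi (round (Re (c / g))) (round (Im (c / g)))"
  have "\<bar>Re (c / g - q)\<bar> \<le> 1 / 2" "\<bar>Im (c / g - q)\<bar> \<le> 1 / 2"
    using of_int_round_abs_le[of "Re (c / g)"] of_int_round_abs_le[of "Im (c / g)"]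
    by (simp_all add: q_def abs_minus_commute)
  then have "(Re (c / g - q))\<^sup>2 \<le> (1 / 2)\<^sup>2" "(Im (c / g - q))\<^sup>2 \<le> (1 / 2)\<^sup>2"
    by (simp_all only: abs_le_square_iff[symmetric] abs_divide abs_numeral abs_one)
  then have "(cmod (c / g - q))\<^sup>2 < 1\<^sup>2" unfolding cmod_power2 by (simp add: power2_eq_square)
  then have "cmod (c / g - q) < 1" by (rule power2_less_imp_less) simp
  then have "cmod (c / g - q) * cmod g < 1 * cmod g" using assms by (intro mult_strict_right_mono) auto
  moreover have "cmod (c / g - q) * cmod g = cmod (c - g * q)"
    using assms unfolding norm_mult[symmetric] by (simp add: algebra_simps)
  ultimately show ?thesis using that[of q] by (simp add: q_def)
qed

lemma gauss_bezout:
  assumes ab: "a \<in> gauss_ints" "b \<in> gauss_ints"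
  obtains g x y where "g \<in> gauss_ints" "x \<in> gauss_ints" "y \<in> gauss_ints" "g = a * x + b * y"
    "gauss_dvd g a" "gauss_dvd g b"
proof (cases "a = 0 \<and> b = 0")
  case True
  then show ?thesis using that[of 0 0 0] by (auto simp: gauss_dvd_refl)
next
  case False
  define J where "J = {a * x + b * y | x y. x \<in> gauss_ints \<and> y \<in> gauss_ints}"
  have "a = a * 1 + b * 0" "b = a * 0 + b * 1" by simp_all
  then have aJ: "a \<in> J" and bJ: "b \<in> J" unfolding J_def using gauss_ints_closed(1,2) by blast+
  obtain g where g: "g \<in> J - {0}" "\<And>h. h \<in> J - {0} \<Longrightarrow> gnorm g \<le> gnorm h"
  proof -
    have "\<exists>g. g \<in> J - {0}" using aJ bJ False by auto
    then show ?thesis using ex_has_least_nat[of "\<lambda>g. g \<in> J - {0}" _ gnorm] that by blast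
  qed
  have JG: "J \<subseteq> gauss_ints" unfolding J_def using ab by auto
  have dvd: "gauss_dvd g c" if c: "c \<in> J" for c
  proof -
    obtain q where q: "q \<in> gauss_ints" "cmod (c - g * q) < cmod g"
      using gauss_division[of c g] c g JG by blast
    obtain x y where xy: "g = a * x + b * y" "x \<in> gauss_ints" "y \<in> gauss_ints" using g unfolding J_def by auto
    obtain x' y' where xy': "c = a * x' + b * y'" "x' \<in> gauss_ints" "y' \<in> gauss_ints" using c unfolding J_def by auto
    have "c - g * q = a * (x' - x * q) + b * (y' - y * q)" unfolding xy xy' by (simp add: algebra_simps)
    then have rJ: "c - g * q \<in> J" unfolding J_def using xy xy' q by auto
    have "c - g * q = 0"
    proof (rule ccontr)
      assume "c - g * q \<noteq> 0"
      then have "gnorm g \<le> gnorm (c - g * q)" using rJ g by auto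
      then have "(cmod g)\<^sup>2 \<le> (cmod (c - g * q))\<^sup>2"
        using rJ g JG real_gnorm by (metis DiffD1 of_nat_mono subsetD)
      then have "cmod g \<le> cmod (c - g * q)" by (rule power2_le_imp_le) simp
      then show False using q by simp
    qed
    then show ?thesis unfolding gauss_dvd_def using q by (intro bexI[of _ q]) auto
  qed
  obtain x y where xy: "g = a * x + b * y" "x \<in> gauss_ints" "y \<in> gauss_ints" using g unfolding J_def by auto
  show ?thesis using that[of g x y] xy g JG dvd aJ bJ by auto
qed

lemma gauss_coprime_bezout:
  assumes "a \<in> gauss_ints" "b \<in> gauss_ints" "gauss_coprime a b"
  obtains x y where "x \<in> gauss_ints" "y \<in> gauss_ints" "a * x + b * y = 1"
proof -
  obtain g x y where g: "g \<in> gauss_ints" "x \<in> gauss_ints" "y \<in> gauss_ints" "g = a * x + b * y"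
    "gauss_dvd g a" "gauss_dvd g b" using gauss_bezout[OF assms(1,2)] by blast
  then have u: "g \<in> gauss_units" using assms(3) unfolding gauss_coprime_def by blast
  have "a * (x * cnj g) + b * (y * cnj g) = g * cnj g" unfolding g(4) by (simp add: algebra_simps)
  also have "\<dots> = 1" using gauss_units_props[OF u] by simp
  finally have "a * (x * cnj g) + b * (y * cnj g) = 1" .
  moreover have "x * cnj g \<in> gauss_ints" "y * cnj g \<in> gauss_ints" using g(1-3) by auto
  ultimately show ?thesis using that by blast
qed

lemma gauss_coprime_dvd:
  assumes "a \<in> gauss_ints" "b \<in> gauss_ints" "c \<in> gauss_ints" "gauss_coprime a b" "gauss_dvd a (b * c)"
  shows "gauss_dvd a c"
proof -
  obtain x y where xy: "x \<in> gauss_ints" "y \<in> gauss_ints" "a * x + b * y = 1"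
    using gauss_coprime_bezout[OF assms(1,2,4)] by blast
  obtain q where q: "q \<in> gauss_ints" "b * c = a * q" using assms(5) unfolding gauss_dvd_def by blast
  have "c = (a * x + b * y) * c" using xy by simp
  also have "\<dots> = a * (x * c) + (b * c) * y" by (simp add: algebra_simps)
  also have "\<dots> = a * (x * c + q * y)" unfolding q by (simp add: algebra_simps)
  finally show ?thesis unfolding gauss_dvd_def using xy q assms by blast
qed

lemma gauss_dvd_antisym:
  assumes "a \<in> gauss_ints" "b \<in> gauss_ints" "a \<noteq> 0" "gauss_dvd a b" "gauss_dvd b a"
  obtains w where "w \<in> gauss_units" "b = a * w"
proof -
  obtain w where w: "w \<in> gauss_ints" "b = a * w" using assms unfolding gauss_dvd_def by blast
  obtain v where v: "v \<in> gauss_ints" "a = b * v" using assms unfolding gauss_dvd_def by blast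
  have "a * (w * v) = a * 1" using w(2) v(2) by (metis mult.assoc mult.right_neutral)
  then have "w * v = 1" using assms by simp
  then have "gnorm w * gnorm v = 1" using gnorm_mult[OF w(1) v(1)] by (simp add: gnorm_def)
  then have "w \<in> gauss_units" using w by (simp add: gauss_units_iff)
  then show ?thesis using that w by blast
qed

definition rot :: "complex \<Rightarrow> complex \<Rightarrow> complex" where "rot b u = u * cnj b / b"

lemma cmod_rot: "b \<noteq> 0 \<Longrightarrow> u \<in> gauss_units \<Longrightarrow> cmod (rot b u) = 1"
  by (simp add: rot_def norm_mult norm_divide gauss_units_props)

lemma rot_eq_imp:
  assumes b: "b1 \<in> gauss_ints" "b2 \<in> gauss_ints" "b1 \<noteq> 0" "b2 \<noteq> 0"
    and cop: "gauss_coprime b1 (cnj b1)" "gauss_coprime b2 (cnj b2)"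
    and u: "u1 \<in> gauss_units" "u2 \<in> gauss_units" and eq: "rot b1 u1 = rot b2 u2"
  obtains w where "w \<in> gauss_units" "b2 = b1 * w" "u2 = u1 * w\<^sup>2"
proof -
  have cross: "u1 * cnj b1 * b2 = u2 * cnj b2 * b1" using eq b by (simp add: rot_def frac_eq_eq)
  have dvd: "gauss_dvd b1 b2" if "b1 \<in> gauss_ints" "b2 \<in> gauss_ints" "gauss_coprime b1 (cnj b1)"
    "u1 \<in> gauss_units" "u2 \<in> gauss_units" "u1 * cnj b1 * b2 = u2 * cnj b2 * b1" for b1 b2 u1 u2
  proof -
    have "cnj b1 * b2 = (cnj u1 * u1) * (cnj b1 * b2)" using that gauss_units_props by simp
    also have "\<dots> = cnj u1 * (u1 * cnj b1 * b2)" by (simp add: mult_ac)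
    also have "\<dots> = b1 * (cnj u1 * (u2 * cnj b2))" unfolding that(6) by (simp add: mult_ac)
    finally have "gauss_dvd b1 (cnj b1 * b2)" unfolding gauss_dvd_def using that gauss_units_props by blast
    then show ?thesis using that by (intro gauss_coprime_dvd[of b1 "cnj b1" b2]) auto
  qed
  have "gauss_dvd b1 b2" using dvd[OF b(1,2) cop(1) u cross] .
  moreover have "gauss_dvd b2 b1" using dvd[OF b(2,1) cop(2) u(2,1) cross[symmetric]] .
  ultimately obtain w where w: "w \<in> gauss_units" "b2 = b1 * w"
    using gauss_dvd_antisym[OF b(1,2,3)] by blast
  have "b1 * cnj b1 * (u1 * w) = b1 * cnj b1 * (u2 * cnj w)" using cross unfolding w by (simp add: mult_ac)
  then have "u1 * w = u2 * cnj w" using b by simp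
  then have "u1 * w * w = u2 * (cnj w * w)" by (simp add: mult_ac)
  then have "u2 = u1 * w\<^sup>2" using gauss_units_props[OF w(1)] by (simp add: power2_eq_square mult.assoc)
  then show ?thesis using that w by blast
qed

lemma Re_eq_unit_circle:
  assumes "cmod z = 1" "cmod w = 1" "Re z = Re w"
  shows "z = w \<or> z = cnj w"
proof -
  have "(Re z)\<^sup>2 + (Im z)\<^sup>2 = 1" "(Re w)\<^sup>2 + (Im w)\<^sup>2 = 1"
    using assms cmod_power2[of z] cmod_power2[of w] by auto
  then have "(Im z)\<^sup>2 = (Im w)\<^sup>2" using assms by simp
  then have "Im z = Im w \<or> Im z = - Im w" by (simp add: power2_eq_iff)
  then show ?thesis using assms by (auto simp: complex_eq_iff)
qed

lemma A_class_cong: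
  assumes "w \<in> gauss_units" "cmod a1 = cmod a2"
  shows "A_class a1 (b * w) (u * w\<^sup>2) = A_class a2 b u"
proof -
  have sub: "A_class a1 (b * w) (u * w\<^sup>2) \<subseteq> A_class a2 b u" if "w \<in> gauss_units" "cmod a1 = cmod a2" for a1 a2 b u w
  proof
    fix t assume "t \<in> A_class a1 (b * w) (u * w\<^sup>2)"
    then obtain a v where t: "t = (a, b * w * v, u * w\<^sup>2 * v\<^sup>2)" "a \<in> gauss_ints" "cmod a = cmod a1" "v \<in> gauss_units"
      unfolding A_class_def by auto
    then have "t = (a, b * (w * v), u * (w * v)\<^sup>2)" by (simp add: power_mult_distrib mult_ac)
    then show "t \<in> A_class a2 b u" unfolding A_class_def using t that gauss_units_mult by auto
  qed
  have w': "cnj w \<in> gauss_units" "w * cnj w = 1" using assms gauss_units_props by auto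
  have eqs: "b * w * cnj w = b" "u * w\<^sup>2 * (cnj w)\<^sup>2 = u"
    using w' by (simp_all add: mult.assoc power_mult_distrib[symmetric])
  have "A_class a2 b u \<subseteq> A_class a1 (b * w) (u * w\<^sup>2)"
    using sub[OF w'(1) assms(2)[symmetric], of "b * w" "u * w\<^sup>2"] by (simp only: eqs)
  then show ?thesis using sub[OF assms, of b u] by auto
qed

lemma rot_cnj: "rot (cnj b) (cnj u) = cnj (rot b u)" by (simp add: rot_def)

lemma gauss_coprime_cnj: "gauss_coprime b (cnj b) \<Longrightarrow> gauss_coprime (cnj b) b"
  unfolding gauss_coprime_def by blast

lemma A_class_self: "a \<in> gauss_ints \<Longrightarrow> (a, b, u) \<in> A_class a b u"
  unfolding A_class_def using gauss_units_def by (auto intro!: exI[of _ 1])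

lemma rot_A_class:
  assumes "(a', b', u') \<in> A_class a b u"
  shows "rot b' u' = rot b u"
proof -
  obtain w where w: "w \<in> gauss_units" "b' = b * w" "u' = u * w\<^sup>2" using assms unfolding A_class_def by auto
  have "rot b' u' = (u * cnj b / b) * (w\<^sup>2 * cnj w / w)" unfolding w rot_def by (simp add: mult_ac)
  also have "w\<^sup>2 * cnj w / w = w * cnj w" using gauss_units_props[OF w(1)] by (simp add: power2_eq_square)
  finally show ?thesis using gauss_units_props[OF w(1)] by (simp add: rot_def)
qed

text \<open>
  The rotation carries the first lattice point of a triple to the second; for fixed \<open>n\<close> its real
  part is a complete invariant of the class \<^const>\<open>A_star\<close>.
\<close>

definition rot_re :: "complex \<times> complex \<times> complex \<Rightarrow> real" where
  "rot_re = (\<lambda>(a, b, u). Re (rot b u))"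

definition Rset :: "nat \<Rightarrow> real \<Rightarrow> real set" where
  "Rset n M = rot_re ` S_set n M"

lemma S_setD:
  assumes "(a, b, u) \<in> S_set n M" "n \<ge> 1"
  shows "a \<in> gauss_ints" "b \<in> gauss_ints" "u \<in> gauss_units" "gauss_coprime b (cnj b)" "a \<noteq> 0" "b \<noteq> 0"
    "gnorm a * gnorm b = n" "0 < real n * (2 - 2 * Re (rot b u))" "real n * (2 - 2 * Re (rot b u)) \<le> M\<^sup>2"
    "cmod (1 - rot b u) \<le> M / sqrt (real n)" "rot b u \<noteq> 1" "M > 0"
proof -
  have s: "a \<in> gauss_ints" "b \<in> gauss_ints" "u \<in> gauss_units" "cmod a * cmod b = sqrt (real n)"
     "0 < cmod a * cmod (b - u * cnj b)" "cmod a * cmod (b - u * cnj b) \<le> M" "gauss_coprime b (cnj b)"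
    using assms unfolding S_set_def by auto
  show "a \<in> gauss_ints" "b \<in> gauss_ints" "u \<in> gauss_units" "gauss_coprime b (cnj b)" by (fact s)+
  have "sqrt (real n) > 0" using assms by simp
  then show ab: "a \<noteq> 0" "b \<noteq> 0" using s(4) by auto
  have "real (gnorm a * gnorm b) = (cmod a * cmod b)\<^sup>2" using s(1,2) by (simp add: real_gnorm power_mult_distrib)
  then have "real (gnorm a * gnorm b) = real n" using s(4) by simp
  then show "gnorm a * gnorm b = n" by linarith
  have d: "cmod (b - u * cnj b) = cmod b * cmod (1 - rot b u)"
  proof -
    have "b - u * cnj b = b * (1 - rot b u)" using ab by (simp add: rot_def algebra_simps)
    then show ?thesis by (simp add: norm_mult)
  qed
  have nd: "cmod a * cmod (b - u * cnj b) = sqrt (real n) * cmod (1 - rot b u)"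
    unfolding d s(4)[symmetric] by simp
  have "(cmod (rot b u))\<^sup>2 = 1" using cmod_rot[OF ab(2) s(3)] by simp
  then have c1: "(cmod (1 - rot b u))\<^sup>2 = 2 - 2 * Re (rot b u)"
    unfolding cmod_power2 by (simp add: power2_eq_square algebra_simps)
  have sq: "(sqrt (real n) * cmod (1 - rot b u))\<^sup>2 = real n * (2 - 2 * Re (rot b u))"
    by (simp add: power_mult_distrib c1)
  show "M > 0" using s by linarith
  show "0 < real n * (2 - 2 * Re (rot b u))" 
    unfolding sq[symmetric] using s(5) unfolding nd by (rule zero_less_power)
  show "real n * (2 - 2 * Re (rot b u)) \<le> M\<^sup>2"
    unfolding sq[symmetric] using s(5,6) nd by (intro power_mono) auto
  show "cmod (1 - rot b u) \<le> M / sqrt (real n)" using s(6) nd assms by (simp add: field_simps)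
  show "rot b u \<noteq> 1" using s(5) nd by auto
qed

lemma S_setI:
  assumes "a \<in> gauss_ints" "b \<in> gauss_ints" "u \<in> gauss_units" "gauss_coprime b (cnj b)" "b \<noteq> 0"
    "gnorm a * gnorm b = n" "0 < real n * (2 - 2 * Re (rot b u))" "real n * (2 - 2 * Re (rot b u)) \<le> M\<^sup>2" "M > 0"
  shows "(a, b, u) \<in> S_set n M"
proof -
  have "(cmod a * cmod b)\<^sup>2 = real (gnorm a * gnorm b)" using assms(1,2) by (simp add: real_gnorm power_mult_distrib)
  then have "(cmod a * cmod b)\<^sup>2 = real n" using assms by simp
  then have ab: "cmod a * cmod b = sqrt (real n)" by (metis norm_ge_zero mult_nonneg_nonneg real_sqrt_unique)
  have d: "cmod (b - u * cnj b) = cmod b * cmod (1 - rot b u)"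
  proof -
    have "b - u * cnj b = b * (1 - rot b u)" using assms by (simp add: rot_def algebra_simps)
    then show ?thesis by (simp add: norm_mult)
  qed
  have nd: "cmod a * cmod (b - u * cnj b) = sqrt (real n) * cmod (1 - rot b u)"
    unfolding d ab[symmetric] by simp
  have "(cmod (rot b u))\<^sup>2 = 1" using cmod_rot assms by simp
  then have c1: "(cmod (1 - rot b u))\<^sup>2 = 2 - 2 * Re (rot b u)"
    unfolding cmod_power2 by (simp add: power2_eq_square algebra_simps)
  have sq: "(cmod a * cmod (b - u * cnj b))\<^sup>2 = real n * (2 - 2 * Re (rot b u))"
    unfolding nd by (simp add: power_mult_distrib c1)
  have "cmod a * cmod (b - u * cnj b) \<noteq> 0" using sq assms(7) by auto
  moreover have "0 \<le> cmod a * cmod (b - u * cnj b)" by simp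
  ultimately have "0 < cmod a * cmod (b - u * cnj b)" by linarith
  moreover have "cmod a * cmod (b - u * cnj b) \<le> M"
    by (rule power2_le_imp_le) (use sq assms in auto)
  ultimately show ?thesis unfolding S_set_def using assms ab by auto
qed

lemma A_star_eq_iff:
  assumes p: "(a1, b1, u1) \<in> S_set n M" "(a2, b2, u2) \<in> S_set n M" and n: "n \<ge> 1"
  shows "A_star a1 b1 u1 = A_star a2 b2 u2 \<longleftrightarrow> Re (rot b1 u1) = Re (rot b2 u2)"
proof
  note d1 = S_setD[OF p(1) n] and d2 = S_setD[OF p(2) n]
  {
    assume "A_star a1 b1 u1 = A_star a2 b2 u2"
    then have "(a1, b1, u1) \<in> A_star a2 b2 u2" using A_class_self[OF d1(1)] unfolding A_star_def by auto
    then show "Re (rot b1 u1) = Re (rot b2 u2)"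
      unfolding A_star_def by (auto dest!: rot_A_class simp: rot_cnj)
  }
  assume "Re (rot b1 u1) = Re (rot b2 u2)"
  then consider "rot b1 u1 = rot b2 u2" | "rot b1 u1 = rot (cnj b2) (cnj u2)"
    using Re_eq_unit_circle[OF cmod_rot cmod_rot] d1 d2 by (auto simp: rot_cnj)
  then show "A_star a1 b1 u1 = A_star a2 b2 u2"
  proof cases
    case 1
    obtain w where w: "w \<in> gauss_units" "b2 = b1 * w" "u2 = u1 * w\<^sup>2"
      using rot_eq_imp[OF d1(2) d2(2) d1(6) d2(6) d1(4) d2(4) d1(3) d2(3) 1] by blast
    have "real (gnorm a1) * real (gnorm b1) = real (gnorm a2) * real (gnorm b1)"
    proof -
      have "gnorm b2 = gnorm b1" using w d1 by (simp add: gnorm_mult gauss_units_iff)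
      then show ?thesis using d1(7) d2(7) by (metis of_nat_mult)
    qed
    then have "(cmod a1)\<^sup>2 = (cmod a2)\<^sup>2" using d1 d2 gnorm_pos[of b1] by (simp add: real_gnorm)
    then have c: "cmod a2 = cmod a1" by simp
    have "A_class a2 b2 u2 = A_class a1 b1 u1" unfolding w by (rule A_class_cong[OF w(1) c])
    moreover have "A_class (cnj a2) (cnj b2) (cnj u2) = A_class (cnj a1) (cnj b1) (cnj u1)"
      unfolding w complex_cnj_mult complex_cnj_power
      by (rule A_class_cong) (use w c gauss_units_props in auto)
    ultimately show ?thesis by (simp add: A_star_def)
  next
    case 2
    have d2': "cnj b2 \<in> gauss_ints" "cnj b2 \<noteq> 0" "gauss_coprime (cnj b2) (cnj (cnj b2))" "cnj u2 \<in> gauss_units"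
      using d2 gauss_coprime_cnj gauss_units_props by auto
    obtain w where w: "w \<in> gauss_units" "cnj b2 = b1 * w" "cnj u2 = u1 * w\<^sup>2"
      using rot_eq_imp[OF d1(2) d2'(1) d1(6) d2'(2) d1(4) d2'(3) d1(3) d2'(4) 2] by blast
    have "real (gnorm a1) * real (gnorm b1) = real (gnorm a2) * real (gnorm b1)"
    proof -
      have "gnorm b2 = gnorm (cnj b2)" by (simp add: gnorm_cnj)
      also have "\<dots> = gnorm b1" unfolding w using w d1 by (simp add: gnorm_mult gauss_units_iff)
      finally show ?thesis using d1(7) d2(7) by (metis of_nat_mult)
    qed
    then have "(cmod a1)\<^sup>2 = (cmod a2)\<^sup>2" using d1 d2 gnorm_pos[of b1] by (simp add: real_gnorm)
    then have c: "cmod (cnj a2) = cmod a1" by simp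
    have "A_class (cnj a2) (cnj b2) (cnj u2) = A_class a1 b1 u1" unfolding w by (rule A_class_cong[OF w(1) c])
    moreover have "A_class a2 b2 u2 = A_class (cnj a1) (cnj b1) (cnj u1)"
    proof -
      have "b2 = cnj b1 * cnj w" "u2 = cnj u1 * (cnj w)\<^sup>2"
        using w(2,3) by (metis complex_cnj_cnj complex_cnj_mult complex_cnj_power)+
      then show ?thesis by (simp only:) (rule A_class_cong, use w c gauss_units_props in auto)
    qed
    ultimately show ?thesis by (auto simp: A_star_def)
  qed
qed

lemma card_image_kernel:
  assumes "\<And>x y. x \<in> S \<Longrightarrow> y \<in> S \<Longrightarrow> f x = f y \<longleftrightarrow> g x = g y"
  shows "card (f ` S) = card (g ` S)"
proof -
  define h where "h y = g (SOME x. x \<in> S \<and> f x = y)" for y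
  have h: "h (f x) = g x" if "x \<in> S" for x
  proof -
    have "\<exists>y. y \<in> S \<and> f y = f x" using that by blast
    then have "(SOME y. y \<in> S \<and> f y = f x) \<in> S \<and> f (SOME y. y \<in> S \<and> f y = f x) = f x" by (rule someI_ex)
    then show ?thesis using assms that unfolding h_def by blast
  qed
  have "inj_on h (f ` S)" by (intro inj_onI) (auto simp: h assms)
  moreover have "h ` (f ` S) = g ` S" using h by (auto simp: image_iff)
  ultimately show ?thesis by (metis card_image)
qed

lemma card_A_family: "n \<ge> 1 \<Longrightarrow> card (A_family n M) = card (Rset n M)"
proof -
  assume n: "n \<ge> 1"
  have "A_family n M = (\<lambda>(a, b, u). A_star a b u) ` S_set n M"
    unfolding A_family_def by force
  moreover have "card ((\<lambda>(a, b, u). A_star a b u) ` S_set n M) = card (rot_re ` S_set n M)"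
  proof (rule card_image_kernel)
    fix x y assume xy: "x \<in> S_set n M" "y \<in> S_set n M"
    obtain a1 b1 u1 a2 b2 u2 where "x = (a1, b1, u1)" "y = (a2, b2, u2)" by (metis prod_cases3)
    then show "(case x of (a, b, u) \<Rightarrow> A_star a b u) = (case y of (a, b, u) \<Rightarrow> A_star a b u) \<longleftrightarrow> rot_re x = rot_re y"
      using A_star_eq_iff[of a1 b1 u1 n M a2 b2 u2] xy n by (simp add: rot_re_def)
  qed
  ultimately show ?thesis by (simp add: Rset_def)
qed

section \<open>Sums of two squares and the parametrisation of classes\<close>

lemma minus_one_quadratic_residue:
  assumes p: "prime p" "p mod 4 = (1::nat)"
  obtains y :: int where "int p dvd y\<^sup>2 + 1"
proof -
  have p5: "p > 2" using p prime_ge_2_nat[of p] by (cases "p = 2") auto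
  have "[Legendre (-1) (int p) = (-1) ^ ((p - 1) div 2)] (mod int p)"
    using euler_criterion[of p "-1"] p p5 by simp
  moreover have "even ((p - 1) div 2)" using p by presburger
  ultimately have c: "[Legendre (-1) (int p) = 1] (mod int p)" by simp
  have "QuadRes (int p) (-1)"
  proof (rule ccontr)
    assume "\<not> QuadRes (int p) (-1)"
    then have "Legendre (-1) (int p) \<in> {0, -1}" by (auto simp: Legendre_def)
    then have "int p dvd 1 \<or> int p dvd 2" using c by (auto simp: cong_iff_dvd_diff)
    then have "p dvd 1 \<or> p dvd 2" by (metis int_dvd_int_iff of_nat_1 of_nat_numeral)
    then show False using p5 by (auto dest: dvd_imp_le)
  qed
  then obtain y where "[y\<^sup>2 = -1] (mod int p)" unfolding QuadRes_def by blast
  then have "int p dvd y\<^sup>2 + 1" by (simp add: cong_iff_dvd_diff)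
  then show ?thesis by (rule that)
qed

lemma prime_sum_two_squares:
  assumes p: "prime p" "p mod 4 = (1::nat)"
  obtains a b :: int where "int p = a\<^sup>2 + b\<^sup>2"
proof -
  obtain y where y: "int p dvd y\<^sup>2 + 1" using minus_one_quadratic_residue[OF p] by blast
  then obtain k where k: "y\<^sup>2 + 1 = int p * k" by (elim dvdE)
  have not_dvd: False if q: "q \<in> gauss_ints" "gi y s = of_nat p * q" "s \<in> {1,-1}" for q s
  proof -
    obtain a b where "q = gi a b" using q by (elim gauss_intsE)
    then have "Im (gi y s) = real p * real_of_int b" unfolding q by simp
    then have "real_of_int s = real_of_int (int p * b)" by simp
    then have "s = int p * b" by linarith
    then have "int p dvd 1" using q(3) by (metis dvd_minus_iff dvd_triv_left insertE singletonD)
    then show False using p by (metis int_dvd_int_iff not_prime_unit of_nat_1)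
  qed
  obtain g x z where g: "g \<in> gauss_ints" "x \<in> gauss_ints" "z \<in> gauss_ints"
    "g = of_nat p * x + gi y 1 * z" "gauss_dvd g (of_nat p)" "gauss_dvd g (gi y 1)"
    using gauss_bezout[of "of_nat p" "gi y 1"] by auto
  obtain h where h: "h \<in> gauss_ints" "of_nat p = g * h" using g(5) unfolding gauss_dvd_def by blast
  have "gnorm (of_nat p) = p\<^sup>2"
  proof -
    have "real (gnorm (of_nat p)) = real (p\<^sup>2)" by (simp add: real_gnorm)
    then show ?thesis by linarith
  qed
  then have gh: "gnorm g * gnorm h = p\<^sup>2" using gnorm_mult[OF g(1) h(1)] h(2) by simp
  then have "gnorm g dvd p\<^sup>2" by (metis dvd_triv_left)
  then obtain i where i: "i \<le> 2" "gnorm g = p ^ i" using p divides_primepow_nat by blast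
  have "i \<noteq> 0"
  proof
    assume "i = 0"
    then have u: "g \<in> gauss_units" using i g by (simp add: gauss_units_iff)
    have kk: "gi y 1 * gi y (-1) = of_nat p * of_int k"
    proof -
      have "gi y 1 * gi y (-1) = of_int (y\<^sup>2 + 1)" by (simp add: gi_def complex_eq_iff power2_eq_square)
      then show ?thesis unfolding k by simp
    qed
    have "gi y (-1) = (cnj g * g) * gi y (-1)" using gauss_units_props[OF u] by simp
    also have "\<dots> = cnj g * (of_nat p * x * gi y (-1) + (gi y 1 * gi y (-1)) * z)"
      by (subst (2) g(4)) (simp add: algebra_simps)
    also have "\<dots> = of_nat p * (cnj g * (x * gi y (-1) + of_int k * z))" unfolding kk by (simp add: algebra_simps)
    finally show False using not_dvd[of "cnj g * (x * gi y (-1) + of_int k * z)" "-1"] g by auto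
  qed
  moreover have "i \<noteq> 2"
  proof
    assume "i = 2"
    then have "gnorm h = 1" using gh i prime_gt_0_nat[OF p(1)] by simp
    then have u: "h \<in> gauss_units" using h by (simp add: gauss_units_iff)
    obtain q where q: "q \<in> gauss_ints" "gi y 1 = g * q" using g(6) unfolding gauss_dvd_def by blast
    have "g = g * (h * cnj h)" using gauss_units_props[OF u] by simp
    also have "\<dots> = of_nat p * cnj h" unfolding h(2) by (simp add: mult_ac)
    finally have "gi y 1 = of_nat p * (cnj h * q)" using q by (metis mult.assoc)
    then show False using not_dvd[of "cnj h * q" 1] h q by auto
  qed
  ultimately have "i = 1" using i by linarith
  then have "gnorm g = p" using i by simp
  moreover obtain a b where "g = gi a b" using g by (elim gauss_intsE)
  ultimately have "int p = a\<^sup>2 + b\<^sup>2" using gnorm_gi[of a b] by simp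
  then show ?thesis by (rule that)
qed

lemma G4_sum_two_squares: "m \<in> G4 \<Longrightarrow> \<exists>a b :: int. int m = a\<^sup>2 + b\<^sup>2"
proof (induction m rule: less_induct)
  case (less m)
  show ?case
  proof (cases "m = 1")
    case True
    then show ?thesis by (intro exI[of _ 1] exI[of _ 0]) simp
  next
    case False
    then obtain p where p: "prime p" "p dvd m" using prime_factor_nat by blast
    have m0: "m > 0" using less G4_pos by blast
    obtain k where k: "m = p * k" using p by (elim dvdE)
    have "k \<in> G4" using G4_dvd[OF less.prems, of k] k by simp
    moreover have "k < m" using k m0 prime_gt_1_nat[OF p(1)] by (cases "k = 0") auto
    ultimately obtain a b :: int where ab: "int k = a\<^sup>2 + b\<^sup>2" using less.IH by blast
    obtain c d :: int where cd: "int p = c\<^sup>2 + d\<^sup>2"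
      using prime_sum_two_squares[OF p(1) G4_prime_dvd[OF less.prems p]] by blast
    have "int m = (a * c - b * d)\<^sup>2 + (a * d + b * c)\<^sup>2"
      unfolding k of_nat_mult ab cd by (simp add: power2_eq_square algebra_simps)
    then show ?thesis by blast
  qed
qed

lemma G4_scaled_sum_two_squares:
  assumes "m \<in> G4" "e \<in> {1,2}"
  shows "\<exists>a b :: int. int (e * m * k\<^sup>2) = a\<^sup>2 + b\<^sup>2"
proof -
  obtain a b :: int where ab: "int m = a\<^sup>2 + b\<^sup>2" using G4_sum_two_squares assms by blast
  show ?thesis
  proof (cases "e = 1")
    case True
    have "int (e * m * k\<^sup>2) = (a * int k)\<^sup>2 + (b * int k)\<^sup>2"
      unfolding True of_nat_mult ab by (simp add: power2_eq_square algebra_simps)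
    then show ?thesis by blast
  next
    case False
    then have e: "e = 2" using assms by auto
    have "int (e * m * k\<^sup>2) = ((a + b) * int k)\<^sup>2 + ((a - b) * int k)\<^sup>2"
      unfolding e of_nat_mult ab by (simp add: power2_eq_square algebra_simps)
    then show ?thesis by blast
  qed
qed

lemma prime_3_mod_4_dvd_sum_squares:
  fixes s t :: nat
  assumes q: "prime q" "q mod 4 = 3" and dvd: "q dvd s\<^sup>2 + t\<^sup>2"
  shows "q dvd s"
proof (rule ccontr)
  assume s: "\<not> q dvd s"
  have t: "\<not> q dvd t"
  proof
    assume "q dvd t"
    then have "q dvd t\<^sup>2" by (simp add: power2_eq_square)
    then have "q dvd s\<^sup>2" using dvd by (metis dvd_add_left_iff)
    then show False using s q prime_dvd_power by blast
  qed
  define k where "k = (q - 1) div 2"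
  have k: "odd k" "q - 1 = 2 * k" using q unfolding k_def by presburger+
  have "[s ^ (q - 1) = 1] (mod q)" "[t ^ (q - 1) = 1] (mod q)" using fermat_theorem q s t by blast+
  then have f: "[(int s)\<^sup>2 ^ k = 1] (mod int q)" "[(int t)\<^sup>2 ^ k = 1] (mod int q)"
    unfolding k by (metis cong_int_iff of_nat_1 of_nat_power power_mult)+
  have "[(int s)\<^sup>2 = - (int t)\<^sup>2] (mod int q)"
    using dvd by (simp add: cong_iff_dvd_diff flip: int_dvd_int_iff)
  then have "[(int s)\<^sup>2 ^ k = (- (int t)\<^sup>2) ^ k] (mod int q)" by (rule cong_pow)
  then have "[(int s)\<^sup>2 ^ k = - ((int t)\<^sup>2 ^ k)] (mod int q)" using k by simp
  then have "[1 = - 1] (mod int q)"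
    using f by (meson cong_minus_minus_iff cong_sym cong_trans)
  then have "int q dvd 2" by (simp add: cong_iff_dvd_diff)
  then have "q dvd 2" by (metis int_dvd_int_iff of_nat_numeral)
  then have "q \<le> 2" by (auto dest: dvd_imp_le)
  then show False using q by (cases "q = 2") (auto simp: prime_nat_iff)
qed

lemma sum_two_squares_decompose:
  fixes s t :: nat
  shows "s\<^sup>2 + t\<^sup>2 > 0 \<Longrightarrow> \<exists>e m h. e \<in> {1,2} \<and> m \<in> G4 \<and> h > 0 \<and> s\<^sup>2 + t\<^sup>2 = e * m * h\<^sup>2"
proof (induction "s + t" arbitrary: s t rule: less_induct)
  case less
  define a where "a = s\<^sup>2 + t\<^sup>2"
  show ?case
  proof (cases "\<exists>q. prime q \<and> q mod 4 = 3 \<and> q dvd a")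
    case True
    then obtain q where q: "prime q" "q mod 4 = 3" "q dvd s\<^sup>2 + t\<^sup>2" unfolding a_def by blast
    have "q dvd s" by (rule prime_3_mod_4_dvd_sum_squares[OF q])
    moreover have "q dvd t" by (rule prime_3_mod_4_dvd_sum_squares[of q t s]) (use q in \<open>auto simp: add.commute\<close>)
    ultimately obtain s' t' where st: "s = q * s'" "t = q * t'" by (elim dvdE)
    have q1: "q > 1" using q prime_gt_1_nat by blast
    have pos: "s'\<^sup>2 + t'\<^sup>2 > 0" using less.prems unfolding st by (auto simp: power_mult_distrib)
    have "s' + t' < s + t"
    proof -
      have "s' + t' > 0" using pos by auto
      then have "1 * (s' + t') < q * (s' + t')" using q1 by (intro mult_strict_right_mono) auto
      then show ?thesis unfolding st by (simp add: distrib_left)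
    qed
    then obtain e m h where emh: "e \<in> {1,2}" "m \<in> G4" "h > 0" "s'\<^sup>2 + t'\<^sup>2 = e * m * h\<^sup>2"
      using less.hyps[of s' t'] pos by blast
    have "s\<^sup>2 + t\<^sup>2 = q\<^sup>2 * (s'\<^sup>2 + t'\<^sup>2)" unfolding st by (simp add: power_mult_distrib distrib_left)
    also have "\<dots> = e * m * (q * h)\<^sup>2" unfolding emh(4) by (simp add: power_mult_distrib mult_ac)
    finally show ?thesis using emh q1 by (intro exI[of _ e] exI[of _ m] exI[of _ "q * h"]) auto
  next
    case False
    have a0: "a > 0" using less.prems a_def by simp
    define m0 where "m0 = squarefree_part a"
    define h where "h = square_part a"
    have dec: "a = m0 * h\<^sup>2" unfolding m0_def h_def by (rule squarefree_decompose)
    have h0: "h > 0" using dec a0 by (cases "h = 0") auto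
    have sf: "squarefree m0" unfolding m0_def by simp
    have pr: "p = 2 \<or> p mod 4 = 1" if "prime p" "p dvd m0" for p
    proof -
      have "p dvd a" using that dec by auto
      then show ?thesis using that False prime_mod_4_cases[of p] by blast
    qed
    show ?thesis
    proof (cases "even m0")
      case False
      then have "m0 \<in> G4" unfolding G4_def using sf pr by auto
      then show ?thesis using dec h0 unfolding a_def by (intro exI[of _ 1] exI[of _ m0] exI[of _ h]) auto
    next
      case True
      then obtain m where m: "m0 = 2 * m" by (elim evenE)
      have "odd m" using squarefree_not_dvd_div[OF sf two_is_prime_nat True] m by simp
      have "p mod 4 = 1" if "prime p" "p dvd m" for p
        using pr[of p] that m \<open>odd m\<close> by (cases "p = 2") auto
      then have "m \<in> G4" unfolding G4_def using sf m squarefree_mono[of m m0] by auto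
      then show ?thesis using dec h0 m unfolding a_def by (intro exI[of _ 2] exI[of _ m] exI[of _ h]) auto
    qed
  qed
qed

lemma gauss_coprime_cnj_gi:
  assumes "coprime x y" "odd (x + y)"
  shows "gauss_coprime (gi x y) (cnj (gi x y))"
  unfolding gauss_coprime_def
proof (intro ballI impI)
  fix d assume d: "d \<in> gauss_ints" "gauss_dvd d (gi x y)" "gauss_dvd d (cnj (gi x y))"
  obtain q1 where q1: "q1 \<in> gauss_ints" "gi x y = d * q1" using d unfolding gauss_dvd_def by blast
  obtain q2 where q2: "q2 \<in> gauss_ints" "cnj (gi x y) = d * q2" using d unfolding gauss_dvd_def by blast
  obtain s t where st: "s * x + t * y = 1" using assms(1) by (metis bezout_int coprime_iff_gcd_eq_1)
  have "2 = of_int s * (gi x y + cnj (gi x y)) - \<i> * of_int t * (gi x y - cnj (gi x y))"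
  proof -
    have "real_of_int (s * x + t * y) = 1" using st by simp
    then show ?thesis by (simp add: complex_eq_iff algebra_simps)
  qed
  also have "\<dots> = d * (of_int s * (q1 + q2) - \<i> * of_int t * (q1 - q2))"
    unfolding q2(2) unfolding q1(2) by (simp add: algebra_simps)
  finally have two: "2 = d * (of_int s * (q1 + q2) - \<i> * of_int t * (q1 - q2))" .
  have "gnorm 2 = gnorm d * gnorm (of_int s * (q1 + q2) - \<i> * of_int t * (q1 - q2))"
    by (subst two, rule gnorm_mult) (use d q1 q2 in auto)
  moreover have "gnorm 2 = 4" by (simp add: gnorm_def)
  ultimately have d4: "gnorm d dvd 4" by (metis dvd_triv_left)
  have "gnorm (gi x y) = gnorm d * gnorm q1" unfolding q1(2) by (rule gnorm_mult[OF d(1) q1(1)])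
  then have "gnorm d dvd gnorm (gi x y)" by simp
  moreover have "odd (gnorm (gi x y))"
  proof -
    have "odd (x\<^sup>2 + y\<^sup>2)" using assms(2) by simp
    then have "odd (int (gnorm (gi x y)))" unfolding gnorm_gi .
    then show ?thesis by simp
  qed
  ultimately have "odd (gnorm d)" by auto
  moreover obtain i where "gnorm d = 2 ^ i"
    using divides_primepow_nat[OF two_is_prime_nat, of "gnorm d" 2] d4 by auto
  ultimately have "gnorm d = 1" by (cases i) auto
  then show "d \<in> gauss_units" using d by (simp add: gauss_units_iff)
qed

lemma rot_cnj_div: "rot z 1 = cnj z / z" by (simp add: rot_def)

lemma Re_cnj_div: "z \<noteq> 0 \<Longrightarrow> Re (cnj z / z) = ((Re z)\<^sup>2 - (Im z)\<^sup>2) / ((Re z)\<^sup>2 + (Im z)\<^sup>2)"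
  by (simp add: Re_divide power2_eq_square)

text \<open>
  Writing \<open>(cmod \<alpha>)\<^sup>2\<close> as \<open>m * h\<^sup>2\<close> or \<open>2 * m * h\<^sup>2\<close> and absorbing \<open>h\<close> into \<open>\<beta>\<close> removes every coprimality
  condition from the count.
\<close>

definition Tset :: "nat \<Rightarrow> (nat \<times> nat \<times> nat \<times> nat) set" where
  "Tset n = {(e, m, X, Y). e \<in> {1,2} \<and> m \<in> G4 \<and> 1 \<le> Y \<and> par e X Y \<and> m * (X\<^sup>2 + Y\<^sup>2) = e * n}"

definition ratio :: "nat \<Rightarrow> nat \<Rightarrow> real" where
  "ratio X Y = ((real X)\<^sup>2 - (real Y)\<^sup>2) / ((real X)\<^sup>2 + (real Y)\<^sup>2)"

lemma ratio_dist:
  assumes "(e, m, X, Y) \<in> Tset n"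
  shows "real n * (2 - 2 * ratio X Y) = 4 * real m * (real Y)\<^sup>2 / real e"
proof -
  have t: "e \<in> {1,2}" "Y \<ge> 1" "m * (X\<^sup>2 + Y\<^sup>2) = e * n" using assms unfolding Tset_def by auto
  have "real (m * (X\<^sup>2 + Y\<^sup>2)) = real (e * n)" using t(3) by simp
  then have n: "real n = real m * ((real X)\<^sup>2 + (real Y)\<^sup>2) / real e" using t(1) by (auto simp: field_simps)
  have pos: "(real X)\<^sup>2 + (real Y)\<^sup>2 > 0" using t(2) by (simp add: sum_power2_gt_zero_iff)
  have e2: "2 - 2 * ratio X Y = 4 * (real Y)\<^sup>2 / ((real X)\<^sup>2 + (real Y)\<^sup>2)"
  proof -
    define D where "D = (real X)\<^sup>2 + (real Y)\<^sup>2"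
    have "2 - 2 * ratio X Y = (2 * D - 2 * ((real X)\<^sup>2 - (real Y)\<^sup>2)) / D"
      using pos unfolding ratio_def D_def[symmetric] by (simp add: diff_divide_distrib)
    also have "\<dots> = 4 * (real Y)\<^sup>2 / D" by (simp add: D_def)
    finally show ?thesis unfolding D_def .
  qed
  show ?thesis unfolding n e2 using pos by simp
qed

lemma rot_representation:
  assumes b: "b \<in> gauss_ints" "b \<noteq> 0" and u: "u \<in> gauss_units"
  obtains x y :: int and f :: nat where "f \<in> {1,2}" "rot b u = rot (gi x y) 1" "x\<^sup>2 + y\<^sup>2 = int (f * gnorm b)"
    "f = 2 \<longrightarrow> even (x + y)"
proof -
  obtain p q where pq: "b = gi p q" using b by (elim gauss_intsE)
  have nz: "gi p q \<noteq> 0" using b pq by simp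
  have n: "int (gnorm b) = p\<^sup>2 + q\<^sup>2" unfolding pq by (rule gnorm_gi)
  consider "u = 1" | "u = -1" | "u = \<i>" | "u = -\<i>" using u unfolding gauss_units_def by auto
  then show ?thesis
  proof cases
    case 1
    then show ?thesis using that[of 1 p q] n pq by simp
  next
    case 2
    have "gi (-q) p = \<i> * gi p q" by (simp add: complex_eq_iff)
    then have "rot b u = rot (gi (-q) p) 1" unfolding pq 2 rot_def using nz by simp
    then show ?thesis using that[of 1 "-q" p] n by simp
  next
    case 3
    have e: "gi (p + q) (q - p) = (1 - \<i>) * gi p q" by (simp add: complex_eq_iff)
    have "(1 + \<i>) / (1 - \<i>) = \<i>" by (simp add: complex_eq_iff Re_divide Im_divide)
    then have "rot b u = rot (gi (p + q) (q - p)) 1" unfolding pq 3 rot_def e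
      by (simp add: times_divide_times_eq[symmetric])
    then show ?thesis using that[of 2 "p + q" "q - p"] n by (simp add: power2_eq_square algebra_simps)
  next
    case 4
    have e: "gi (p - q) (p + q) = (1 + \<i>) * gi p q" by (simp add: complex_eq_iff)
    have "(1 - \<i>) / (1 + \<i>) = - \<i>" by (simp add: complex_eq_iff Re_divide Im_divide)
    then have "rot b u = rot (gi (p - q) (p + q)) 1" unfolding pq 4 rot_def e
      by (simp add: times_divide_times_eq[symmetric])
    then show ?thesis using that[of 2 "p - q" "p + q"] n by (simp add: power2_eq_square algebra_simps)
  qed
qed

lemma Rset_subset_ratio:
  assumes n: "n \<ge> 1" and r: "r \<in> Rset n M"
  shows "\<exists>e m X Y. (e, m, X, Y) \<in> Tset n \<and> r = ratio X Y"
proof -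
  obtain a b u where S: "(a, b, u) \<in> S_set n M" "r = Re (rot b u)" using r unfolding Rset_def rot_re_def by auto
  note d = S_setD[OF S(1) n]
  obtain x y f where f: "f \<in> {1,2}" "rot b u = rot (gi x y) 1" "x\<^sup>2 + y\<^sup>2 = int (f * gnorm b)"
    "f = 2 \<longrightarrow> even (x + y)" by (rule rot_representation[OF d(2,6,3)])
  obtain s t where st: "a = gi s t" using d by (elim gauss_intsE)
  have "int (gnorm a) = int ((nat \<bar>s\<bar>)\<^sup>2 + (nat \<bar>t\<bar>)\<^sup>2)" unfolding st gnorm_gi by simp
  then have ga: "gnorm a = (nat \<bar>s\<bar>)\<^sup>2 + (nat \<bar>t\<bar>)\<^sup>2" by linarith
  have "gnorm a > 0" using gnorm_pos d by fastforce
  then obtain e' m h where emh: "e' \<in> {1,2}" "m \<in> G4" "h > 0" "gnorm a = e' * m * h\<^sup>2"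
    using sum_two_squares_decompose[of "nat \<bar>s\<bar>" "nat \<bar>t\<bar>"] ga by auto
  define X where "X = nat \<bar>x\<bar>"
  define Y where "Y = nat \<bar>y\<bar>"
  have XY: "X\<^sup>2 + Y\<^sup>2 = f * gnorm b"
  proof -
    have "int (X\<^sup>2 + Y\<^sup>2) = int (f * gnorm b)" using f(3) by (simp add: X_def Y_def)
    then show ?thesis by linarith
  qed
  have even: "even (X + Y)" if "f = 2" using f(4) that by (simp add: X_def Y_def even_nat_iff)
  have nz: "gi x y \<noteq> 0"
  proof
    assume "gi x y = 0"
    then have "x = 0" "y = 0" by (auto simp: complex_eq_iff)
    then show False using f(1,3) gnorm_pos[OF d(2,6)] by auto
  qed
  have ry: "r = ratio X Y"
    unfolding S(2) f(2) rot_cnj_div Re_cnj_div[OF nz] ratio_def X_def Y_def by simp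
  have Y1: "Y \<ge> 1"
  proof (rule ccontr)
    assume "\<not> Y \<ge> 1"
    then have "y = 0" by (simp add: Y_def)
    then have "rot (gi x y) 1 = 1" using nz by (simp add: rot_def complex_eq_iff Re_divide Im_divide power2_eq_square)
    then show False using d(11) f(2) by simp
  qed
  have scale: "ratio (c * X) (c * Y) = ratio X Y" if "c > 0" for c
  proof -
    have "ratio (c * X) (c * Y) = ((real c)\<^sup>2 * ((real X)\<^sup>2 - (real Y)\<^sup>2)) / ((real c)\<^sup>2 * ((real X)\<^sup>2 + (real Y)\<^sup>2))"
      unfolding ratio_def by (simp add: power_mult_distrib algebra_simps)
    then show ?thesis using that unfolding ratio_def by simp
  qed
  have key: "(e, m, c * X, c * Y) \<in> Tset n"
    if "e \<in> {1,2}" "c > 0" "par e (c * X) (c * Y)" "c\<^sup>2 * f = e * e' * h\<^sup>2" for e c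
  proof -
    have "m * ((c * X)\<^sup>2 + (c * Y)\<^sup>2) = m * c\<^sup>2 * (X\<^sup>2 + Y\<^sup>2)" by (simp add: power_mult_distrib algebra_simps)
    also have "\<dots> = m * (c\<^sup>2 * f) * gnorm b" unfolding XY by (simp add: mult_ac)
    also have "\<dots> = e * (gnorm a * gnorm b)" unfolding that emh(4) by (simp add: mult_ac)
    finally have "m * ((c * X)\<^sup>2 + (c * Y)\<^sup>2) = e * n" using d(7) by simp
    then show ?thesis unfolding Tset_def using that emh Y1 by simp
  qed
  consider "f = 1" "e' = 1" | "f = 1" "e' = 2" | "f = 2" "e' = 1" | "f = 2" "e' = 2" using f(1) emh(1) by auto
  then show ?thesis
  proof cases
    case 1
    then have "(1, m, h * X, h * Y) \<in> Tset n" using emh by (intro key) (auto simp: par_def)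
    moreover have "ratio (h * X) (h * Y) = r" using scale[of h] emh ry by simp
    ultimately show ?thesis by blast
  next
    case 2
    then have "(2, m, (2*h) * X, (2*h) * Y) \<in> Tset n" using emh by (intro key) (auto simp: par_def power_mult_distrib)
    moreover have "ratio ((2*h) * X) ((2*h) * Y) = r" using scale[of "2*h"] emh ry by simp
    ultimately show ?thesis by blast
  next
    case 3
    then have "(2, m, h * X, h * Y) \<in> Tset n" using emh even by (intro key) (auto simp: par_def distrib_left[symmetric])
    moreover have "ratio (h * X) (h * Y) = r" using scale[of h] emh ry by simp
    ultimately show ?thesis by blast
  next
    case 4
    then have "(1, m, h * X, h * Y) \<in> Tset n" using emh by (intro key) (auto simp: par_def)
    moreover have "ratio (h * X) (h * Y) = r" using scale[of h] emh ry by simp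
    ultimately show ?thesis by blast
  qed
qed

lemma ratio_in_Rset:
  assumes n: "n \<ge> 1" and T: "(e, m, X, Y) \<in> Tset n" and M: "4 * real m * (real Y)\<^sup>2 \<le> real e * M\<^sup>2" "M > 0"
  shows "ratio X Y \<in> Rset n M"
proof -
  have t: "e \<in> {1,2}" "m \<in> G4" "Y \<ge> 1" "par e X Y" "m * (X\<^sup>2 + Y\<^sup>2) = e * n" using T unfolding Tset_def by auto
  have e0: "real e > 0" using t by auto
  have m0: "real m > 0" using t G4_pos by simp
  have dist: "0 < real n * (2 - 2 * ratio X Y)" "real n * (2 - 2 * ratio X Y) \<le> M\<^sup>2"
    unfolding ratio_dist[OF T] using e0 m0 t(3) M(1) by (auto simp: field_simps)
  define g where "g = gcd X Y"
  have g0: "g > 0" using t(3) by (auto simp: g_def)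
  obtain x y where xy: "X = g * x" "Y = g * y" "coprime x y"
    unfolding g_def using gcd_coprime_exists[of X Y] t(3) by (metis mult.commute gcd_eq_0_iff not_one_le_zero)
  have y0: "y > 0" using xy t(3) by (cases "y = 0") auto
  define z where "z = gi (int x) (int y)"
  have z0: "z \<noteq> 0" using y0 by (auto simp: z_def complex_eq_iff)
  have rz: "Re (rot z 1) = ratio X Y"
  proof -
    have "ratio X Y = ((real g)\<^sup>2 * ((real x)\<^sup>2 - (real y)\<^sup>2)) / ((real g)\<^sup>2 * ((real x)\<^sup>2 + (real y)\<^sup>2))"
      unfolding ratio_def xy by (simp add: power_mult_distrib algebra_simps)
    then show ?thesis unfolding rot_cnj_div Re_cnj_div[OF z0] using g0 by (simp add: z_def)
  qed
  have N: "m * g\<^sup>2 * (x\<^sup>2 + y\<^sup>2) = e * n" using t(5) unfolding xy by (simp add: power_mult_distrib algebra_simps)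
  have fin: "ratio X Y \<in> Rset n M"
    if b: "b \<in> gauss_ints" "b \<noteq> 0" "gauss_coprime b (cnj b)" "u \<in> gauss_units" "rot b u = rot z 1"
      and k: "f \<in> {1,2}" "n = f * m * k\<^sup>2 * gnorm b" for b u f k
  proof -
    obtain p q :: int where pq: "int (f * m * k\<^sup>2) = p\<^sup>2 + q\<^sup>2"
      using G4_scaled_sum_two_squares[OF t(2) k(1)] by blast
    then have "int (gnorm (gi p q)) = int (f * m * k\<^sup>2)" using gnorm_gi by simp
    then have "gnorm (gi p q) = f * m * k\<^sup>2" by linarith
    then have "gnorm (gi p q) * gnorm b = n" using k by simp
    then have "(gi p q, b, u) \<in> S_set n M" using b dist rz M by (intro S_setI) auto
    then have "rot_re (gi p q, b, u) \<in> Rset n M" unfolding Rset_def by blast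
    then show ?thesis using b rz by (simp add: rot_re_def)
  qed
  have gz: "gnorm z = x\<^sup>2 + y\<^sup>2"
  proof -
    have "int (gnorm z) = int (x\<^sup>2 + y\<^sup>2)" unfolding z_def gnorm_gi by simp
    then show ?thesis by linarith
  qed
  show ?thesis
  proof (cases "odd (x + y)")
    case True
    have cop: "gauss_coprime z (cnj z)" unfolding z_def
      using True xy(3) by (intro gauss_coprime_cnj_gi) auto
    show ?thesis
    proof (cases "e = 1")
      case e1: True
      then have "n = 1 * m * g\<^sup>2 * gnorm z" using N[folded gz] by simp
      then show ?thesis using cop z0 by (intro fin[of z 1 1 g]) (auto simp: z_def gauss_units_def)
    next
      case False
      then have e2: "e = 2" using t by auto
      have "even (g * (x + y))" using t(4) e2 xy unfolding par_def by (simp add: distrib_left)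
      then have "even g" using True by simp
      then obtain k where k: "g = 2 * k" by (elim evenE)
      have "n = 2 * m * k\<^sup>2 * gnorm z" using N[folded gz] e2 k by (simp add: power_mult_distrib mult_ac)
      then show ?thesis using cop z0 by (intro fin[of z 1 2 k]) (auto simp: z_def gauss_units_def)
    qed
  next
    case False
    have "odd x \<and> odd y" using False xy(3) by (metis coprime_common_divisor even_add odd_one)
    define p where "p = (int x + int y) div 2"
    define q where "q = (int y - int x) div 2"
    have pq: "int x + int y = 2 * p" "int y - int x = 2 * q"
      using \<open>odd x \<and> odd y\<close> unfolding p_def q_def by auto
    then have xpq: "int x = p - q" "int y = p + q" by linarith+
    define b where "b = gi p q"
    have zb: "z = (1 + \<i>) * b" unfolding z_def b_def xpq by (simp add: complex_eq_iff)
    have b0: "b \<noteq> 0" using z0 zb by auto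
    have "coprime p q"
    proof (rule coprimeI)
      fix d assume "d dvd p" "d dvd q"
      then have "d dvd int x" "d dvd int y" unfolding xpq by auto
      then show "is_unit d" using xy(3) by (metis coprime_common_divisor coprime_int_iff)
    qed
    moreover have "odd (p + q)" using \<open>odd x \<and> odd y\<close> xpq by (metis even_of_nat)
    ultimately have cop: "gauss_coprime b (cnj b)" unfolding b_def by (rule gauss_coprime_cnj_gi)
    have "(1 - \<i>) / (1 + \<i>) = - \<i>" by (simp add: complex_eq_iff Re_divide Im_divide)
    then have rot: "rot b (- \<i>) = rot z 1" unfolding zb rot_def by (simp add: times_divide_times_eq[symmetric])
    have gb: "gnorm z = 2 * gnorm b"
    proof -
      have "gnorm z = gnorm (1 + \<i>) * gnorm b" unfolding zb by (rule gnorm_mult) (auto simp: b_def)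
      moreover have "gnorm (1 + \<i>) = 2" by (simp add: gnorm_def cmod_power2)
      ultimately show ?thesis by simp
    qed
    show ?thesis
    proof (cases "e = 1")
      case True
      then have "n = 2 * m * g\<^sup>2 * gnorm b" using N[folded gz, unfolded gb] by simp
      then show ?thesis using cop b0 rot by (intro fin[of b "- \<i>" 2 g]) (auto simp: b_def gauss_units_def)
    next
      case False
      then have e2: "e = 2" using t by auto
      have "n = 1 * m * g\<^sup>2 * gnorm b" using N[folded gz, unfolded gb] e2 by simp
      then show ?thesis using cop b0 rot by (intro fin[of b "- \<i>" 1 g]) (auto simp: b_def gauss_units_def)
    qed
  qed
qed

lemma squarefree_times_square_eq:
  fixes a b x y :: nat
  assumes "squarefree a" "squarefree b" "a * x\<^sup>2 = b * y\<^sup>2" "x > 0" "y > 0"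
  shows "a = b \<and> x = y"
proof -
  have ne: "a \<noteq> 0" "b \<noteq> 0" using assms(1,2) by (auto intro!: Nat.gr0I)
  have dvd: "a dvd b" if "squarefree a" "a * x\<^sup>2 = b * y\<^sup>2" "a \<noteq> 0" "b \<noteq> 0" "x > 0" "y > 0" for a b x y :: nat
  proof (rule multiplicity_le_imp_dvd)
    show "a \<noteq> 0" by fact
    fix p :: nat assume p: "prime p"
    have "multiplicity p a \<le> 1" using that(1,3) p by (simp add: squarefree_factorial_semiring'')
    have "multiplicity p (a * x\<^sup>2) = multiplicity p a + 2 * multiplicity p x"
      using p that(3-6) by (simp add: prime_elem_multiplicity_mult_distrib prime_elem_multiplicity_power_distrib)
    moreover have "multiplicity p (b * y\<^sup>2) = multiplicity p b + 2 * multiplicity p y"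
      using p that(3-6) by (simp add: prime_elem_multiplicity_mult_distrib prime_elem_multiplicity_power_distrib)
    ultimately have "multiplicity p a + 2 * multiplicity p x = multiplicity p b + 2 * multiplicity p y"
      using that by simp
    then show "multiplicity p a \<le> multiplicity p b" using \<open>multiplicity p a \<le> 1\<close> by presburger
  qed
  have "a dvd b" by (rule dvd[OF assms(1,3) ne assms(4,5)])
  moreover have "b dvd a" by (rule dvd[OF assms(2) assms(3)[symmetric] ne(2,1) assms(5,4)])
  ultimately have "a = b" by (rule dvd_antisym)
  then show ?thesis using assms ne by simp
qed

lemma squarefree_e_m: "m \<in> G4 \<Longrightarrow> e \<in> {1,2} \<Longrightarrow> squarefree (e * m)"
  using G4_odd[of m] G4_squarefree[of m]
  by (auto intro!: squarefree_mult_coprime simp: squarefree_prime)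

lemma Tset_inj:
  assumes T: "(e1, m1, X1, Y1) \<in> Tset n" "(e2, m2, X2, Y2) \<in> Tset n" and n: "n \<ge> 1"
    and r: "ratio X1 Y1 = ratio X2 Y2"
  shows "(e1, m1, X1, Y1) = (e2, m2, X2, Y2)"
proof -
  have t1: "e1 \<in> {1,2}" "m1 \<in> G4" "Y1 \<ge> 1" using T unfolding Tset_def by auto
  have t2: "e2 \<in> {1,2}" "m2 \<in> G4" "Y2 \<ge> 1" using T unfolding Tset_def by auto
  have e0: "real e1 > 0" "real e2 > 0" using t1 t2 by auto
  have "4 * real m1 * (real Y1)\<^sup>2 / real e1 = 4 * real m2 * (real Y2)\<^sup>2 / real e2"
    unfolding ratio_dist[OF T(1), symmetric] ratio_dist[OF T(2), symmetric] r ..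
  then have "real (e2 * m1 * Y1\<^sup>2) = real (e1 * m2 * Y2\<^sup>2)" using e0 by (simp add: field_simps)
  then have "e2 * m1 * Y1\<^sup>2 = e1 * m2 * Y2\<^sup>2" by linarith
  then have eq: "e2 * m1 = e1 * m2 \<and> Y1 = Y2"
    using squarefree_e_m t1 t2 by (intro squarefree_times_square_eq) auto
  have "odd m1" "odd m2" using G4_odd t1 t2 by auto
  then have e: "e1 = e2" using eq t1(1) t2(1) by auto
  then have m: "m1 = m2" using eq e0 by auto
  have "m1 * (X1\<^sup>2 + Y1\<^sup>2) = m2 * (X2\<^sup>2 + Y2\<^sup>2)" using T e unfolding Tset_def by auto
  then have "X1\<^sup>2 = X2\<^sup>2" using m eq G4_pos[OF t1(2)] by simp
  then show ?thesis using e m eq by simp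
qed

definition TTset :: "nat \<Rightarrow> real \<Rightarrow> (nat \<times> nat \<times> nat \<times> nat) set" where
  "TTset n M = {(e, m, X, Y). (e, m, X, Y) \<in> Tset n \<and> 4 * real m * (real Y)\<^sup>2 \<le> real e * M\<^sup>2}"

lemma card_Rset:
  assumes n: "n \<ge> 1" and M: "M > 0"
  shows "card (Rset n M) = card (TTset n M)"
proof -
  have "Rset n M = (\<lambda>(e, m, X, Y). ratio X Y) ` TTset n M"
  proof (intro equalityI subsetI)
    fix r assume r: "r \<in> Rset n M"
    obtain e m X Y where T: "(e, m, X, Y) \<in> Tset n" "r = ratio X Y" using Rset_subset_ratio[OF n r] by blast
    obtain a b u where S: "(a, b, u) \<in> S_set n M" "r = Re (rot b u)" using r unfolding Rset_def rot_re_def by auto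
    have e0: "real e > 0" using T unfolding Tset_def by auto
    have "4 * real m * (real Y)\<^sup>2 / real e \<le> M\<^sup>2"
      using S_setD(9)[OF S(1) n] ratio_dist[OF T(1)] S(2) T(2) by simp
    then have "4 * real m * (real Y)\<^sup>2 \<le> real e * M\<^sup>2" using e0 by (simp add: pos_divide_le_eq mult.commute)
    then show "r \<in> (\<lambda>(e, m, X, Y). ratio X Y) ` TTset n M" using T unfolding TTset_def by force
  next
    fix r assume "r \<in> (\<lambda>(e, m, X, Y). ratio X Y) ` TTset n M"
    then show "r \<in> Rset n M" unfolding TTset_def using ratio_in_Rset[OF n _ _ M] by auto
  qed
  moreover have "inj_on (\<lambda>(e, m, X, Y). ratio X Y) (TTset n M)"
  proof (rule inj_onI)
    fix s t assume st: "s \<in> TTset n M" "t \<in> TTset n M"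
      "(case s of (e, m, X, Y) \<Rightarrow> ratio X Y) = (case t of (e, m, X, Y) \<Rightarrow> ratio X Y)"
    obtain e1 m1 X1 Y1 where s: "s = (e1, m1, X1, Y1)" by (cases s)
    obtain e2 m2 X2 Y2 where t: "t = (e2, m2, X2, Y2)" by (cases t)
    show "s = t" unfolding s t using st n unfolding s t TTset_def by (intro Tset_inj[of _ _ _ _ n]) auto
  qed
  ultimately show ?thesis by (simp add: card_image)
qed

lemma sum_card_A_family:
  assumes M: "0 < M" "M \<le> 2 * sqrt N"
  shows "(\<Sum>n | 1 \<le> n \<and> real n \<le> N. real (card (A_family n M)))
    = (\<Sum>e\<in>{1,2}. \<Sum>m | m \<in> G4 \<and> real m \<le> real e * M\<^sup>2 / 4. real (card (Qset e m N M)))"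
proof -
  define D where "D = {n. 1 \<le> n \<and> real n \<le> N}"
  define U where "U = (SIGMA e:{1,2::nat}. SIGMA m:{m. m \<in> G4 \<and> real m \<le> real e * M\<^sup>2 / 4}. Qset e m N M)"
  have finQ: "finite (Qset e m N M)" if "e \<in> {1,2}" "m \<in> G4" for e m
    using that G4_pos[of m] M by (intro finite_Qset) auto
  have finU: "finite U" unfolding U_def by (intro finite_SigmaI finQ finite_nat_le_real) auto
  have finD: "finite D" unfolding D_def by (rule finite_nat_le_real)
  have U: "U = (\<Union>n\<in>D. TTset n M)"
  proof (intro equalityI subsetI)
    fix t assume t: "t \<in> U"
    obtain e m X Y where tt: "t = (e, m, X, Y)" by (cases t)
    have c: "e \<in> {1,2}" "m \<in> G4" "1 \<le> Y" "par e X Y" "real m * ((real X)\<^sup>2 + (real Y)\<^sup>2) \<le> real e * N"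
      "4 * real m * (real Y)\<^sup>2 \<le> real e * M\<^sup>2" using t unfolding tt U_def Qset_def by auto
    have "e dvd m * (X\<^sup>2 + Y\<^sup>2)" using c(1,4) by (auto simp: par_def)
    then obtain n where n: "m * (X\<^sup>2 + Y\<^sup>2) = e * n" by (elim dvdE)
    have "real (e * n) \<le> real e * N" using c(5) unfolding n[symmetric] by simp
    then have "real n \<le> N" using c(1) by auto
    moreover have "n \<ge> 1"
    proof (rule ccontr)
      assume "\<not> n \<ge> 1"
      then have "m * (X\<^sup>2 + Y\<^sup>2) = 0" using n by simp
      then show False using c(3) G4_pos[OF c(2)] by simp
    qed
    ultimately show "t \<in> (\<Union>n\<in>D. TTset n M)" using c n unfolding tt D_def TTset_def Tset_def by auto
  next
    fix t assume "t \<in> (\<Union>n\<in>D. TTset n M)"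
    then obtain n e m X Y where tt: "t = (e, m, X, Y)" "n \<in> D" "(e, m, X, Y) \<in> TTset n M" by (metis UN_E prod_cases4)
    have c: "e \<in> {1,2}" "m \<in> G4" "1 \<le> Y" "par e X Y" "m * (X\<^sup>2 + Y\<^sup>2) = e * n"
      "4 * real m * (real Y)\<^sup>2 \<le> real e * M\<^sup>2" using tt unfolding TTset_def Tset_def by auto
    have "real m * ((real X)\<^sup>2 + (real Y)\<^sup>2) = real (m * (X\<^sup>2 + Y\<^sup>2))" by simp
    also have "\<dots> = real e * real n" unfolding c(5) by simp
    also have "\<dots> \<le> real e * N" using tt(2) unfolding D_def by (intro mult_left_mono) auto
    finally have "(X, Y) \<in> Qset e m N M" unfolding Qset_def using c by auto
    moreover have "real m \<le> real e * M\<^sup>2 / 4"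
    proof -
      have "4 * real m * 1 \<le> 4 * real m * (real Y)\<^sup>2" using c(3) by (intro mult_left_mono) auto
      then show ?thesis using c(6) by simp
    qed
    ultimately show "t \<in> U" unfolding tt U_def using c by auto
  qed
  have disj: "TTset n M \<inter> TTset n' M = {}" if "n \<noteq> n'" for n n'
    using that unfolding TTset_def Tset_def by auto
  have "(\<Sum>n\<in>D. real (card (A_family n M))) = (\<Sum>n\<in>D. real (card (TTset n M)))"
    by (intro sum.cong refl) (auto simp: D_def card_A_family card_Rset M)
  also have "\<dots> = real (card (\<Union>n\<in>D. TTset n M))"
    using finU unfolding U by (subst card_UN_disjoint) (auto simp: finD disj)
  also have "\<dots> = real (card U)" unfolding U ..
  also have "\<dots> = (\<Sum>e\<in>{1,2}. \<Sum>m | m \<in> G4 \<and> real m \<le> real e * M\<^sup>2 / 4. real (card (Qset e m N M)))"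
  proof -
    have "card U = (\<Sum>e\<in>{1,2}. card (SIGMA m:{m. m \<in> G4 \<and> real m \<le> real e * M\<^sup>2 / 4}. Qset e m N M))"
      unfolding U_def
      by (rule card_SigmaI) (simp, intro ballI finite_SigmaI finQ finite_nat_le_real, auto)
    also have "\<dots> = (\<Sum>e\<in>{1,2}. \<Sum>m | m \<in> G4 \<and> real m \<le> real e * M\<^sup>2 / 4. card (Qset e m N M))"
      by (intro sum.cong refl card_SigmaI finite_nat_le_real) (auto intro!: finQ)
    finally show ?thesis by simp
  qed
  finally show ?thesis unfolding D_def .
qed

lemma sum_card_A_family_asymptotic:
  "\<exists>(E :: real \<Rightarrow> real \<Rightarrow> real) (C :: real) (N0 :: real).
        \<forall>N M :: real. N \<ge> N0 \<longrightarrow> 1 \<le> M \<longrightarrow> M \<le> 2 * sqrt N \<longrightarrow>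
          \<bar>E N M\<bar> \<le> C \<and>
          (\<Sum>n | 1 \<le> n \<and> real n \<le> N. real (card (A_family n M))) =
            kappa' / 2 * I_fun (M\<^sup>2 / (4 * N)) * M * sqrt N * (sqrt (2 * ln M) + E N M)"
proof -
  obtain K where K: "\<And>N M. 1 \<le> M \<Longrightarrow> M \<le> 2 * sqrt N \<Longrightarrow>
    \<bar>(\<Sum>e\<in>{1,2}. \<Sum>m | m \<in> G4 \<and> real m \<le> real e * M\<^sup>2 / 4. real (card (Qset e m N M)))
      - kappa' / 2 * I_fun (M\<^sup>2 / (4 * N)) * M * sqrt N * sqrt (2 * ln M)\<bar> \<le> K * (M * sqrt N)"
    using Qset_total by blast
  define S where "S N M = (\<Sum>n | 1 \<le> n \<and> real n \<le> N. real (card (A_family n M)))" for N M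
  define A where "A N M = kappa' / 2 * I_fun (M\<^sup>2 / (4 * N)) * M * sqrt N" for N M
  define E where "E N M = S N M / A N M - sqrt (2 * ln M)" for N M
  have main: "\<bar>E N M\<bar> \<le> K * pi / kappa' \<and> S N M = A N M * (sqrt (2 * ln M) + E N M)"
    if M: "1 \<le> M" "M \<le> 2 * sqrt N" for N M
  proof -
    have N: "N > 0"
    proof -
      have "sqrt N > 0" using M by linarith
      then show ?thesis by simp
    qed
    define c where "c = M\<^sup>2 / (4 * N)"
    have "M\<^sup>2 \<le> 4 * N" using power_mono[OF M(2), of 2] M N by (simp add: power_mult_distrib)
    then have c: "0 \<le> c" "c \<le> 1" using N by (auto simp: c_def field_simps)
    have MN: "M * sqrt N > 0" using M N by simp
    have "kappa' / 2 * (2 / pi) * (M * sqrt N) \<le> kappa' / 2 * I_fun c * (M * sqrt N)"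
      using I_fun_bounds(1)[OF c] kappa'_pos MN by (intro mult_right_mono mult_left_mono) auto
    then have A_ge: "kappa' / pi * (M * sqrt N) \<le> A N M" by (simp add: A_def c_def mult_ac)
    have "kappa' / pi * (M * sqrt N) > 0" using kappa'_pos MN by simp
    then have A0: "A N M > 0" using A_ge by linarith
    have "\<bar>S N M - A N M * sqrt (2 * ln M)\<bar> \<le> K * (M * sqrt N)"
      using K[OF M] unfolding S_def A_def using sum_card_A_family[of M N] M by simp
    moreover have "S N M - A N M * sqrt (2 * ln M) = A N M * E N M"
      using A0 by (simp add: E_def right_diff_distrib)
    ultimately have le: "A N M * \<bar>E N M\<bar> \<le> K * (M * sqrt N)" using A0 by (simp add: abs_mult)
    have "kappa' / pi * (M * sqrt N) * \<bar>E N M\<bar> \<le> A N M * \<bar>E N M\<bar>" using A_ge by (intro mult_right_mono) auto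
    then have "(M * sqrt N) * (kappa' / pi * \<bar>E N M\<bar>) \<le> (M * sqrt N) * K" using le by (simp add: mult_ac)
    then have "kappa' / pi * \<bar>E N M\<bar> \<le> K" by (rule mult_left_le_imp_le) (rule MN)
    then have "\<bar>E N M\<bar> \<le> K * pi / kappa'" using kappa'_pos by (simp add: field_simps)
    moreover have "S N M = A N M * (sqrt (2 * ln M) + E N M)" using A0 by (simp add: E_def)
    ultimately show ?thesis by blast
  qed
  show ?thesis
    by (rule exI[of _ E], rule exI[of _ "K * pi / kappa'"], rule exI[of _ 0])
       (use main in \<open>auto simp: S_def A_def\<close>)
qed

section \<open>Gaussian integers in thin sectors\<close>

definition phi :: "complex \<Rightarrow> complex" where "phi z = cnj z / z"

lemma phi_mult: "phi (x * y) = phi x * phi y" by (simp add: phi_def)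

lemma phi_cnj: "phi (cnj x) = cnj (phi x)" by (simp add: phi_def)

lemma cmod_phi: "x \<noteq> 0 \<Longrightarrow> cmod (phi x) = 1" by (simp add: phi_def norm_divide)

lemma rot_phi: "rot b u = u * phi b" by (simp add: rot_def phi_def)

definition prim :: "complex \<Rightarrow> bool" where "prim z \<longleftrightarrow> (\<exists>a b. z = gi a b \<and> coprime a b)"

lemma prim_gauss: "prim z \<Longrightarrow> z \<in> gauss_ints" by (auto simp: prim_def)

lemma prim_nonzero: "prim z \<Longrightarrow> z \<noteq> 0"
  by (auto simp: prim_def complex_eq_iff)

lemma prim_of_dvd:
  assumes b: "gauss_coprime b (cnj b)" and z: "z \<in> gauss_ints" "gauss_dvd z b"
  shows "prim z"
proof -
  obtain x y where xy: "z = gi x y" using z by (elim gauss_intsE)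
  have "coprime x y"
  proof (rule coprimeI)
    fix d assume "d dvd x" "d dvd y"
    then obtain p q where pq: "x = d * p" "y = d * q" by (elim dvdE)
    have "z = of_int d * gi p q" unfolding xy pq by (simp add: complex_eq_iff)
    then have "gauss_dvd (of_int d) z" unfolding gauss_dvd_def by (intro bexI[of _ "gi p q"]) auto
    then have db: "gauss_dvd (of_int d) b" using z gauss_dvd_trans by blast
    then have "gauss_dvd (of_int d) (cnj b)" using gauss_dvd_cnj[OF db] by simp
    then have "of_int d \<in> gauss_units" using b db unfolding gauss_coprime_def by auto
    then have "cmod (of_int d) = 1" using gauss_units_props by blast
    then have "\<bar>d\<bar> = 1" by simp
    then show "is_unit d" by simp
  qed
  then show ?thesis unfolding prim_def using xy by blast
qed

lemma gnorm_ball: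
  assumes Z: "Z \<ge> (1::real)"
  shows "finite {z. z \<in> gauss_ints \<and> real (gnorm z) < 2 * Z}"
    "real (card {z. z \<in> gauss_ints \<and> real (gnorm z) < 2 * Z}) \<le> 16 * Z"
proof -
  define k where "k = \<lfloor>sqrt (2 * Z)\<rfloor>"
  have k0: "k \<ge> 0" using Z by (simp add: k_def)
  have sub: "{z. z \<in> gauss_ints \<and> real (gnorm z) < 2 * Z} \<subseteq> (\<lambda>(x,y). gi x y) ` ({-k..k} \<times> {-k..k})"
  proof
    fix z assume z: "z \<in> {z. z \<in> gauss_ints \<and> real (gnorm z) < 2 * Z}"
    then obtain x y where xy: "z = gi x y" by (auto elim: gauss_intsE)
    have "real (gnorm z) = real_of_int (int (gnorm z))" by simp
    also have "\<dots> = (real_of_int x)\<^sup>2 + (real_of_int y)\<^sup>2" unfolding xy gnorm_gi by simp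
    finally have n: "(real_of_int x)\<^sup>2 + (real_of_int y)\<^sup>2 < 2 * Z" using z by simp
    have "\<bar>c\<bar> \<le> k" if "(real_of_int c)\<^sup>2 \<le> 2 * Z" for c
    proof -
      have "\<bar>real_of_int c\<bar> \<le> sqrt (2 * Z)" using that by (simp add: real_le_rsqrt)
      then have "real_of_int \<bar>c\<bar> \<le> sqrt (2 * Z)" by simp
      then show ?thesis unfolding k_def by (simp only: le_floor_iff)
    qed
    moreover have "(real_of_int x)\<^sup>2 \<le> 2 * Z" "(real_of_int y)\<^sup>2 \<le> 2 * Z"
      using n zero_le_power2[of "real_of_int x"] zero_le_power2[of "real_of_int y"] by linarith+
    ultimately have "\<bar>x\<bar> \<le> k" "\<bar>y\<bar> \<le> k" by auto
    then show "z \<in> (\<lambda>(x,y). gi x y) ` ({-k..k} \<times> {-k..k})" unfolding xy by force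
  qed
  then show "finite {z. z \<in> gauss_ints \<and> real (gnorm z) < 2 * Z}" by (rule finite_subset) auto
  have "card {z. z \<in> gauss_ints \<and> real (gnorm z) < 2 * Z} \<le> card ((\<lambda>(x,y). gi x y) ` ({-k..k} \<times> {-k..k}))"
    by (intro card_mono sub) auto
  also have "\<dots> \<le> card ({-k..k} \<times> {-k..k})" by (rule card_image_le) auto
  also have "\<dots> = nat (2 * k + 1) * nat (2 * k + 1)" by (simp add: card_cartesian_product)
  finally have "real (card {z. z \<in> gauss_ints \<and> real (gnorm z) < 2 * Z}) \<le> real (nat (2 * k + 1) * nat (2 * k + 1))"
    by (rule of_nat_mono)
  also have "\<dots> = (2 * real_of_int k + 1)\<^sup>2" using k0 by (simp add: power2_eq_square)
  also have "\<dots> \<le> (4 * sqrt Z)\<^sup>2"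
  proof (intro power_mono)
    have "real_of_int k \<le> sqrt (2 * Z)" unfolding k_def by simp
    also have "\<dots> = sqrt 2 * sqrt Z" by (simp add: real_sqrt_mult)
    also have "\<dots> \<le> 3 / 2 * sqrt Z"
    proof (intro mult_right_mono)
      show "sqrt 2 \<le> 3 / 2" by (rule real_le_lsqrt) (auto simp: power2_eq_square)
    qed (use Z in auto)
    finally have "real_of_int k \<le> 3 / 2 * sqrt Z" .
    moreover have "1 \<le> sqrt Z" using Z by simp
    ultimately show "2 * real_of_int k + 1 \<le> 4 * sqrt Z" by linarith
  qed (use k0 in auto)
  also have "\<dots> = 16 * Z" using Z by (simp add: power_mult_distrib)
  finally show "real (card {z. z \<in> gauss_ints \<and> real (gnorm z) < 2 * Z}) \<le> 16 * Z" .
qed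

lemma line_count:
  assumes z0: "coprime a b" "Z \<le> real (gnorm (gi a b))" and Z: "Z > 0"
    and S: "\<And>w. w \<in> S \<Longrightarrow> w \<in> gauss_ints \<and> real (gnorm w) < 2 * Z"
      "\<And>x y. gi x y \<in> S \<Longrightarrow> a * y - b * x = h"
  shows "card S \<le> 5"
proof (cases "S = {}")
  case False
  then obtain w' where w': "w' \<in> S" by auto
  obtain x' y' where xy': "w' = gi x' y'" using S(1)[OF w'] by (auto elim: gauss_intsE)
  have "S \<subseteq> (\<lambda>t. w' + of_int t * gi a b) ` {-2..2}"
  proof
    fix w assume w: "w \<in> S"
    obtain x y where xy: "w = gi x y" using S(1)[OF w] by (auto elim: gauss_intsE)
    have "a * y - b * x = a * y' - b * x'" using S(2)[of x y] S(2)[of x' y'] w w' xy xy' by simp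
    then have eq: "a * (y - y') = b * (x - x')" by (simp add: algebra_simps)
    obtain t where t: "x - x' = a * t" "y - y' = b * t"
    proof (cases "a = 0")
      case True
      then have "\<bar>b\<bar> = 1" using z0(1) by simp
      then have bb: "b * b = 1" by (auto simp: abs_if split: if_splits)
      have "x - x' = 0" using eq True \<open>\<bar>b\<bar> = 1\<close> by auto
      moreover have "y - y' = b * (b * (y - y'))" using bb by (simp add: mult.assoc[symmetric])
      ultimately show ?thesis using that[of "b * (y - y')"] True by simp
    next
      case False
      have "a dvd b * (x - x')" using eq by (metis dvd_triv_left)
      then have "a dvd x - x'" using z0(1) by (simp add: coprime_dvd_mult_right_iff)
      then obtain t where t: "x - x' = a * t" by (elim dvdE)
      then have "a * (y - y') = a * (b * t)" using eq by (simp add: mult_ac)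
      then show ?thesis using that[of t] t False by simp
    qed
    have wt: "w = w' + of_int t * gi a b" unfolding xy xy'
      using t by (simp add: complex_eq_iff algebra_simps flip: of_int_mult of_int_add)
    have "cmod (of_int t * gi a b) = cmod (w - w')" unfolding wt by simp
    also have "\<dots> \<le> cmod w + cmod w'" by (rule norm_triangle_ineq4)
    also have "\<dots> < sqrt (2 * Z) + sqrt (2 * Z)"
    proof -
      have "cmod v < sqrt (2 * Z)" if "v \<in> S" for v
      proof -
        have "(cmod v)\<^sup>2 < 2 * Z" using S(1)[OF that] real_gnorm[of v] by simp
        then show ?thesis by (rule real_less_rsqrt)
      qed
      then show ?thesis using w w' by (intro add_strict_mono) auto
    qed
    finally have "(cmod (of_int t * gi a b))\<^sup>2 < (2 * sqrt (2 * Z))\<^sup>2" by (intro power_strict_mono) auto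
    then have "(real_of_int t)\<^sup>2 * real (gnorm (gi a b)) < 8 * Z"
      using Z by (simp add: norm_mult power_mult_distrib real_gnorm)
    moreover have "(real_of_int t)\<^sup>2 * Z \<le> (real_of_int t)\<^sup>2 * real (gnorm (gi a b))"
      using z0(2) by (intro mult_left_mono) auto
    ultimately have "(real_of_int t)\<^sup>2 * Z < 8 * Z" by linarith
    then have "(real_of_int t)\<^sup>2 < 8" using Z by simp
    then have "\<bar>real_of_int t\<bar> < 3" by (intro power2_less_imp_less[of "\<bar>real_of_int t\<bar>" 3]) auto
    then have "t \<in> {-2..2}" by auto
    then show "w \<in> (\<lambda>t. w' + of_int t * gi a b) ` {-2..2}" using wt by blast
  qed
  then have "card S \<le> card ((\<lambda>t::int. w' + of_int t * gi a b) ` {-2..2})" by (intro card_mono) auto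
  also have "\<dots> \<le> card {-2..2::int}" by (rule card_image_le) auto
  finally show ?thesis by simp
qed auto

lemma sector_count:
  assumes Z: "Z \<ge> 1" and H: "H \<ge> 0"
    and S: "\<And>w. w \<in> S \<Longrightarrow> prim w \<and> Z \<le> real (gnorm w) \<and> real (gnorm w) < 2 * Z"
    and pair: "\<And>w w'. w \<in> S \<Longrightarrow> w' \<in> S \<Longrightarrow> \<bar>Im (cnj w * w')\<bar> \<le> H"
  shows "real (card S) \<le> 10 * H + 5"
proof (cases "S = {}")
  case False
  then obtain z0 where z0: "z0 \<in> S" by auto
  then obtain a b where ab: "z0 = gi a b" "coprime a b" using S unfolding prim_def by blast
  have SG: "w \<in> gauss_ints \<and> real (gnorm w) < 2 * Z" if "w \<in> S" for w using S[OF that] prim_gauss by blast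
  have finS: "finite S" by (rule finite_subset[OF _ gnorm_ball(1)[OF Z]]) (use SG in auto)
  define h where "h w = \<lfloor>Im (cnj z0 * w)\<rfloor>" for w
  have h_gi: "h (gi x y) = a * y - b * x" for x y
  proof -
    have "Im (cnj z0 * gi x y) = real_of_int (a * y - b * x)" unfolding ab by simp
    then show ?thesis unfolding h_def by (simp only: floor_of_int)
  qed
  define L where "L = \<lfloor>H\<rfloor>"
  have L0: "L \<ge> 0" using H by (simp add: L_def)
  have "S = (\<Union>j\<in>{-L..L}. {w \<in> S. h w = j})"
  proof -
    have "h w \<in> {-L..L}" if w: "w \<in> S" for w
    proof -
      obtain x y where xy: "w = gi x y" using SG[OF w] by (auto elim: gauss_intsE)
      have "Im (cnj z0 * w) = real_of_int (h w)" unfolding xy h_gi ab by simp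
      then have "\<bar>real_of_int (h w)\<bar> \<le> H" using pair[OF z0 w] by simp
      then have "real_of_int \<bar>h w\<bar> \<le> H" by simp
      then have "\<bar>h w\<bar> \<le> L" unfolding L_def by (simp only: le_floor_iff)
      then show ?thesis by auto
    qed
    then show ?thesis by auto
  qed
  then have "card S = card (\<Union>j\<in>{-L..L}. {w \<in> S. h w = j})" by (rule arg_cong)
  also have "\<dots> \<le> (\<Sum>j\<in>{-L..L}. card {w \<in> S. h w = j})" by (rule card_UN_le) auto
  also have "\<dots> \<le> (\<Sum>j\<in>{-L..L}. 5)"
  proof (intro sum_mono line_count[OF ab(2)])
    show "Z \<le> real (gnorm (gi a b))" using S[OF z0] ab by simp
    show "Z > 0" using Z by simp
    show "w \<in> gauss_ints \<and> real (gnorm w) < 2 * Z" if "w \<in> {w \<in> S. h w = j}" for w j using that SG by auto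
    show "a * y - b * x = j" if "gi x y \<in> {w \<in> S. h w = j}" for x y j using that h_gi by auto
  qed
  also have "\<dots> = 5 * nat (2 * L + 1)" by simp
  finally have "real (card S) \<le> real (5 * nat (2 * L + 1))" by (rule of_nat_mono)
  also have "\<dots> = 5 * (2 * real_of_int L + 1)" using L0 by simp
  also have "\<dots> \<le> 10 * H + 5"
  proof -
    have "real_of_int L \<le> H" unfolding L_def by simp
    then show ?thesis by simp
  qed
  finally show ?thesis .
qed (use H in auto)

lemma phi_sector:
  assumes Z: "Z \<ge> 1" and h: "h \<ge> 0"
    and S: "\<And>w. w \<in> S \<Longrightarrow> prim w \<and> Z \<le> real (gnorm w) \<and> real (gnorm w) < 2 * Z"
    and near: "\<And>w. w \<in> S \<Longrightarrow> cmod (phi w - v) \<le> h"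
  shows "real (card S) \<le> 20 * (h * Z) + 5"
proof -
  have "real (card S) \<le> 10 * (2 * h * Z) + 5"
  proof (rule sector_count[OF Z _ S])
    show "0 \<le> 2 * h * Z" using Z h by simp
    fix w w' assume w: "w \<in> S" "w' \<in> S"
    have nz: "w \<noteq> 0" "w' \<noteq> 0" using S w prim_nonzero by auto
    have "phi w - phi w' = (phi w - v) - (phi w' - v)" by simp
    then have "cmod (phi w - phi w') \<le> cmod (phi w - v) + cmod (phi w' - v)" by (metis norm_triangle_ineq4)
    also have "\<dots> \<le> 2 * h" using near[OF w(1)] near[OF w(2)] by linarith
    finally have d: "cmod (phi w - phi w') \<le> 2 * h" .
    have "cnj w * w' - cnj w' * w = (phi w - phi w') * (w * w')"
      using nz by (simp add: phi_def field_simps)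
    moreover have "cnj w * w' - cnj w' * w = 2 * \<i> * of_real (Im (cnj w * w'))"
      by (simp add: complex_eq_iff)
    ultimately have "cmod (2 * \<i> * of_real (Im (cnj w * w'))) = cmod (phi w - phi w') * (cmod w * cmod w')"
      by (metis norm_mult)
    moreover have "cmod (2 * \<i> * of_real t) = 2 * \<bar>t\<bar>" for t by (simp add: norm_mult)
    ultimately have "2 * \<bar>Im (cnj w * w')\<bar> = cmod (phi w - phi w') * (cmod w * cmod w')" by (simp only:)
    also have "\<dots> \<le> 2 * h * (2 * Z)"
    proof (rule mult_mono[OF d])
      have sq: "cmod x \<le> sqrt (2 * Z)" if "x \<in> S" for x
      proof -
        have "(cmod x)\<^sup>2 \<le> 2 * Z" using S[OF that] real_gnorm[of x] prim_gauss by force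
        then show ?thesis by (rule real_le_rsqrt)
      qed
      have "cmod w * cmod w' \<le> sqrt (2 * Z) * sqrt (2 * Z)" using w sq Z by (intro mult_mono) auto
      then show "cmod w * cmod w' \<le> 2 * Z" using Z by simp
    qed (use h in auto)
    finally show "\<bar>Im (cnj w * w')\<bar> \<le> 2 * h * Z" by (simp add: mult_ac)
  qed
  then show ?thesis by simp
qed

lemma phi_power_sector:
  assumes Z: "Z \<ge> 1" and h: "h \<ge> 0" and e: "e \<in> {1,2::nat}" and c: "cmod c = 1"
    and S: "\<And>w. w \<in> S \<Longrightarrow> prim w \<and> Z \<le> real (gnorm w) \<and> real (gnorm w) < 2 * Z"
    and near: "\<And>w. w \<in> S \<Longrightarrow> cmod (phi w ^ e * c - 1) \<le> h"
  shows "real (card S) \<le> 40 * (h * Z) + 10"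
proof -
  have cc: "cnj c * c = 1" using c by (metis complex_norm_square mult.commute of_real_1 power_one)
  have near': "cmod (phi w ^ e - cnj c) \<le> h" if "w \<in> S" for w
  proof -
    have "phi w ^ e - cnj c = cnj c * (phi w ^ e * c - 1)" using cc by (simp add: algebra_simps)
    then have "cmod (phi w ^ e - cnj c) = cmod (phi w ^ e * c - 1)" using c by (simp add: norm_mult)
    then show ?thesis using near[OF that] by simp
  qed
  have hZ: "0 \<le> h * Z" using h Z by simp
  show ?thesis
  proof (cases "e = 1")
    case True
    then have "real (card S) \<le> 20 * (h * Z) + 5" using near' by (intro phi_sector[OF Z h S]) auto
    then show ?thesis using hZ by linarith
  next
    case False
    then have e2: "e = 2" using e by auto
    define v where "v = csqrt (cnj c)"
    have v2: "v\<^sup>2 = cnj c" by (simp add: v_def)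
    have "(cmod v)\<^sup>2 = 1\<^sup>2" using v2 c by (simp add: norm_power[symmetric])
    then have v1: "cmod v = 1" by (metis norm_ge_zero power2_eq_iff_nonneg zero_le_one)
    define A where "A = {w \<in> S. cmod (phi w - v) \<le> h}"
    define B where "B = {w \<in> S. cmod (phi w - (- v)) \<le> h}"
    have "S \<subseteq> A \<union> B"
    proof
      fix w assume w: "w \<in> S"
      have "(phi w)\<^sup>2 - v\<^sup>2 = (phi w - v) * (phi w - (- v))" by (simp add: power2_eq_square algebra_simps)
      then have p: "cmod (phi w - v) * cmod (phi w - (- v)) \<le> h"
        using near'[OF w] unfolding e2 v2[symmetric] by (simp add: norm_mult)
      have "2 * v = (phi w - (- v)) - (phi w - v)" by simp
      then have "cmod (2 * v) \<le> cmod (phi w - (- v)) + cmod (phi w - v)" by (metis norm_triangle_ineq4)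
      then have "2 \<le> cmod (phi w - (- v)) + cmod (phi w - v)" using v1 by (simp add: norm_mult)
      then consider "1 \<le> cmod (phi w - (- v))" | "1 \<le> cmod (phi w - v)" by linarith
      then show "w \<in> A \<union> B"
      proof cases
        case 1
        then have "cmod (phi w - v) * 1 \<le> cmod (phi w - v) * cmod (phi w - (- v))" by (intro mult_left_mono) auto
        then show ?thesis using p w by (simp add: A_def)
      next
        case 2
        then have "1 * cmod (phi w - (- v)) \<le> cmod (phi w - v) * cmod (phi w - (- v))" by (intro mult_right_mono) auto
        then show ?thesis using p w by (simp add: B_def)
      qed
    qed
    moreover have "finite S"
      by (rule finite_subset[OF _ gnorm_ball(1)[OF Z]]) (use S prim_gauss in auto)
    then have "finite (A \<union> B)" by (simp add: A_def B_def)
    ultimately have "card S \<le> card (A \<union> B)" by (intro card_mono)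
    also have "\<dots> \<le> card A + card B" by (rule card_Un_le)
    finally have "real (card S) \<le> real (card A) + real (card B)" by linarith
    moreover have "real (card A) \<le> 20 * (h * Z) + 5" "real (card B) \<le> 20 * (h * Z) + 5"
    proof -
      show "real (card A) \<le> 20 * (h * Z) + 5"
        by (rule phi_sector[OF Z h, of _ v]) (use S in \<open>auto simp: A_def\<close>)
      show "real (card B) \<le> 20 * (h * Z) + 5"
        by (rule phi_sector[OF Z h, of _ "- v"]) (use S in \<open>auto simp: B_def\<close>)
    qed
    ultimately show ?thesis by linarith
  qed
qed

lemma sigma_card_le:
  assumes "finite X" "\<And>x. x \<in> X \<Longrightarrow> finite (Y x)" "\<And>x. x \<in> X \<Longrightarrow> real (card (Y x)) \<le> m"
  shows "real (card (Sigma X Y)) \<le> real (card X) * m"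
proof -
  have "real (card (Sigma X Y)) = (\<Sum>x\<in>X. real (card (Y x)))"
    using assms by (subst card_SigmaI) auto
  also have "\<dots> \<le> (\<Sum>x\<in>X. m)" using assms by (intro sum_mono) auto
  finally show ?thesis by simp
qed

lemma fibre_card_le:
  fixes S :: "'s set" and k :: "'s \<Rightarrow> 'k" and a b c d :: "'s \<Rightarrow> complex"
  assumes fin: "finite S" and inj: "inj_on (\<lambda>s. (k s, a s, b s, c s, d s)) S"
    and k: "finite X" "k ` S \<subseteq> X" "real (card X) \<le> x"
    and a: "finite A" "a ` S \<subseteq> A" "real (card A) \<le> na"
    and b: "finite B" "b ` S \<subseteq> B" "real (card B) \<le> nb"
    and c: "\<And>k0 a0 b0. real (card (c ` {s \<in> S. k s = k0 \<and> a s = a0 \<and> b s = b0})) \<le> nc"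
    and d: "\<And>k0 a0 b0. real (card (d ` {s \<in> S. k s = k0 \<and> a s = a0 \<and> b s = b0})) \<le> nd"
  shows "real (card S) \<le> x * na * nb * (nc * nd)"
proof -
  let ?F = "\<lambda>k0 a0 b0. {s \<in> S. k s = k0 \<and> a s = a0 \<and> b s = b0}"
  let ?Y = "\<lambda>(k0, a0, b0). c ` ?F k0 a0 b0 \<times> d ` ?F k0 a0 b0"
  have nn: "nc \<ge> 0" "nd \<ge> 0" "x \<ge> 0" "na \<ge> 0" "nb \<ge> 0"
    using order.trans[OF of_nat_0_le_iff c] order.trans[OF of_nat_0_le_iff d]
      order.trans[OF of_nat_0_le_iff k(3)] order.trans[OF of_nat_0_le_iff a(3)] order.trans[OF of_nat_0_le_iff b(3)] by auto
  have fs: "finite (Sigma (X \<times> A \<times> B) ?Y)" using fin k a b by (intro finite_SigmaI finite_cartesian_product) auto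
  have "card S = card ((\<lambda>s. ((k s, a s, b s), c s, d s)) ` S)"
    by (rule card_image[symmetric]) (use inj in \<open>auto simp: inj_on_def\<close>)
  also have "\<dots> \<le> card (Sigma (X \<times> A \<times> B) ?Y)"
  proof (rule card_mono[OF fs], rule subsetI)
    fix t assume "t \<in> (\<lambda>s. ((k s, a s, b s), c s, d s)) ` S"
    then obtain s where s: "s \<in> S" "t = ((k s, a s, b s), c s, d s)" by auto
    then have "k s \<in> X" "a s \<in> A" "b s \<in> B" using k(2) a(2) b(2) by auto
    moreover have "s \<in> ?F (k s) (a s) (b s)" using s by simp
    ultimately show "t \<in> Sigma (X \<times> A \<times> B) ?Y" unfolding s(2) by blast
  qed
  finally have "real (card S) \<le> real (card (Sigma (X \<times> A \<times> B) ?Y))" by simp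
  also have "\<dots> \<le> real (card (X \<times> A \<times> B)) * (nc * nd)"
  proof (rule sigma_card_le)
    show "finite (X \<times> A \<times> B)" using k a b by simp
    fix t assume "t \<in> X \<times> A \<times> B"
    obtain k0 a0 b0 where t: "t = (k0, a0, b0)" by (cases t)
    show "finite (?Y t)" unfolding t using fin by simp
    have "real (card (?Y t)) = real (card (c ` ?F k0 a0 b0)) * real (card (d ` ?F k0 a0 b0))"
      unfolding t by (simp add: card_cartesian_product)
    also have "\<dots> \<le> nc * nd" by (intro mult_mono c d nn) auto
    finally show "real (card (?Y t)) \<le> nc * nd" .
  qed
  also have "real (card (X \<times> A \<times> B)) = real (card X) * real (card A) * real (card B)"
    by (simp add: card_cartesian_product)
  also have "\<dots> * (nc * nd) \<le> x * na * nb * (nc * nd)"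
    using nn k(3) a(3) b(3) by (intro mult_right_mono mult_mono) auto
  finally show ?thesis .
qed

text \<open>
  Each of the four terms of the expanded product is compared with \<open>Q = N\<^sup>1\<^sup>/\<^sup>3 M\<^sup>4\<^sup>/\<^sup>3\<close> after raising to a
  power that clears the fractional exponents.
\<close>

lemma box_numeric:
  fixes K Z1 Z2 Z3 Z4 M N P Q \<eta> :: real
  assumes P_def: "P = K * Z1 * Z2 * Z3 * Z4" and \<eta>_def: "\<eta> = M / sqrt P"
    and ge1: "K \<ge> 1" "Z1 \<ge> 1" "Z2 \<ge> 1" "Z3 \<ge> 1" "Z4 \<ge> 1"
    and M: "M > 0" "M\<^sup>2 \<le> 4 * N" and PN: "P \<le> N" and Q: "Q \<ge> 0" "Q ^ 3 = N * M ^ 4"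
    and ord: "Z3 \<le> Z1" "Z4 \<le> Z1" "Z3 \<le> Z2" "Z4 \<le> Z2"
    and con: "K * Z1 \<le> 8 * M\<^sup>2 * Z2" "K * Z2 \<le> 8 * M\<^sup>2 * Z1" "K * Z3 \<le> 8 * M\<^sup>2" "K * Z4 \<le> 8 * M\<^sup>2"
  shows "K * Z3 * Z4 * ((\<eta> * Z1 + 1) * (\<eta> * Z2 + 1)) \<le> 10 * Q"
proof -
  have P0: "P > 0" unfolding P_def using ge1 by simp
  have N0: "N > 0" using P0 PN by linarith
  have sP: "sqrt P > 0" "sqrt P * sqrt P = P" using P0 by auto
  have T1: "M\<^sup>2 \<le> 2 * Q"
  proof (rule power_le_imp_le_base[of _ 2])
    have "(M\<^sup>2) ^ Suc 2 = M\<^sup>2 * M ^ 4" by (simp add: eval_nat_numeral)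
    also have "\<dots> \<le> 4 * N * M ^ 4" using M by (intro mult_right_mono) auto
    also have "\<dots> \<le> 8 * (N * M ^ 4)" using N0 by simp
    also have "\<dots> = (2 * Q) ^ Suc 2" using Q(2) by (simp add: power_mult_distrib numeral_3_eq_3)
    finally show "(M\<^sup>2) ^ Suc 2 \<le> (2 * Q) ^ Suc 2" .
  qed (use Q in simp)
  have T2: "M * sqrt P / Z \<le> 2 * Q" if Z: "Z \<ge> 1" "P \<le> 8 * M\<^sup>2 * Z ^ 4" for Z
  proof (rule power_le_imp_le_base[of _ 11])
    have "(M * sqrt P / Z) ^ 4 = M ^ 4 * P\<^sup>2 / Z ^ 4"
      using P0 by (simp add: power_mult_distrib power_divide real_sqrt_power[symmetric] power2_eq_square eval_nat_numeral)
    also have "\<dots> \<le> 8 * M ^ 6 * P"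
    proof -
      have "M ^ 4 * P\<^sup>2 \<le> M ^ 4 * (P * (8 * M\<^sup>2 * Z ^ 4))"
        unfolding power2_eq_square[of P] using Z P0 by (intro mult_left_mono) auto
      also have "\<dots> = 8 * M ^ 6 * P * Z ^ 4" by (simp add: eval_nat_numeral)
      finally show ?thesis using Z by (simp add: pos_divide_le_eq)
    qed
    also have "\<dots> \<le> 8 * M ^ 6 * N" using PN M by (intro mult_left_mono) auto
    finally have "((M * sqrt P / Z) ^ 4) ^ 3 \<le> (8 * M ^ 6 * N) ^ 3"
      using M P0 Z by (intro power_mono) auto
    also have "\<dots> = 512 * N ^ 3 * M ^ 16 * M\<^sup>2" by (simp add: power_mult_distrib flip: power_mult power_add)
    also have "\<dots> \<le> 512 * N ^ 3 * M ^ 16 * (4 * N)" using M N0 by (intro mult_left_mono) auto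
    also have "\<dots> = 2048 * (N * M ^ 4) ^ 4"
      by (simp add: power_mult_distrib eval_nat_numeral)
    also have "\<dots> \<le> 4096 * (N * M ^ 4) ^ 4" using N0 by simp
    also have "\<dots> = (2 * Q) ^ 12" unfolding Q(2)[symmetric] by (simp add: power_mult_distrib flip: power_mult)
    finally show "(M * sqrt P / Z) ^ Suc 11 \<le> (2 * Q) ^ Suc 11" by (simp flip: power_mult)
  qed (use Q in simp)
  have T3: "K * Z3 * Z4 \<le> 4 * Q"
  proof (rule power_le_imp_le_base[of _ 2])
    define t where "t = K * Z3 * Z4"
    have t0: "t > 0" using ge1 by (simp add: t_def)
    have tt: "t * t \<le> K * P"
    proof -
      have "t * t = K * K * Z3 * Z4 * (Z3 * Z4)" by (simp add: t_def)
      also have "\<dots> \<le> K * K * Z3 * Z4 * (Z1 * Z2)" using ge1 ord by (intro mult_left_mono mult_mono) auto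
      also have "\<dots> = K * P" by (simp add: P_def)
      finally show ?thesis .
    qed
    have Kt: "K * t \<le> 64 * M ^ 4"
    proof -
      have "K * t = (K * Z3) * (K * Z4)" by (simp add: t_def)
      also have "\<dots> \<le> (8 * M\<^sup>2) * (8 * M\<^sup>2)" using ge1 by (intro mult_mono[OF con(3,4)]) auto
      also have "\<dots> = 64 * M ^ 4" by (simp add: eval_nat_numeral)
      finally show ?thesis .
    qed
    have "t ^ Suc 2 = t * t * t" by (simp add: eval_nat_numeral)
    also have "\<dots> \<le> K * P * t" using tt t0 by (intro mult_right_mono) auto
    also have "\<dots> = P * (K * t)" by simp
    also have "\<dots> \<le> N * (64 * M ^ 4)" using P0 N0 ge1 t0 by (intro mult_mono[OF PN Kt]) auto
    also have "\<dots> = (4 * Q) ^ Suc 2" using Q(2) by (simp add: power_mult_distrib numeral_3_eq_3)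
    finally show "(K * Z3 * Z4) ^ Suc 2 \<le> (4 * Q) ^ Suc 2" by (simp only: t_def)
  qed (use Q in simp)
  have P1: "P \<le> 8 * M\<^sup>2 * Z2 ^ 4"
  proof -
    have "P = (K * Z1) * (Z2 * (Z3 * Z4))" by (simp add: P_def)
    also have "\<dots> \<le> (8 * M\<^sup>2 * Z2) * (Z2 * (Z2 * Z2))"
      using ord ge1 M by (intro mult_mono[OF con(1)] mult_left_mono mult_mono) auto
    also have "\<dots> = 8 * M\<^sup>2 * Z2 ^ 4" by (simp add: eval_nat_numeral)
    finally show ?thesis .
  qed
  have P2: "P \<le> 8 * M\<^sup>2 * Z1 ^ 4"
  proof -
    have "P = (K * Z2) * (Z1 * (Z3 * Z4))" by (simp add: P_def)
    also have "\<dots> \<le> (8 * M\<^sup>2 * Z1) * (Z1 * (Z1 * Z1))"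
      using ord ge1 M by (intro mult_mono[OF con(2)] mult_left_mono mult_mono) auto
    also have "\<dots> = 8 * M\<^sup>2 * Z1 ^ 4" by (simp add: eval_nat_numeral)
    finally show ?thesis .
  qed
  have eP: "\<eta> * P = M * sqrt P" "\<eta> * \<eta> * P = M\<^sup>2"
    unfolding \<eta>_def using P0 sP by (simp_all add: field_simps power2_eq_square)
  have "K * Z3 * Z4 * ((\<eta> * Z1 + 1) * (\<eta> * Z2 + 1))
     = \<eta> * \<eta> * P + \<eta> * P / Z2 + \<eta> * P / Z1 + K * Z3 * Z4"
    using ge1 unfolding P_def by (simp add: field_simps)
  also have "\<dots> = M\<^sup>2 + M * sqrt P / Z2 + M * sqrt P / Z1 + K * Z3 * Z4" unfolding eP ..
  also have "\<dots> \<le> 10 * Q" using T1 T2[OF ge1(3) P1] T2[OF ge1(2) P2] T3 by linarith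
  finally show ?thesis .
qed

section \<open>Pairs of classes\<close>

lemma rot_separation:
  assumes G: "d \<in> gauss_ints" "x \<in> gauss_ints" "y \<in> gauss_ints" and nz: "d \<noteq> 0" "x \<noteq> 0" "y \<noteq> 0"
    and u: "u \<in> gauss_units" "v \<in> gauss_units" and ne: "rot (d * x) u \<noteq> rot (d * y) v"
    and near: "cmod (1 - rot (d * x) u) \<le> M / sqrt (real n)" "cmod (1 - rot (d * y) v) \<le> M / sqrt (real n)"
    and n: "n \<ge> 1" and M: "M > 0"
  shows "real n \<le> 4 * M\<^sup>2 * (real (gnorm x) * real (gnorm y))"
proof -
  define z where "z = u * cnj x * y - v * cnj y * x"
  have z: "rot (d * x) u - rot (d * y) v = phi d * (z / (x * y))"
    unfolding z_def rot_def phi_def using nz by (simp add: field_simps)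
  have "z \<noteq> 0" using ne z by auto
  moreover have "z \<in> gauss_ints" unfolding z_def using G gauss_units_props u by auto
  ultimately have z1: "cmod z \<ge> 1" by (intro cmod_ge_1)
  have "rot (d * x) u - rot (d * y) v = (1 - rot (d * y) v) - (1 - rot (d * x) u)" by simp
  then have "cmod (rot (d * x) u - rot (d * y) v) \<le> cmod (1 - rot (d * y) v) + cmod (1 - rot (d * x) u)"
    by (metis norm_triangle_ineq4)
  also have "\<dots> \<le> 2 * M / sqrt (real n)" using near by simp
  finally have "cmod z / (cmod x * cmod y) \<le> 2 * M / sqrt (real n)"
    unfolding z using nz by (simp add: norm_mult norm_divide cmod_phi)
  moreover have "1 / (cmod x * cmod y) \<le> cmod z / (cmod x * cmod y)" using z1 by (intro divide_right_mono) auto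
  ultimately have "1 / (cmod x * cmod y) \<le> 2 * M / sqrt (real n)" by linarith
  then have "sqrt (real n) \<le> 2 * M * (cmod x * cmod y)" using nz n by (simp add: field_simps)
  then have "(sqrt (real n))\<^sup>2 \<le> (2 * M * (cmod x * cmod y))\<^sup>2" by (intro power_mono) auto
  then show ?thesis using G by (simp add: power_mult_distrib real_gnorm mult_ac)
qed

lemma gnorm_alpha_le:
  assumes S: "(a, b, u) \<in> S_set n M" and n: "n \<ge> 1"
  shows "real (gnorm a) \<le> M\<^sup>2"
proof -
  note d = S_setD[OF S n]
  have ne: "b - u * cnj b \<noteq> 0" using d(11,6) by (auto simp: rot_def)
  have "b - u * cnj b = b * (1 - rot b u)" using d by (simp add: rot_def algebra_simps)
  then have "cmod (b - u * cnj b) = cmod b * cmod (1 - rot b u)" by (simp add: norm_mult)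
  moreover have "cmod (b - u * cnj b) \<ge> 1" using ne d gauss_units_props by (intro cmod_ge_1) auto
  ultimately have "1 \<le> cmod b * cmod (1 - rot b u)" by simp
  also have "\<dots> \<le> cmod b * (M / sqrt (real n))" using d by (intro mult_left_mono) auto
  finally have "sqrt (real n) \<le> cmod b * M" using n by (simp add: field_simps)
  then have "(sqrt (real n))\<^sup>2 \<le> (cmod b * M)\<^sup>2" by (intro power_mono) auto
  then have "real n \<le> real (gnorm b) * M\<^sup>2" using d by (simp add: power_mult_distrib real_gnorm)
  moreover have "real n = real (gnorm b) * real (gnorm a)" using d(7) by (metis mult.commute of_nat_mult)
  ultimately have "real (gnorm b) * real (gnorm a) \<le> real (gnorm b) * M\<^sup>2" by simp
  then show ?thesis by (rule mult_left_le_imp_le) (use gnorm_pos[OF d(2,6)] in simp)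
qed

text \<open>
  A tuple \<open>(k, u, v, d, e, g, h)\<close> encodes two triples of \<open>S_set n M\<close> with second components
  \<open>d * e * g\<close> and \<open>d * cnj e * h\<close>, units \<open>u\<close> and \<open>v\<close>, and \<open>n\<close> equal to \<open>k\<close> times the norms
  of \<open>d, e, g, h\<close>.
\<close>

type_synonym quad = "nat \<times> complex \<times> complex \<times> complex \<times> complex \<times> complex \<times> complex"

definition pk :: "quad \<Rightarrow> nat" where "pk = (\<lambda>(k, u, v, d, e, g, h). k)"
definition pu :: "quad \<Rightarrow> complex" where "pu = (\<lambda>(k, u, v, d, e, g, h). u)"
definition pv :: "quad \<Rightarrow> complex" where "pv = (\<lambda>(k, u, v, d, e, g, h). v)"
definition pd :: "quad \<Rightarrow> complex" where "pd = (\<lambda>(k, u, v, d, e, g, h). d)"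
definition pe :: "quad \<Rightarrow> complex" where "pe = (\<lambda>(k, u, v, d, e, g, h). e)"
definition pg :: "quad \<Rightarrow> complex" where "pg = (\<lambda>(k, u, v, d, e, g, h). g)"
definition ph :: "quad \<Rightarrow> complex" where "ph = (\<lambda>(k, u, v, d, e, g, h). h)"

lemmas quad_proj = pk_def pu_def pv_def pd_def pe_def pg_def ph_def

lemma quad_eqI:
  assumes "pk s = pk t" "pu s = pu t" "pv s = pv t" "pd s = pd t" "pe s = pe t" "pg s = pg t" "ph s = ph t"
  shows "s = t"
  using assms by (cases s, cases t) (simp add: quad_proj)

definition tn :: "quad \<Rightarrow> nat" where
  "tn s = pk s * gnorm (pd s) * gnorm (pe s) * gnorm (pg s) * gnorm (ph s)"

definition rot1 :: "quad \<Rightarrow> complex" where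
  "rot1 s = pu s * (phi (pd s) * phi (pe s) * phi (pg s))"

definition rot2 :: "quad \<Rightarrow> complex" where
  "rot2 s = pv s * (phi (pd s) * cnj (phi (pe s)) * phi (ph s))"

definition valid :: "real \<Rightarrow> quad \<Rightarrow> bool" where
  "valid M s \<longleftrightarrow> pk s \<ge> 1 \<and> pu s \<in> gauss_units \<and> pv s \<in> gauss_units \<and>
     prim (pd s) \<and> prim (pe s) \<and> prim (pg s) \<and> prim (ph s) \<and>
     cmod (rot1 s - 1) \<le> M / sqrt (real (tn s)) \<and> cmod (rot2 s - 1) \<le> M / sqrt (real (tn s)) \<and>
     real (pk s) * real (gnorm (pg s)) \<le> M\<^sup>2 \<and> real (pk s) * real (gnorm (ph s)) \<le> M\<^sup>2 \<and>
     real (pk s) * real (gnorm (pd s)) \<le> 4 * M\<^sup>2 * real (gnorm (pe s)) \<and>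
     real (pk s) * real (gnorm (pe s)) \<le> 4 * M\<^sup>2 * real (gnorm (pd s))"

lemma coprime_gnorm:
  assumes G: "x \<in> gauss_ints" "y \<in> gauss_ints"
    and p: "p \<in> gauss_ints" "q \<in> gauss_ints" "x * p + y * q = 1"
    and r: "r \<in> gauss_ints" "s \<in> gauss_ints" "x * r + cnj y * s = 1"
  shows "coprime (gnorm x) (gnorm y)"
proof -
  define P where "P = p * (x * r + cnj y * s) + y * q * r"
  define Q where "Q = q * s"
  have PQ: "P \<in> gauss_ints" "Q \<in> gauss_ints" unfolding P_def Q_def using assms by auto
  have "x * P + (y * cnj y) * Q = (x * p + y * q) * (x * r + cnj y * s)"
    unfolding P_def Q_def by (simp add: algebra_simps)
  also have "\<dots> = 1" using p r by simp
  finally have 1: "x * P + of_nat (gnorm y) * Q = 1" using mult_cnj_gnorm[OF G(2)] by simp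
  then have 2: "cnj x * cnj P + of_nat (gnorm y) * cnj Q = 1"
    by (metis complex_cnj_add complex_cnj_mult complex_cnj_of_nat complex_cnj_one)
  define R where "R = P * cnj P"
  define T where "T = Q * (cnj x * cnj P + of_nat (gnorm y) * cnj Q) + x * P * cnj Q"
  have RT: "R \<in> gauss_ints" "T \<in> gauss_ints" unfolding R_def T_def using PQ G by auto
  have "(x * cnj x) * R + of_nat (gnorm y) * T = (x * P + of_nat (gnorm y) * Q) * (cnj x * cnj P + of_nat (gnorm y) * cnj Q)"
    unfolding R_def T_def by (simp add: algebra_simps)
  also have "\<dots> = 1" using 1 2 by simp
  finally have 3: "of_nat (gnorm x) * R + of_nat (gnorm y) * T = 1" using mult_cnj_gnorm[OF G(1)] by simp
  obtain a b where ab: "R = gi a b" using RT by (elim gauss_intsE)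
  obtain c d where cd: "T = gi c d" using RT by (elim gauss_intsE)
  have "Re (of_nat (gnorm x) * R + of_nat (gnorm y) * T) = 1" using 3 by simp
  then have "real_of_int (int (gnorm x) * a + int (gnorm y) * c) = 1" unfolding ab cd by simp
  then have e: "int (gnorm x) * a + int (gnorm y) * c = 1" by linarith
  have "coprime (int (gnorm x)) (int (gnorm y))"
  proof (rule coprimeI)
    fix t assume "t dvd int (gnorm x)" "t dvd int (gnorm y)"
    then have "t dvd int (gnorm x) * a + int (gnorm y) * c" by simp
    then show "is_unit t" unfolding e .
  qed
  then show ?thesis by simp
qed

lemma pair_decomposition:
  assumes n: "n \<ge> 1" and r: "r1 \<in> Rset n M" "r2 \<in> Rset n M" "r1 \<noteq> r2"
  shows "\<exists>s. valid M s \<and> tn s = n \<and> Re (rot1 s) = r1 \<and> Re (rot2 s) = r2"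
proof -
  obtain a1 b1 u1 where S1: "(a1, b1, u1) \<in> S_set n M" "r1 = Re (rot b1 u1)"
    using r(1) unfolding Rset_def rot_re_def by auto
  obtain a2 b2 u2 where S2: "(a2, b2, u2) \<in> S_set n M" "r2 = Re (rot b2 u2)"
    using r(2) unfolding Rset_def rot_re_def by auto
  note d1 = S_setD[OF S1(1) n] and d2 = S_setD[OF S2(1) n]
  obtain d x y where d: "d \<in> gauss_ints" "x \<in> gauss_ints" "y \<in> gauss_ints" "d = b1 * x + b2 * y"
    "gauss_dvd d b1" "gauss_dvd d b2" by (rule gauss_bezout[OF d1(2) d2(2)])
  obtain h1 where h1: "h1 \<in> gauss_ints" "b1 = d * h1" using d(5) unfolding gauss_dvd_def by blast
  obtain h2 where h2: "h2 \<in> gauss_ints" "b2 = d * h2" using d(6) unfolding gauss_dvd_def by blast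
  have d0: "d \<noteq> 0" using h1 d1(6) by auto
  have hb: "h1 * x + h2 * y = 1"
  proof -
    have "d * (h1 * x + h2 * y) = d * 1" using d(4) unfolding h1(2) h2(2) by (simp add: algebra_simps)
    then show ?thesis using d0 by simp
  qed
  have ch2: "cnj h2 \<in> gauss_ints" using h2 by simp
  obtain e x' y' where e: "e \<in> gauss_ints" "x' \<in> gauss_ints" "y' \<in> gauss_ints" "e = h1 * x' + cnj h2 * y'"
    "gauss_dvd e h1" "gauss_dvd e (cnj h2)" by (rule gauss_bezout[OF h1(1) ch2])
  obtain g where g: "g \<in> gauss_ints" "h1 = e * g" using e(5) unfolding gauss_dvd_def by blast
  obtain h' where h': "h' \<in> gauss_ints" "cnj h2 = e * h'" using e(6) unfolding gauss_dvd_def by blast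
  define h where "h = cnj h'"
  have h: "h \<in> gauss_ints" "h2 = cnj e * h" "cnj h = h'"
    using h' unfolding h_def by (auto, metis complex_cnj_cnj complex_cnj_mult)
  have nz: "e \<noteq> 0" "g \<noteq> 0" "h \<noteq> 0" using g h h1(2) h2(2) d1(6) d2(6) by auto
  have gb: "g * x' + cnj h * y' = 1"
  proof -
    have "e * (g * x' + cnj h * y') = e * 1" using e(4) unfolding g(2) h'(2) h(3) by (simp add: algebra_simps)
    then show ?thesis using nz by simp
  qed
  have hb': "g * (e * x) + h * (cnj e * y) = 1" using hb unfolding g(2) h(2) by (simp add: algebra_simps)
  have cop: "coprime (gnorm g) (gnorm h)"
    by (rule coprime_gnorm[OF g(1) h(1) _ _ hb' _ _ gb]) (use e(1-3) d(1-3) in auto)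
  have b1: "b1 = d * e * g" unfolding h1(2) g(2) by simp
  have b2: "b2 = d * cnj e * h" unfolding h2(2) h(2) by simp
  have pos: "gnorm d \<ge> 1" "gnorm e \<ge> 1" "gnorm g \<ge> 1" "gnorm h \<ge> 1" using gnorm_pos d(1) e(1) g(1) h(1) d0 nz by auto
  have n1: "n = gnorm a1 * (gnorm d * gnorm e * gnorm g)" using d1(7) unfolding b1 using d(1) e(1) g(1) by (simp add: gnorm_mult)
  have n2: "n = gnorm a2 * (gnorm d * gnorm e * gnorm h)" using d2(7) unfolding b2 using d(1) e(1) h(1) by (simp add: gnorm_mult gnorm_cnj)
  have "gnorm a1 * (gnorm d * gnorm e * gnorm g) = gnorm a2 * (gnorm d * gnorm e * gnorm h)"
    by (rule trans[OF n1[symmetric] n2])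
  then have "gnorm d * gnorm e * (gnorm a1 * gnorm g) = gnorm d * gnorm e * (gnorm a2 * gnorm h)"
    by (simp only: mult_ac)
  then have ag: "gnorm a1 * gnorm g = gnorm a2 * gnorm h" using pos by simp
  then have "gnorm h dvd gnorm a1 * gnorm g" by simp
  then have "gnorm h dvd gnorm a1" using cop by (metis coprime_commute coprime_dvd_mult_left_iff)
  then obtain k where k: "gnorm a1 = gnorm h * k" by (elim dvdE)
  have "gnorm h * (gnorm g * k) = gnorm h * gnorm a2" using ag unfolding k by (simp add: mult_ac)
  then have k2: "gnorm a2 = gnorm g * k" using pos by simp
  have k1: "k \<ge> 1" using k gnorm_pos[OF d1(1,5)] by (cases k) auto
  define s :: quad where "s = (k, u1, u2, d, e, g, h)"
  have proj: "pk s = k" "pu s = u1" "pv s = u2" "pd s = d" "pe s = e" "pg s = g" "ph s = h"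
    by (simp_all add: s_def quad_proj)
  have ts: "tn s = n" unfolding tn_def proj n1 k by (simp add: mult_ac)
  have r1s: "rot1 s = rot b1 u1" unfolding rot1_def proj rot_phi b1 by (simp add: phi_mult)
  have r2s: "rot2 s = rot b2 u2" unfolding rot2_def proj rot_phi b2 by (simp add: phi_mult phi_cnj)
  have dv: "gauss_dvd z b1" if "b1 = z * w" "w \<in> gauss_ints" for z w using that unfolding gauss_dvd_def by blast
  have dv2: "gauss_dvd z b2" if "b2 = z * w" "w \<in> gauss_ints" for z w using that unfolding gauss_dvd_def by blast
  have pr: "prim d" "prim e" "prim g" "prim h"
  proof -
    show "prim d" by (rule prim_of_dvd[OF d1(4) d(1) dv[of _ "e * g"]]) (use e(1) g(1) in \<open>auto simp: b1 mult_ac\<close>)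
    show "prim e" by (rule prim_of_dvd[OF d1(4) e(1) dv[of _ "d * g"]]) (use d(1) g(1) in \<open>auto simp: b1 mult_ac\<close>)
    show "prim g" by (rule prim_of_dvd[OF d1(4) g(1) dv[of _ "d * e"]]) (use d(1) e(1) in \<open>auto simp: b1 mult_ac\<close>)
    show "prim h" by (rule prim_of_dvd[OF d2(4) h(1) dv2[of _ "d * cnj e"]]) (use d(1) e(1) in \<open>auto simp: b2 mult_ac\<close>)
  qed
  have M: "M > 0" by (rule d1(12))
  have ne1: "rot b1 u1 \<noteq> rot b2 u2" using S1 S2 r(3) by auto
  have ne2: "rot b1 u1 \<noteq> rot (cnj b2) (cnj u2)" using S1 S2 r(3) by (auto simp: rot_cnj)
  have "real n \<le> 4 * M\<^sup>2 * (real (gnorm (e * g)) * real (gnorm (cnj e * h)))"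
    by (rule rot_separation[of d "e * g" "cnj e * h" u1 u2])
       (use d(1) e(1) g(1) h(1) d0 nz d1(3,10) d2(3,10) ne1 n M in \<open>auto simp: b1 b2 mult.assoc\<close>)
  then have q1: "real n \<le> 4 * M\<^sup>2 * (real (gnorm e * gnorm g) * real (gnorm e * gnorm h))"
    using e(1) g(1) h(1) by (simp add: gnorm_mult gnorm_cnj)
  have "real n \<le> 4 * M\<^sup>2 * (real (gnorm (d * g)) * real (gnorm (cnj d * cnj h)))"
  proof (rule rot_separation[of e "d * g" "cnj d * cnj h" u1 "cnj u2"])
    have cb2: "e * (cnj d * cnj h) = cnj b2" unfolding b2 by (simp add: mult_ac)
    have cb1: "e * (d * g) = b1" unfolding b1 by (simp add: mult_ac)
    show "rot (e * (d * g)) u1 \<noteq> rot (e * (cnj d * cnj h)) (cnj u2)" unfolding cb1 cb2 by (rule ne2)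
    show "cmod (1 - rot (e * (d * g)) u1) \<le> M / sqrt (real n)" unfolding cb1 by (rule d1(10))
    have "cmod (1 - rot (cnj b2) (cnj u2)) = cmod (cnj (1 - rot b2 u2))" by (simp add: rot_cnj)
    also have "\<dots> = cmod (1 - rot b2 u2)" by (rule complex_mod_cnj)
    finally show "cmod (1 - rot (e * (cnj d * cnj h)) (cnj u2)) \<le> M / sqrt (real n)" unfolding cb2 using d2(10) by simp
  qed (use d(1) e(1) g(1) h(1) d0 nz d1(3) d2(3) n M gauss_units_props in auto)
  then have q2: "real n \<le> 4 * M\<^sup>2 * (real (gnorm d * gnorm g) * real (gnorm d * gnorm h))"
    using d(1) g(1) h(1) by (simp add: gnorm_mult gnorm_cnj)
  have nn: "real n = real k * real (gnorm d) * real (gnorm e) * real (gnorm g) * real (gnorm h)"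
    using ts unfolding tn_def proj by (metis of_nat_mult)
  have c1: "real k * real (gnorm d) \<le> 4 * M\<^sup>2 * real (gnorm e)"
  proof -
    have "(real (gnorm e) * real (gnorm g) * real (gnorm h)) * (real k * real (gnorm d))
       \<le> (real (gnorm e) * real (gnorm g) * real (gnorm h)) * (4 * M\<^sup>2 * real (gnorm e))"
      using q1 unfolding nn by (simp add: mult_ac)
    then show ?thesis by (rule mult_left_le_imp_le) (use pos in simp)
  qed
  have c2: "real k * real (gnorm e) \<le> 4 * M\<^sup>2 * real (gnorm d)"
  proof -
    have "(real (gnorm d) * real (gnorm g) * real (gnorm h)) * (real k * real (gnorm e))
       \<le> (real (gnorm d) * real (gnorm g) * real (gnorm h)) * (4 * M\<^sup>2 * real (gnorm d))"
      using q2 unfolding nn by (simp add: mult_ac)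
    then show ?thesis by (rule mult_left_le_imp_le) (use pos in simp)
  qed
  have c3: "real k * real (gnorm g) \<le> M\<^sup>2" using gnorm_alpha_le[OF S2(1) n] unfolding k2 by (simp add: mult.commute)
  have c4: "real k * real (gnorm h) \<le> M\<^sup>2" using gnorm_alpha_le[OF S1(1) n] unfolding k by (simp add: mult.commute)
  have "valid M s" unfolding valid_def ts r1s r2s proj
    using k1 d1(3,10) d2(3,10) pr c1 c2 c3 c4 by (simp add: norm_minus_commute)
  then show ?thesis using ts r1s r2s S1(2) S2(2) by (intro exI[of _ s]) simp
qed

definition dyad :: "nat \<Rightarrow> nat \<Rightarrow> bool" where "dyad i m \<longleftrightarrow> 2 ^ i \<le> m \<and> m < 2 ^ Suc i"

lemma dyadE:
  assumes "m \<ge> 1"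
  obtains i where "dyad i m"
  using ex_power_ivl1[of 2 m] assms unfolding dyad_def by auto

lemma dyad_real: "dyad i m \<Longrightarrow> (2::real) ^ i \<le> real m \<and> real m < 2 * 2 ^ i"
  unfolding dyad_def by (metis of_nat_le_iff of_nat_less_iff of_nat_numeral of_nat_power power_Suc)

definition Box :: "real \<Rightarrow> real \<Rightarrow> nat \<times> nat \<times> nat \<times> nat \<times> nat \<Rightarrow> quad set" where
  "Box N M = (\<lambda>(i0, i1, i2, i3, i4). {s. valid M s \<and> real (tn s) \<le> N \<and> dyad i0 (pk s) \<and>
     dyad i1 (gnorm (pd s)) \<and> dyad i2 (gnorm (pe s)) \<and> dyad i3 (gnorm (pg s)) \<and> dyad i4 (gnorm (ph s))})"

lemma fibre_bound:
  assumes Z: "Z \<ge> 1" and eta: "\<eta> \<ge> 0" and e: "e \<in> {1,2::nat}"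
    and F: "\<And>s. s \<in> F \<Longrightarrow> prim (z s) \<and> Z \<le> real (gnorm (z s)) \<and> real (gnorm (z s)) < 2 * Z"
    and near: "\<And>s. s \<in> F \<Longrightarrow> cmod (phi (z s) ^ e * w s - 1) \<le> 2 * \<eta>"
    and w1: "\<And>s. s \<in> F \<Longrightarrow> cmod (w s) = 1"
    and const: "\<And>s s'. s \<in> F \<Longrightarrow> s' \<in> F \<Longrightarrow> w s = w s'"
  shows "real (card (z ` F)) \<le> 80 * (\<eta> * Z + 1)"
proof (cases "F = {}")
  case True
  then show ?thesis using Z eta by simp
next
  case False
  then obtain s0 where s0: "s0 \<in> F" by auto
  have "real (card (z ` F)) \<le> 40 * (2 * \<eta> * Z) + 10"
  proof (rule phi_power_sector[OF Z _ e w1[OF s0]])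
    show "0 \<le> 2 * \<eta>" using eta by simp
    show "prim y \<and> Z \<le> real (gnorm y) \<and> real (gnorm y) < 2 * Z" if "y \<in> z ` F" for y using F that by auto
    show "cmod (phi y ^ e * w s0 - 1) \<le> 2 * \<eta>" if "y \<in> z ` F" for y
      using near const[OF _ s0] that by force
  qed
  then show ?thesis by simp
qed

lemma unit_product_near:
  assumes "cmod (x - 1) \<le> h" "cmod (y - 1) \<le> h" "cmod y = 1"
  shows "cmod (x * y - 1) \<le> 2 * h"
proof -
  have "x * y - 1 = (x - 1) * y + (y - 1)" by (simp add: algebra_simps)
  then have "cmod (x * y - 1) \<le> cmod ((x - 1) * y) + cmod (y - 1)" by (metis norm_triangle_ineq)
  also have "\<dots> \<le> 2 * h" using assms by (simp add: norm_mult)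
  finally show ?thesis .
qed

lemma cnj_near: "cmod (cnj x - 1) = cmod (x - 1)"
  by (metis complex_cnj_diff complex_cnj_one complex_mod_cnj)

text \<open>
  Both rotations are close to 1, so any two of the four Gaussian integers confine each of the other
  two to boundedly many thin sectors; the two fixed ones are chosen to be the two smallest.
\<close>

lemma Box_card:
  assumes M: "M > 0" "M\<^sup>2 \<le> 4 * N" and Q: "Q \<ge> 0" "Q ^ 3 = N * M ^ 4"
  shows "finite (Box N M I)" "real (card (Box N M I)) \<le> 16 ^ 3 * 80\<^sup>2 * 10 * Q"
proof -
  obtain i0 i1 i2 i3 i4 where I: "I = (i0, i1, i2, i3, i4)" by (metis prod_cases5)
  define B where "B = Box N M I"
  define K D E G H :: real where "K = 2 ^ i0" and "D = 2 ^ i1" and "E = 2 ^ i2" and "G = 2 ^ i3" and "H = 2 ^ i4"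
  note defs = K_def D_def E_def G_def H_def
  have ge1: "K \<ge> 1" "D \<ge> 1" "E \<ge> 1" "G \<ge> 1" "H \<ge> 1" unfolding defs by simp_all
  define P where "P = K * D * E * G * H"
  define \<eta> where "\<eta> = M / sqrt P"
  have P0: "P > 0" unfolding P_def using ge1 by simp
  have eta0: "\<eta> \<ge> 0" unfolding \<eta>_def using M P0 by simp
  let ?ball = "\<lambda>Z. {z. z \<in> gauss_ints \<and> real (gnorm z) < 2 * Z}"
  have mem: "valid M s" "real (tn s) \<le> N" "K \<le> real (pk s)" "real (pk s) < 2 * K"
     "D \<le> real (gnorm (pd s))" "real (gnorm (pd s)) < 2 * D" "E \<le> real (gnorm (pe s))" "real (gnorm (pe s)) < 2 * E"
     "G \<le> real (gnorm (pg s))" "real (gnorm (pg s)) < 2 * G" "H \<le> real (gnorm (ph s))" "real (gnorm (ph s)) < 2 * H"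
     "dyad i0 (pk s)"
    if "s \<in> B" for s
    using that dyad_real unfolding B_def I Box_def defs by auto
  have val: "pu s \<in> gauss_units" "pv s \<in> gauss_units" "prim (pd s)" "prim (pe s)" "prim (pg s)" "prim (ph s)"
    if "s \<in> B" for s using mem(1)[OF that] unfolding valid_def by auto
  have Pn: "P \<le> real (tn s)" if "s \<in> B" for s
  proof -
    have "P \<le> real (pk s) * real (gnorm (pd s)) * real (gnorm (pe s)) * real (gnorm (pg s)) * real (gnorm (ph s))"
      unfolding P_def using mem[OF that] ge1 by (intro mult_mono) auto
    then show ?thesis unfolding tn_def by simp
  qed
  have eta: "cmod (rot1 s - 1) \<le> \<eta>" "cmod (rot2 s - 1) \<le> \<eta>" if "s \<in> B" for s
  proof -
    have "M / sqrt (real (tn s)) \<le> \<eta>" unfolding \<eta>_def using Pn[OF that] P0 M by (intro divide_left_mono) auto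
    then show "cmod (rot1 s - 1) \<le> \<eta>" "cmod (rot2 s - 1) \<le> \<eta>" using mem(1)[OF that] unfolding valid_def by auto
  qed
  have c1: "cmod (phi (pd s)) = 1" "cmod (phi (pe s)) = 1" "cmod (phi (pg s)) = 1" "cmod (phi (ph s)) = 1"
     "cmod (pu s) = 1" "cmod (pv s) = 1" if "s \<in> B" for s
    using val[OF that] by (auto intro!: cmod_phi dest: prim_nonzero gauss_units_props(2))
  have cr: "cmod (rot1 s) = 1" "cmod (rot2 s) = 1" if "s \<in> B" for s
    unfolding rot1_def rot2_def using c1[OF that] by (simp_all add: norm_mult)
  have ee: "phi (pe s) * cnj (phi (pe s)) = 1" "phi (pd s) * cnj (phi (pd s)) = 1" if "s \<in> B" for s
    using c1[OF that] by (simp_all add: complex_norm_square[symmetric])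
  have R3: "cmod ((phi (pd s))\<^sup>2 * (pu s * pv s * phi (pg s) * phi (ph s)) - 1) \<le> 2 * \<eta>" if "s \<in> B" for s
  proof -
    have "rot1 s * rot2 s = (phi (pd s))\<^sup>2 * (pu s * pv s * phi (pg s) * phi (ph s)) * (phi (pe s) * cnj (phi (pe s)))"
      unfolding rot1_def rot2_def by (simp add: power2_eq_square mult_ac)
    then show ?thesis using unit_product_near[OF eta[OF that] cr(2)[OF that]] ee[OF that] by simp
  qed
  have R4: "cmod ((phi (pe s))\<^sup>2 * (pu s * cnj (pv s) * phi (pg s) * cnj (phi (ph s))) - 1) \<le> 2 * \<eta>" if "s \<in> B" for s
  proof -
    have "rot1 s * cnj (rot2 s) = (phi (pe s))\<^sup>2 * (pu s * cnj (pv s) * phi (pg s) * cnj (phi (ph s))) * (phi (pd s) * cnj (phi (pd s)))"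
      unfolding rot1_def rot2_def by (simp add: power2_eq_square mult_ac)
    moreover have "cmod (rot1 s * cnj (rot2 s) - 1) \<le> 2 * \<eta>"
      using eta[OF that] cr[OF that] by (intro unit_product_near) (simp_all add: cnj_near)
    ultimately show ?thesis using ee[OF that] by simp
  qed
  have R1: "cmod (rot1 s - 1) \<le> 2 * \<eta>" "cmod (rot2 s - 1) \<le> 2 * \<eta>" if "s \<in> B" for s
    using eta[OF that] eta0 by auto
  define X where "X = {m. dyad i0 m} \<times> gauss_units \<times> gauss_units"
  define kf where "kf s = (pk s, pu s, pv s)" for s
  have "{m. dyad i0 m} = {2 ^ i0..<2 ^ Suc i0}" by (auto simp: dyad_def)
  then have cd: "finite {m. dyad i0 m}" "card {m. dyad i0 m} = 2 ^ i0" by auto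
  have cu: "finite gauss_units" "card gauss_units = 4"
  proof -
    show "finite gauss_units" by (simp add: gauss_units_def)
    show "card gauss_units = 4" unfolding gauss_units_def
      by (subst card_insert_disjoint, auto simp: complex_eq_iff)+
  qed
  have X: "finite X" "kf ` B \<subseteq> X" "real (card X) \<le> 16 * K"
    unfolding X_def kf_def using cd cu val mem(13) by (auto simp: card_cartesian_product K_def)
  have balls: "pd ` B \<subseteq> ?ball D" "pe ` B \<subseteq> ?ball E" "pg ` B \<subseteq> ?ball G" "ph ` B \<subseteq> ?ball H"
    using mem val prim_gauss by auto
  have finB: "finite B"
  proof (rule finite_subset)
    show "B \<subseteq> {m. dyad i0 m} \<times> gauss_units \<times> gauss_units \<times> ?ball D \<times> ?ball E \<times> ?ball G \<times> ?ball H"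
    proof
      fix s assume s: "s \<in> B"
      have "s = (pk s, pu s, pv s, pd s, pe s, pg s, ph s)" by (cases s) (simp add: quad_proj)
      moreover have "(pk s, pu s, pv s, pd s, pe s, pg s, ph s) \<in>
        {m. dyad i0 m} \<times> gauss_units \<times> gauss_units \<times> ?ball D \<times> ?ball E \<times> ?ball G \<times> ?ball H"
        using mem(13)[OF s] val[OF s] balls s by blast
      ultimately show "s \<in> {m. dyad i0 m} \<times> gauss_units \<times> gauss_units \<times> ?ball D \<times> ?ball E \<times> ?ball G \<times> ?ball H" by simp
    qed
    show "finite ({m. dyad i0 m} \<times> gauss_units \<times> gauss_units \<times> ?ball D \<times> ?ball E \<times> ?ball G \<times> ?ball H)"
      by (intro finite_cartesian_product cd cu gnorm_ball(1) ge1)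
  qed
  then show "finite (Box N M I)" by (simp add: B_def)
  have core: "real (card B) \<le> 16 ^ 3 * 80\<^sup>2 * 10 * Q"
    if inj: "inj_on (\<lambda>s. (kf s, a s, b s, c s, d s)) B"
      and sub: "a ` B \<subseteq> ?ball Z3" "b ` B \<subseteq> ?ball Z4"
      and cnt: "\<And>k0 a0 b0. real (card (c ` {s \<in> B. kf s = k0 \<and> a s = a0 \<and> b s = b0})) \<le> 80 * (\<eta> * Z1 + 1)"
        "\<And>k0 a0 b0. real (card (d ` {s \<in> B. kf s = k0 \<and> a s = a0 \<and> b s = b0})) \<le> 80 * (\<eta> * Z2 + 1)"
      and num: "Z1 \<ge> 1" "Z2 \<ge> 1" "Z3 \<ge> 1" "Z4 \<ge> 1" "P = K * Z1 * Z2 * Z3 * Z4" "P \<le> N"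
        "Z3 \<le> Z1" "Z4 \<le> Z1" "Z3 \<le> Z2" "Z4 \<le> Z2"
        "K * Z1 \<le> 8 * M\<^sup>2 * Z2" "K * Z2 \<le> 8 * M\<^sup>2 * Z1" "K * Z3 \<le> 8 * M\<^sup>2" "K * Z4 \<le> 8 * M\<^sup>2"
    for a b c d :: "quad \<Rightarrow> complex" and Z1 Z2 Z3 Z4 :: real
  proof -
    have "real (card B) \<le> 16 * K * (16 * Z3) * (16 * Z4) * ((80 * (\<eta> * Z1 + 1)) * (80 * (\<eta> * Z2 + 1)))"
      by (rule fibre_card_le[OF finB inj X gnorm_ball(1)[OF num(3)] sub(1) gnorm_ball(2)[OF num(3)]
            gnorm_ball(1)[OF num(4)] sub(2) gnorm_ball(2)[OF num(4)] cnt])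
    also have "\<dots> = 16 ^ 3 * 80\<^sup>2 * (K * Z3 * Z4 * ((\<eta> * Z1 + 1) * (\<eta> * Z2 + 1)))"
    proof -
      have "16 * K * (16 * Z3) * (16 * Z4) * ((80 * x) * (80 * y)) = 16 ^ 3 * 80\<^sup>2 * (K * Z3 * Z4 * (x * y))" for x y :: real
        by (simp add: mult_ac)
      then show ?thesis .
    qed
    also have "\<dots> \<le> 16 ^ 3 * 80\<^sup>2 * (10 * Q)"
      by (intro mult_left_mono box_numeric[OF num(5) \<eta>_def ge1(1) num(1-4) M num(6) Q num(7-14)]) auto
    finally show ?thesis by simp
  qed
  have fb: "real (card (z ` F)) \<le> 80 * (\<eta> * Z + 1)"
    if "F \<subseteq> B" "Z \<ge> 1" "e \<in> {1,2::nat}" "\<And>s. s \<in> B \<Longrightarrow> prim (z s) \<and> Z \<le> real (gnorm (z s)) \<and> real (gnorm (z s)) < 2 * Z"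
      "\<And>s. s \<in> B \<Longrightarrow> cmod (phi (z s) ^ e * w s - 1) \<le> 2 * \<eta>" "\<And>s. s \<in> B \<Longrightarrow> cmod (w s) = 1"
      "\<And>s s'. s \<in> F \<Longrightarrow> s' \<in> F \<Longrightarrow> w s = w s'" for F z Z e w
  proof (rule fibre_bound[OF that(2) eta0 that(3)])
    fix s assume s: "s \<in> F"
    then have sB: "s \<in> B" using that(1) by blast
    show "prim (z s) \<and> Z \<le> real (gnorm (z s)) \<and> real (gnorm (z s)) < 2 * Z" by (rule that(4)[OF sB])
    show "cmod (phi (z s) ^ e * w s - 1) \<le> 2 * \<eta>" by (rule that(5)[OF sB])
    show "cmod (w s) = 1" by (rule that(6)[OF sB])
    show "w s = w s'" if "s' \<in> F" for s' by (rule \<open>\<And>s s'. s \<in> F \<Longrightarrow> s' \<in> F \<Longrightarrow> w s = w s'\<close>[OF s that])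
  qed
  have fd: "prim (pd s) \<and> D \<le> real (gnorm (pd s)) \<and> real (gnorm (pd s)) < 2 * D"
    and fe: "prim (pe s) \<and> E \<le> real (gnorm (pe s)) \<and> real (gnorm (pe s)) < 2 * E"
    and fg: "prim (pg s) \<and> G \<le> real (gnorm (pg s)) \<and> real (gnorm (pg s)) < 2 * G"
    and fh: "prim (ph s) \<and> H \<le> real (gnorm (ph s)) \<and> real (gnorm (ph s)) < 2 * H" if "s \<in> B" for s
    using mem[OF that] val[OF that] by auto
  note pds = fb[where z = pd and Z = D, OF _ ge1(2) _ fd] and pes = fb[where z = pe and Z = E, OF _ ge1(3) _ fe]
    and pgs = fb[where z = pg and Z = G, OF _ ge1(4) _ fg] and phs = fb[where z = ph and Z = H, OF _ ge1(5) _ fh]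
  have cn: "cmod (cnj (rot2 s) - 1) \<le> 2 * \<eta>" if "s \<in> B" for s using R1[OF that] by (simp add: cnj_near)
  have R4c: "cmod (cnj ((phi (pe s))\<^sup>2 * (pu s * cnj (pv s) * phi (pg s) * cnj (phi (ph s)))) - 1) \<le> 2 * \<eta>" if "s \<in> B" for s
    using R4[OF that] by (simp only: cnj_near)
  have D_eg: "real (card (pd ` {s \<in> B. kf s = k0 \<and> pe s = a0 \<and> pg s = b0})) \<le> 80 * (\<eta> * D + 1)" for k0 a0 b0
  proof (rule pds[where e = 1 and w = "\<lambda>s. pu s * phi (pe s) * phi (pg s)"])
    fix s assume s: "s \<in> B"
    show "cmod (phi (pd s) ^ 1 * (pu s * phi (pe s) * phi (pg s)) - 1) \<le> 2 * \<eta>" by (use R1(1)[OF s] in \<open>simp add: rot1_def mult_ac\<close>)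
    show "cmod (pu s * phi (pe s) * phi (pg s)) = 1" using c1[OF s] by (simp add: norm_mult norm_power)
  qed (auto simp: kf_def)
  have D_eh: "real (card (pd ` {s \<in> B. kf s = k0 \<and> pe s = a0 \<and> ph s = b0})) \<le> 80 * (\<eta> * D + 1)" for k0 a0 b0
  proof (rule pds[where e = 1 and w = "\<lambda>s. pv s * cnj (phi (pe s)) * phi (ph s)"])
    fix s assume s: "s \<in> B"
    show "cmod (phi (pd s) ^ 1 * (pv s * cnj (phi (pe s)) * phi (ph s)) - 1) \<le> 2 * \<eta>" by (use R1(2)[OF s] in \<open>simp add: rot2_def mult_ac\<close>)
    show "cmod (pv s * cnj (phi (pe s)) * phi (ph s)) = 1" using c1[OF s] by (simp add: norm_mult norm_power)
  qed (auto simp: kf_def)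
  have D_gh: "real (card (pd ` {s \<in> B. kf s = k0 \<and> pg s = a0 \<and> ph s = b0})) \<le> 80 * (\<eta> * D + 1)" for k0 a0 b0
  proof (rule pds[where e = 2 and w = "\<lambda>s. pu s * pv s * phi (pg s) * phi (ph s)"])
    fix s assume s: "s \<in> B"
    show "cmod (phi (pd s) ^ 2 * (pu s * pv s * phi (pg s) * phi (ph s)) - 1) \<le> 2 * \<eta>" by (rule R3[OF s])
    show "cmod (pu s * pv s * phi (pg s) * phi (ph s)) = 1" using c1[OF s] by (simp add: norm_mult norm_power)
  qed (auto simp: kf_def)
  have E_dg: "real (card (pe ` {s \<in> B. kf s = k0 \<and> pd s = a0 \<and> pg s = b0})) \<le> 80 * (\<eta> * E + 1)" for k0 a0 b0
  proof (rule pes[where e = 1 and w = "\<lambda>s. pu s * phi (pd s) * phi (pg s)"])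
    fix s assume s: "s \<in> B"
    show "cmod (phi (pe s) ^ 1 * (pu s * phi (pd s) * phi (pg s)) - 1) \<le> 2 * \<eta>" by (use R1(1)[OF s] in \<open>simp add: rot1_def mult_ac\<close>)
    show "cmod (pu s * phi (pd s) * phi (pg s)) = 1" using c1[OF s] by (simp add: norm_mult norm_power)
  qed (auto simp: kf_def)
  have E_dh: "real (card (pe ` {s \<in> B. kf s = k0 \<and> pd s = a0 \<and> ph s = b0})) \<le> 80 * (\<eta> * E + 1)" for k0 a0 b0
  proof (rule pes[where e = 1 and w = "\<lambda>s. cnj (pv s) * cnj (phi (pd s)) * cnj (phi (ph s))"])
    fix s assume s: "s \<in> B"
    show "cmod (phi (pe s) ^ 1 * (cnj (pv s) * cnj (phi (pd s)) * cnj (phi (ph s))) - 1) \<le> 2 * \<eta>" by (use cn[OF s] in \<open>simp add: rot2_def mult_ac\<close>)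
    show "cmod (cnj (pv s) * cnj (phi (pd s)) * cnj (phi (ph s))) = 1" using c1[OF s] by (simp add: norm_mult norm_power)
  qed (auto simp: kf_def)
  have E_gh: "real (card (pe ` {s \<in> B. kf s = k0 \<and> pg s = a0 \<and> ph s = b0})) \<le> 80 * (\<eta> * E + 1)" for k0 a0 b0
  proof (rule pes[where e = 2 and w = "\<lambda>s. pu s * cnj (pv s) * phi (pg s) * cnj (phi (ph s))"])
    fix s assume s: "s \<in> B"
    show "cmod (phi (pe s) ^ 2 * (pu s * cnj (pv s) * phi (pg s) * cnj (phi (ph s))) - 1) \<le> 2 * \<eta>" by (rule R4[OF s])
    show "cmod (pu s * cnj (pv s) * phi (pg s) * cnj (phi (ph s))) = 1" using c1[OF s] by (simp add: norm_mult norm_power)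
  qed (auto simp: kf_def)
  have G_de: "real (card (pg ` {s \<in> B. kf s = k0 \<and> pd s = a0 \<and> pe s = b0})) \<le> 80 * (\<eta> * G + 1)" for k0 a0 b0
  proof (rule pgs[where e = 1 and w = "\<lambda>s. pu s * phi (pd s) * phi (pe s)"])
    fix s assume s: "s \<in> B"
    show "cmod (phi (pg s) ^ 1 * (pu s * phi (pd s) * phi (pe s)) - 1) \<le> 2 * \<eta>" by (use R1(1)[OF s] in \<open>simp add: rot1_def mult_ac\<close>)
    show "cmod (pu s * phi (pd s) * phi (pe s)) = 1" using c1[OF s] by (simp add: norm_mult norm_power)
  qed (auto simp: kf_def)
  have G_dh: "real (card (pg ` {s \<in> B. kf s = k0 \<and> pd s = a0 \<and> ph s = b0})) \<le> 80 * (\<eta> * G + 1)" for k0 a0 b0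
  proof (rule pgs[where e = 1 and w = "\<lambda>s. (phi (pd s))\<^sup>2 * (pu s * pv s * phi (ph s))"])
    fix s assume s: "s \<in> B"
    show "cmod (phi (pg s) ^ 1 * ((phi (pd s))\<^sup>2 * (pu s * pv s * phi (ph s))) - 1) \<le> 2 * \<eta>" by (use R3[OF s] in \<open>simp add:  mult_ac\<close>)
    show "cmod ((phi (pd s))\<^sup>2 * (pu s * pv s * phi (ph s))) = 1" using c1[OF s] by (simp add: norm_mult norm_power)
  qed (auto simp: kf_def)
  have G_eh: "real (card (pg ` {s \<in> B. kf s = k0 \<and> pe s = a0 \<and> ph s = b0})) \<le> 80 * (\<eta> * G + 1)" for k0 a0 b0
  proof (rule pgs[where e = 1 and w = "\<lambda>s. (phi (pe s))\<^sup>2 * (pu s * cnj (pv s) * cnj (phi (ph s)))"])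
    fix s assume s: "s \<in> B"
    show "cmod (phi (pg s) ^ 1 * ((phi (pe s))\<^sup>2 * (pu s * cnj (pv s) * cnj (phi (ph s)))) - 1) \<le> 2 * \<eta>" by (use R4[OF s] in \<open>simp add:  mult_ac\<close>)
    show "cmod ((phi (pe s))\<^sup>2 * (pu s * cnj (pv s) * cnj (phi (ph s)))) = 1" using c1[OF s] by (simp add: norm_mult norm_power)
  qed (auto simp: kf_def)
  have H_de: "real (card (ph ` {s \<in> B. kf s = k0 \<and> pd s = a0 \<and> pe s = b0})) \<le> 80 * (\<eta> * H + 1)" for k0 a0 b0
  proof (rule phs[where e = 1 and w = "\<lambda>s. pv s * phi (pd s) * cnj (phi (pe s))"])
    fix s assume s: "s \<in> B"
    show "cmod (phi (ph s) ^ 1 * (pv s * phi (pd s) * cnj (phi (pe s))) - 1) \<le> 2 * \<eta>" by (use R1(2)[OF s] in \<open>simp add: rot2_def mult_ac\<close>)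
    show "cmod (pv s * phi (pd s) * cnj (phi (pe s))) = 1" using c1[OF s] by (simp add: norm_mult norm_power)
  qed (auto simp: kf_def)
  have H_dg: "real (card (ph ` {s \<in> B. kf s = k0 \<and> pd s = a0 \<and> pg s = b0})) \<le> 80 * (\<eta> * H + 1)" for k0 a0 b0
  proof (rule phs[where e = 1 and w = "\<lambda>s. (phi (pd s))\<^sup>2 * (pu s * pv s * phi (pg s))"])
    fix s assume s: "s \<in> B"
    show "cmod (phi (ph s) ^ 1 * ((phi (pd s))\<^sup>2 * (pu s * pv s * phi (pg s))) - 1) \<le> 2 * \<eta>" by (use R3[OF s] in \<open>simp add:  mult_ac\<close>)
    show "cmod ((phi (pd s))\<^sup>2 * (pu s * pv s * phi (pg s))) = 1" using c1[OF s] by (simp add: norm_mult norm_power)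
  qed (auto simp: kf_def)
  have H_eg: "real (card (ph ` {s \<in> B. kf s = k0 \<and> pe s = a0 \<and> pg s = b0})) \<le> 80 * (\<eta> * H + 1)" for k0 a0 b0
  proof (rule phs[where e = 1 and w = "\<lambda>s. (cnj (phi (pe s)))\<^sup>2 * (cnj (pu s) * pv s * cnj (phi (pg s)))"])
    fix s assume s: "s \<in> B"
    show "cmod (phi (ph s) ^ 1 * ((cnj (phi (pe s)))\<^sup>2 * (cnj (pu s) * pv s * cnj (phi (pg s)))) - 1) \<le> 2 * \<eta>" by (use R4c[OF s] in \<open>simp add:  mult_ac\<close>)
    show "cmod ((cnj (phi (pe s)))\<^sup>2 * (cnj (pu s) * pv s * cnj (phi (pg s)))) = 1" using c1[OF s] by (simp add: norm_mult norm_power)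
  qed (auto simp: kf_def)
  have "real (card B) \<le> 16 ^ 3 * 80\<^sup>2 * 10 * Q"
  proof (cases "B = {}")
    case True
    then show ?thesis using Q by simp
  next
    case False
    then obtain s where s: "s \<in> B" by auto
    have PN: "P \<le> N" using Pn[OF s] mem(2)[OF s] by linarith
    note m = mem[OF s]
    have v: "real (pk s) * real (gnorm (pg s)) \<le> M\<^sup>2" "real (pk s) * real (gnorm (ph s)) \<le> M\<^sup>2"
     "real (pk s) * real (gnorm (pd s)) \<le> 4 * M\<^sup>2 * real (gnorm (pe s))"
     "real (pk s) * real (gnorm (pe s)) \<le> 4 * M\<^sup>2 * real (gnorm (pd s))"
      using m(1) unfolding valid_def by auto
    have up: "4 * M\<^sup>2 * y \<le> 8 * M\<^sup>2 * x" if "y < 2 * x" for x y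
    proof -
      have "4 * M\<^sup>2 * y \<le> 4 * M\<^sup>2 * (2 * x)" using that by (intro mult_left_mono) auto
      then show ?thesis by simp
    qed
    have M8: "M\<^sup>2 \<le> 8 * M\<^sup>2" by simp
    have KD: "K * D \<le> 8 * M\<^sup>2 * E"
    proof -
      have "K * D \<le> real (pk s) * real (gnorm (pd s))" using m ge1 by (intro mult_mono) auto
      then show ?thesis using v(3) up[OF m(8)] by linarith
    qed
    have KE: "K * E \<le> 8 * M\<^sup>2 * D"
    proof -
      have "K * E \<le> real (pk s) * real (gnorm (pe s))" using m ge1 by (intro mult_mono) auto
      then show ?thesis using v(4) up[OF m(6)] by linarith
    qed
    have KG: "K * G \<le> 8 * M\<^sup>2"
    proof -
      have "K * G \<le> real (pk s) * real (gnorm (pg s))" using m ge1 by (intro mult_mono) auto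
      then show ?thesis using v(1) M8 by linarith
    qed
    have KH: "K * H \<le> 8 * M\<^sup>2"
    proof -
      have "K * H \<le> real (pk s) * real (gnorm (ph s))" using m ge1 by (intro mult_mono) auto
      then show ?thesis using v(2) M8 by linarith
    qed
    have m1: "8 * M\<^sup>2 * x \<le> 8 * M\<^sup>2 * y" if "x \<le> y" for x y using that by (intro mult_left_mono) auto
    have m2: "8 * M\<^sup>2 \<le> 8 * M\<^sup>2 * x" if "1 \<le> x" for x using m1[OF that] by simp
    have m3: "K * x \<le> K * y" if "x \<le> y" for x y using that ge1 by (intro mult_left_mono) auto
    have inj: "inj_on (\<lambda>s. (kf s, pd s, pe s, pg s, ph s)) B"
      by (rule inj_onI, rule quad_eqI) (simp_all add: kf_def)
    have PP: "P = K * G * H * D * E" "P = K * E * H * D * G" "P = K * E * G * D * H"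
      "P = K * D * H * E * G" "P = K * D * G * E * H" "P = K * D * E * G * H"
      unfolding P_def by (simp_all add: mult_ac)
    consider "D \<le> G" "D \<le> H" "E \<le> G" "E \<le> H" | "D \<le> E" "D \<le> H" "G \<le> E" "G \<le> H"
      | "D \<le> E" "D \<le> G" "H \<le> E" "H \<le> G" | "E \<le> D" "E \<le> H" "G \<le> D" "G \<le> H"
      | "E \<le> D" "E \<le> G" "H \<le> D" "H \<le> G" | "G \<le> D" "G \<le> E" "H \<le> D" "H \<le> E"
      by (smt (verit))
    then show ?thesis
    proof cases
      case 1
      show ?thesis
      proof (rule core[where a = pd and b = pe and c = pg and d = ph and ?Z1.0 = G and ?Z2.0 = H and ?Z3.0 = D and ?Z4.0 = E])
        show "inj_on (\<lambda>s. (kf s, pd s, pe s, pg s, ph s)) B" using inj by (auto simp: inj_on_def)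
        show "pd ` B \<subseteq> ?ball D" "pe ` B \<subseteq> ?ball E" by (rule balls)+
        show "real (card (pg ` {s \<in> B. kf s = k0 \<and> pd s = a0 \<and> pe s = b0})) \<le> 80 * (\<eta> * G + 1)" for k0 a0 b0
          by (rule G_de)
        show "real (card (ph ` {s \<in> B. kf s = k0 \<and> pd s = a0 \<and> pe s = b0})) \<le> 80 * (\<eta> * H + 1)" for k0 a0 b0
          by (rule H_de)
        show "G \<ge> 1" "H \<ge> 1" "D \<ge> 1" "E \<ge> 1" "P = K * G * H * D * E" "P \<le> N"
          by (rule ge1 PP PN)+
        show "D \<le> G" "E \<le> G" "D \<le> H" "E \<le> H" by (rule 1)+
        show "K * G \<le> 8 * M\<^sup>2 * H" "K * H \<le> 8 * M\<^sup>2 * G" "K * D \<le> 8 * M\<^sup>2" "K * E \<le> 8 * M\<^sup>2"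
          using KG KH m2[OF ge1(4)] m2[OF ge1(5)] m3[OF 1(1)] m3[OF 1(3)] by linarith+
      qed
    next
      case 2
      show ?thesis
      proof (rule core[where a = pd and b = pg and c = pe and d = ph and ?Z1.0 = E and ?Z2.0 = H and ?Z3.0 = D and ?Z4.0 = G])
        show "inj_on (\<lambda>s. (kf s, pd s, pg s, pe s, ph s)) B" using inj by (auto simp: inj_on_def)
        show "pd ` B \<subseteq> ?ball D" "pg ` B \<subseteq> ?ball G" by (rule balls)+
        show "real (card (pe ` {s \<in> B. kf s = k0 \<and> pd s = a0 \<and> pg s = b0})) \<le> 80 * (\<eta> * E + 1)" for k0 a0 b0
          by (rule E_dg)
        show "real (card (ph ` {s \<in> B. kf s = k0 \<and> pd s = a0 \<and> pg s = b0})) \<le> 80 * (\<eta> * H + 1)" for k0 a0 b0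
          by (rule H_dg)
        show "E \<ge> 1" "H \<ge> 1" "D \<ge> 1" "G \<ge> 1" "P = K * E * H * D * G" "P \<le> N"
          by (rule ge1 PP PN)+
        show "D \<le> E" "G \<le> E" "D \<le> H" "G \<le> H" by (rule 2)+
        show "K * E \<le> 8 * M\<^sup>2 * H" "K * H \<le> 8 * M\<^sup>2 * E" "K * D \<le> 8 * M\<^sup>2" "K * G \<le> 8 * M\<^sup>2"
          using KE KG KH m1[OF 2(2)] m2[OF ge1(3)] m3[OF 2(2)] by linarith+
      qed
    next
      case 3
      show ?thesis
      proof (rule core[where a = pd and b = ph and c = pe and d = pg and ?Z1.0 = E and ?Z2.0 = G and ?Z3.0 = D and ?Z4.0 = H])
        show "inj_on (\<lambda>s. (kf s, pd s, ph s, pe s, pg s)) B" using inj by (auto simp: inj_on_def)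
        show "pd ` B \<subseteq> ?ball D" "ph ` B \<subseteq> ?ball H" by (rule balls)+
        show "real (card (pe ` {s \<in> B. kf s = k0 \<and> pd s = a0 \<and> ph s = b0})) \<le> 80 * (\<eta> * E + 1)" for k0 a0 b0
          by (rule E_dh)
        show "real (card (pg ` {s \<in> B. kf s = k0 \<and> pd s = a0 \<and> ph s = b0})) \<le> 80 * (\<eta> * G + 1)" for k0 a0 b0
          by (rule G_dh)
        show "E \<ge> 1" "G \<ge> 1" "D \<ge> 1" "H \<ge> 1" "P = K * E * G * D * H" "P \<le> N"
          by (rule ge1 PP PN)+
        show "D \<le> E" "H \<le> E" "D \<le> G" "H \<le> G" by (rule 3)+
        show "K * E \<le> 8 * M\<^sup>2 * G" "K * G \<le> 8 * M\<^sup>2 * E" "K * D \<le> 8 * M\<^sup>2" "K * H \<le> 8 * M\<^sup>2"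
          using KE KG KH m1[OF 3(2)] m2[OF ge1(3)] m3[OF 3(2)] by linarith+
      qed
    next
      case 4
      show ?thesis
      proof (rule core[where a = pe and b = pg and c = pd and d = ph and ?Z1.0 = D and ?Z2.0 = H and ?Z3.0 = E and ?Z4.0 = G])
        show "inj_on (\<lambda>s. (kf s, pe s, pg s, pd s, ph s)) B" using inj by (auto simp: inj_on_def)
        show "pe ` B \<subseteq> ?ball E" "pg ` B \<subseteq> ?ball G" by (rule balls)+
        show "real (card (pd ` {s \<in> B. kf s = k0 \<and> pe s = a0 \<and> pg s = b0})) \<le> 80 * (\<eta> * D + 1)" for k0 a0 b0
          by (rule D_eg)
        show "real (card (ph ` {s \<in> B. kf s = k0 \<and> pe s = a0 \<and> pg s = b0})) \<le> 80 * (\<eta> * H + 1)" for k0 a0 b0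
          by (rule H_eg)
        show "D \<ge> 1" "H \<ge> 1" "E \<ge> 1" "G \<ge> 1" "P = K * D * H * E * G" "P \<le> N"
          by (rule ge1 PP PN)+
        show "E \<le> D" "G \<le> D" "E \<le> H" "G \<le> H" by (rule 4)+
        show "K * D \<le> 8 * M\<^sup>2 * H" "K * H \<le> 8 * M\<^sup>2 * D" "K * E \<le> 8 * M\<^sup>2" "K * G \<le> 8 * M\<^sup>2"
          using KD KG KH m1[OF 4(2)] m2[OF ge1(2)] m3[OF 4(2)] by linarith+
      qed
    next
      case 5
      show ?thesis
      proof (rule core[where a = pe and b = ph and c = pd and d = pg and ?Z1.0 = D and ?Z2.0 = G and ?Z3.0 = E and ?Z4.0 = H])
        show "inj_on (\<lambda>s. (kf s, pe s, ph s, pd s, pg s)) B" using inj by (auto simp: inj_on_def)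
        show "pe ` B \<subseteq> ?ball E" "ph ` B \<subseteq> ?ball H" by (rule balls)+
        show "real (card (pd ` {s \<in> B. kf s = k0 \<and> pe s = a0 \<and> ph s = b0})) \<le> 80 * (\<eta> * D + 1)" for k0 a0 b0
          by (rule D_eh)
        show "real (card (pg ` {s \<in> B. kf s = k0 \<and> pe s = a0 \<and> ph s = b0})) \<le> 80 * (\<eta> * G + 1)" for k0 a0 b0
          by (rule G_eh)
        show "D \<ge> 1" "G \<ge> 1" "E \<ge> 1" "H \<ge> 1" "P = K * D * G * E * H" "P \<le> N"
          by (rule ge1 PP PN)+
        show "E \<le> D" "H \<le> D" "E \<le> G" "H \<le> G" by (rule 5)+
        show "K * D \<le> 8 * M\<^sup>2 * G" "K * G \<le> 8 * M\<^sup>2 * D" "K * E \<le> 8 * M\<^sup>2" "K * H \<le> 8 * M\<^sup>2"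
          using KD KG KH m1[OF 5(2)] m2[OF ge1(2)] m3[OF 5(2)] by linarith+
      qed
    next
      case 6
      show ?thesis
      proof (rule core[where a = pg and b = ph and c = pd and d = pe and ?Z1.0 = D and ?Z2.0 = E and ?Z3.0 = G and ?Z4.0 = H])
        show "inj_on (\<lambda>s. (kf s, pg s, ph s, pd s, pe s)) B" using inj by (auto simp: inj_on_def)
        show "pg ` B \<subseteq> ?ball G" "ph ` B \<subseteq> ?ball H" by (rule balls)+
        show "real (card (pd ` {s \<in> B. kf s = k0 \<and> pg s = a0 \<and> ph s = b0})) \<le> 80 * (\<eta> * D + 1)" for k0 a0 b0
          by (rule D_gh)
        show "real (card (pe ` {s \<in> B. kf s = k0 \<and> pg s = a0 \<and> ph s = b0})) \<le> 80 * (\<eta> * E + 1)" for k0 a0 b0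
          by (rule E_gh)
        show "D \<ge> 1" "E \<ge> 1" "G \<ge> 1" "H \<ge> 1" "P = K * D * E * G * H" "P \<le> N"
          by (rule ge1 PP PN)+
        show "G \<le> D" "H \<le> D" "G \<le> E" "H \<le> E" by (rule 6)+
        show "K * D \<le> 8 * M\<^sup>2 * E" "K * E \<le> 8 * M\<^sup>2 * D" "K * G \<le> 8 * M\<^sup>2" "K * H \<le> 8 * M\<^sup>2"
          using KD KE KG KH by linarith+
      qed
    qed
  qed
  then show "real (card (Box N M I)) \<le> 16 ^ 3 * 80\<^sup>2 * 10 * Q" by (simp add: B_def)
qed

lemma choose_two_le_pairs:
  fixes R :: "'a set"
  shows "real (card R choose 2) \<le> real (card {(x, y). x \<in> R \<and> y \<in> R \<and> x \<noteq> y})"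
proof (cases "finite R")
  case True
  have "{(x, y). x \<in> R \<and> y \<in> R \<and> x \<noteq> y} = R \<times> R - (\<lambda>x. (x, x)) ` R" by auto
  moreover have "card (R \<times> R - (\<lambda>x. (x, x)) ` R) = card (R \<times> R) - card ((\<lambda>x. (x, x)) ` R)"
    using True by (intro card_Diff_subset) auto
  moreover have "card ((\<lambda>x. (x, x)) ` R) = card R" by (intro card_image) (auto simp: inj_on_def)
  ultimately have "card {(x, y). x \<in> R \<and> y \<in> R \<and> x \<noteq> y} = card R * (card R - 1)"
    by (simp add: card_cartesian_product diff_mult_distrib2)
  moreover have "card R choose 2 \<le> card R * (card R - 1)" by (simp add: choose_two)
  ultimately show ?thesis by (simp only: of_nat_le_iff)
qed (simp add: binomial_eq_0)

lemma sum_choose_two_le: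
  assumes M: "M > 0" "M \<le> 2 * sqrt N" and N: "N \<ge> 1"
    and Q: "Q \<ge> 0" "Q ^ 3 = N * M ^ 4" and L: "N < 2 ^ Suc L"
  shows "(\<Sum>n | 1 \<le> n \<and> real n \<le> N. real (card (A_family n M) choose 2)) \<le> (real L + 1) ^ 5 * (16 ^ 3 * 80\<^sup>2 * 10 * Q)"
proof -
  define I where "I = {..L} \<times> {..L} \<times> {..L} \<times> {..L} \<times> {..L}"
  define U where "U = (\<Union>i\<in>I. Box N M i)"
  define D where "D = {n. 1 \<le> n \<and> real n \<le> N}"
  define PP where "PP n = {(x, y). x \<in> Rset n M \<and> y \<in> Rset n M \<and> x \<noteq> y}" for n
  define res where "res s = (tn s, Re (rot1 s), Re (rot2 s))" for s
  have MN: "M\<^sup>2 \<le> 4 * N" using power_mono[OF M(2), of 2] M N by (simp add: power_mult_distrib)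
  note box = Box_card[OF M(1) MN Q]
  have finD: "finite D" unfolding D_def by (rule finite_nat_le_real)
  have finI: "finite I" "card I = (L + 1) ^ 5" unfolding I_def
    by (simp_all add: card_cartesian_product eval_nat_numeral)
  have finU: "finite U" unfolding U_def using finI box by blast
  have sub: "Sigma D PP \<subseteq> res ` U"
  proof
    fix t assume "t \<in> Sigma D PP"
    then obtain n r1 r2 where t: "t = (n, r1, r2)" "n \<ge> 1" "real n \<le> N" "r1 \<in> Rset n M" "r2 \<in> Rset n M" "r1 \<noteq> r2"
      unfolding D_def PP_def by auto
    obtain s where s: "valid M s" "tn s = n" "Re (rot1 s) = r1" "Re (rot2 s) = r2"
      using pair_decomposition[OF t(2,4,5,6)] by blast
    have "tn s \<ge> 1" using s t by simp
    have ge: "pk s \<ge> 1" "gnorm (pd s) \<ge> 1" "gnorm (pe s) \<ge> 1" "gnorm (pg s) \<ge> 1" "gnorm (ph s) \<ge> 1"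
      using \<open>tn s \<ge> 1\<close> unfolding tn_def by (auto simp: Suc_le_eq)
    have dvd: "pk s dvd tn s" "gnorm (pd s) dvd tn s" "gnorm (pe s) dvd tn s" "gnorm (pg s) dvd tn s" "gnorm (ph s) dvd tn s"
      unfolding tn_def by auto
    have dy: "\<exists>i\<in>{..L}. dyad i m" if m: "m \<ge> 1" "m dvd tn s" for m
    proof -
      obtain i where i: "dyad i m" by (rule dyadE[OF m(1)])
      have "m \<le> n" using m s t by (auto dest: dvd_imp_le)
      then have "(2::real) ^ i \<le> real n" using dyad_real[OF i] by (meson of_nat_mono order.trans)
      then have "(2::real) ^ i < 2 ^ Suc L" using t(3) L by linarith
      then have "i < Suc L" by (rule power_less_imp_less_exp[rotated]) simp
      then show ?thesis using i by auto
    qed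
    obtain i0 i1 i2 i3 i4 where "i0 \<in> {..L}" "i1 \<in> {..L}" "i2 \<in> {..L}" "i3 \<in> {..L}" "i4 \<in> {..L}"
      "dyad i0 (pk s)" "dyad i1 (gnorm (pd s))" "dyad i2 (gnorm (pe s))" "dyad i3 (gnorm (pg s))" "dyad i4 (gnorm (ph s))"
      using dy[OF ge(1) dvd(1)] dy[OF ge(2) dvd(2)] dy[OF ge(3) dvd(3)] dy[OF ge(4) dvd(4)] dy[OF ge(5) dvd(5)] by blast
    then have "s \<in> Box N M (i0, i1, i2, i3, i4)" "(i0, i1, i2, i3, i4) \<in> I"
      unfolding Box_def I_def using s t by auto
    then have "s \<in> U" unfolding U_def by blast
    then show "t \<in> res ` U" unfolding t res_def using s by force
  qed
  have finS: "finite (Sigma D PP)" using sub finU by (meson finite_imageI finite_subset)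
  have finPP: "finite (PP n)" if "n \<in> D" for n
  proof -
    have "Pair n ` PP n \<subseteq> Sigma D PP" using that by auto
    then have "finite (Pair n ` PP n)" using finS by (rule finite_subset)
    then show ?thesis by (rule finite_imageD) (auto simp: inj_on_def)
  qed
  have "(\<Sum>n\<in>D. real (card (A_family n M) choose 2)) \<le> (\<Sum>n\<in>D. real (card (PP n)))"
  proof (intro sum_mono)
    fix n assume "n \<in> D"
    then have "card (A_family n M) = card (Rset n M)" unfolding D_def by (intro card_A_family) auto
    then show "real (card (A_family n M) choose 2) \<le> real (card (PP n))"
      unfolding PP_def using choose_two_le_pairs[of "Rset n M"] by simp
  qed
  also have "\<dots> = real (card (Sigma D PP))" using finD finPP by (subst card_SigmaI) auto
  also have "\<dots> \<le> real (card (res ` U))" using sub finU by (intro of_nat_mono card_mono) auto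
  also have "\<dots> \<le> real (card U)" using finU by (intro of_nat_mono card_image_le)
  also have "\<dots> \<le> real (\<Sum>i\<in>I. card (Box N M i))" unfolding U_def using finI by (intro of_nat_mono card_UN_le)
  also have "\<dots> = (\<Sum>i\<in>I. real (card (Box N M i)))" by simp
  also have "\<dots> \<le> (\<Sum>i\<in>I. 16 ^ 3 * 80\<^sup>2 * 10 * Q)" by (intro sum_mono box)
  also have "\<dots> = (real L + 1) ^ 5 * (16 ^ 3 * 80\<^sup>2 * 10 * Q)" using finI by (simp add: add.commute)
  finally show ?thesis unfolding D_def .
qed

lemma sum_choose_two_A_family:
  "\<exists>(C :: real) (N0 :: real).
        \<forall>N M :: real. N \<ge> N0 \<longrightarrow> 0 < M \<longrightarrow> M \<le> 2 * sqrt N \<longrightarrow>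
          (\<Sum>n | 1 \<le> n \<and> real n \<le> N. real (card (A_family n M) choose 2)) \<le>
            C * (N powr (1/3) * M powr (4/3) * (ln N) ^ 6 + sqrt N * (ln N) ^ 3)"
proof (rule exI[of _ "3 ^ 5 * (16 ^ 3 * 80\<^sup>2 * 10)"], rule exI[of _ "3 :: real"], intro allI impI)
  fix N M :: real assume N: "N \<ge> 3" and M: "0 < M" "M \<le> 2 * sqrt N"
  define Q where "Q = N powr (1/3) * M powr (4/3)"
  have Q0: "Q \<ge> 0" by (simp add: Q_def)
  have Q3: "Q ^ 3 = N * M ^ 4"
  proof -
    have "(N powr (1/3)) ^ 3 = N" using N by (simp add: powr_power)
    moreover have "(M powr (4/3)) ^ 3 = M ^ 4"
      using M by (simp add: powr_power)
    ultimately show ?thesis by (simp add: Q_def power_mult_distrib)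
  qed
  define l where "l = ln N"
  have l1: "l \<ge> 1"
  proof -
    have "exp 1 \<le> N" using exp_le N by linarith
    then have "ln (exp 1) \<le> ln N" by (intro ln_mono) auto
    then show ?thesis by (simp add: l_def)
  qed
  define L where "L = nat \<lfloor>log 2 N\<rfloor>"
  have lg: "log 2 N \<ge> 0" using N by simp
  have "log 2 N < real L + 1" unfolding L_def using lg by linarith
  then have "N < 2 powr (real L + 1)" using N by (subst (asm) log_less_iff) auto
  also have "\<dots> = 2 ^ Suc L" by (simp add: powr_add powr_realpow)
  finally have NL: "N < 2 ^ Suc L" .
  have L: "real L + 1 \<le> 3 * l"
  proof -
    have "real L \<le> log 2 N" unfolding L_def using lg by linarith
    also have "\<dots> = l / ln 2" by (simp add: log_def l_def)
    also have "\<dots> \<le> l / (1 / 2)" using l1 ln2_ge_two_thirds by (intro divide_left_mono) auto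
    finally show ?thesis using l1 by simp
  qed
  have "(\<Sum>n | 1 \<le> n \<and> real n \<le> N. real (card (A_family n M) choose 2)) \<le> (real L + 1) ^ 5 * (16 ^ 3 * 80\<^sup>2 * 10 * Q)"
    using N by (intro sum_choose_two_le[OF M _ Q0 Q3 NL]) auto
  also have "\<dots> \<le> (3 * l) ^ 5 * (16 ^ 3 * 80\<^sup>2 * 10 * Q)" using L Q0 by (intro mult_right_mono power_mono) auto
  also have "\<dots> = 3 ^ 5 * (16 ^ 3 * 80\<^sup>2 * 10) * (Q * l ^ 5)" by (simp add: power_mult_distrib)
  also have "\<dots> \<le> 3 ^ 5 * (16 ^ 3 * 80\<^sup>2 * 10) * (Q * l ^ 6 + sqrt N * l ^ 3)"
  proof (intro mult_left_mono)
    have "Q * l ^ 5 \<le> Q * l ^ 6" using Q0 l1 by (intro mult_left_mono power_increasing) auto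
    moreover have "0 \<le> sqrt N * l ^ 3" using N l1 by simp
    ultimately show "Q * l ^ 5 \<le> Q * l ^ 6 + sqrt N * l ^ 3" by linarith
  qed simp
  finally show "(\<Sum>n | 1 \<le> n \<and> real n \<le> N. real (card (A_family n M) choose 2)) \<le>
     3 ^ 5 * (16 ^ 3 * 80\<^sup>2 * 10) * (N powr (1/3) * M powr (4/3) * (ln N) ^ 6 + sqrt N * (ln N) ^ 3)"
    unfolding Q_def l_def .
qed

theorem theorem6p2:
  shows
    "(\<exists>(E :: real \<Rightarrow> real \<Rightarrow> real) (C :: real) (N0 :: real).
        \<forall>N M :: real. N \<ge> N0 \<longrightarrow> 1 \<le> M \<longrightarrow> M \<le> 2 * sqrt N \<longrightarrow>
          \<bar>E N M\<bar> \<le> C \<and>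
          (\<Sum>n | 1 \<le> n \<and> real n \<le> N. real (card (A_family n M))) =
            kappa' / 2 * I_fun (M\<^sup>2 / (4 * N)) * M * sqrt N * (sqrt (2 * ln M) + E N M)) \<and>
     (\<exists>(C :: real) (N0 :: real).
        \<forall>N M :: real. N \<ge> N0 \<longrightarrow> 0 < M \<longrightarrow> M \<le> 2 * sqrt N \<longrightarrow>
          (\<Sum>n | 1 \<le> n \<and> real n \<le> N. real (card (A_family n M) choose 2)) \<le>
            C * (N powr (1/3) * M powr (4/3) * (ln N) ^ 6 + sqrt N * (ln N) ^ 3))"
  by (rule conjI[OF sum_card_A_family_asymptotic sum_choose_two_A_family])

end
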